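(* Let $s>0$ be an integer and consider the sequence of active random intersection graphs $G_s(n,m,P)$, $n=1,2,\dots$, with $m=m_n$, $P=P_n$. Let $m,n\to\infty$. Assume that $Z_1=\binom{m}{s}^{-1/2}n^{1/2}\binom{X_1}{s}$ converges in distribution to a random variable $Z$, and that $\binom{m}{s}n^{-1}\to\beta$ for some $\beta\in(0,+\infty)$. (1) If $0<\mathbf{E}Z^3<\infty$ and $\lim_{n\to\infty}\mathbf{E}Z_1^3=\mathbf{E}Z^3$, then $$r=\frac{a_1}{\beta^{-1}(a_1a_3-a_2^2)+a_2}+o(1)$$ and $$r=\frac{1}{\sqrt{\beta}}\,\frac{\overline{\delta}_1^{5/2}}{\overline{\delta}_3\overline{\delta}_1-\overline{\delta}_2^2+\overline{\delta}_2\overline{\delta}_1}+o(1).$$ (2) If $0<\mathbf{E}Z^2<\infty$, $\lim_{n\to\infty}\mathbf{E}Z_1^2=\mathbf{E}Z^2$ and $\mathbf{E}Z^3=\infty$, then $r=o(1)$.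
   Context: Active random intersection graph $G_s(n,m,P)$: let $W=\{w_1,\dots,w_m\}$ and let $P$ be a probability distribution on $\{0,1,\dots,m\}$. Let $D_1,\dots,D_n$ be independent identically distributed random subsets of $W$ with $\mathbf{P}(D_i=A)=\binom{m}{|A|}^{-1}P(|A|)$ for each $A\subset W$. Put $X_i=|D_i|$ (so $X_1,\dots,X_n$ are i.i.d. with distribution $P$). The vertex set is $\{v_1,\dots,v_n\}$, and distinct $v_i,v_j$ are adjacent, $v_i\sim v_j$, iff $|D_i\cap D_j|\ge s$. The integer $s$ is fixed while $m=m_n$ and $P=P_n$ depend on $n$. Assortativity coefficient: $d(v)$ denotes the degree of $v$. Let $(v_1^*,v_2^* )$ be an ordered pair of distinct vertices drawn uniformly at random, independently of the random graph, and let $\mathbf{E}^*$ denote conditional expectation given the event $v_1^*\sim v_2^*$ (with respect to both the random graph and the random pair). Then $$r=\frac{g-b^2}{b'-b^2},\qquad g=\mathbf{E}^*d(v_1^* )d(v_2^* ),\quad b=\mathbf{E}^*d(v_1^* ),\quad b'=\mathbf{E}^*d^2(v_1^* ).$$ Notation: $a_k=\mathbf{E}\binom{X_1}{s}^k$ (depends on $n$). Let $z_1=\mathbf{E}Z$ and let $d_*$ be a random variable with $\mathbf{P}(d_*=k)=p_k=(k!)^{-1}\mathbf{E}\left((z_1Z)^ke^{-z_1Z}\right)$, $k=0,1,\dots$. Then $\overline{\delta}_i=\mathbf{E}(d_* )_i$, where $(x)_i=x(x-1)\cdots(x-i+1)$. The symbol $o(1)$ refers to $n\to\infty$. *)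

theory Defs
  imports "HOL-Probability.Probability" "HOL-Library.Landau_Symbols"
begin

text \<open>
  A random subset of \<open>W = {1..m}\<close>: its size is drawn from \<open>P\<close>, and given the size it is
  uniformly distributed. Meaningful only if \<open>P\<close> is supported on \<open>{0..m}\<close>.
\<close>

definition random_subset :: "nat \<Rightarrow> nat pmf \<Rightarrow> nat set pmf" where
  "random_subset m P = bind_pmf P (\<lambda>k. pmf_of_set {A. A \<subseteq> {1..m} \<and> card A = k})"

lemma pmf_random_subset:
  assumes "set_pmf P \<subseteq> {0..m}" and "A \<subseteq> {1..m}"
  shows "pmf (random_subset m P) A = pmf P (card A) / real (m choose card A)"
proof -
  have *: "pmf (pmf_of_set {B. B \<subseteq> {1..m} \<and> card B = k}) A =
      indicator {card A} k / real (m choose card A)" if "k \<in> set_pmf P" for k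
  proof -
    have "k \<le> m" using that assms(1) by auto
    have c: "card {B. B \<subseteq> {1..m} \<and> card B = k} = m choose k"
      using n_subsets[of "{1..m}" k] by simp
    have "m choose k > 0" using \<open>k \<le> m\<close> by simp
    then have ne: "{B. B \<subseteq> {1..m} \<and> card B = k} \<noteq> {}" using c by (metis card.empty less_irrefl)
    have fin: "finite {B. B \<subseteq> {1..m} \<and> card B = k}" by simp
    show ?thesis
      unfolding pmf_of_set[OF ne fin] c using assms(2) by (auto simp: indicator_def)
  qed
  have "pmf (random_subset m P) A =
      (\<integral>k. pmf (pmf_of_set {B. B \<subseteq> {1..m} \<and> card B = k}) A \<partial>measure_pmf P)"
    unfolding random_subset_def by (rule pmf_bind)
  also have "\<dots> = (\<integral>k. indicator {card A} k / real (m choose card A) \<partial>measure_pmf P)"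
    by (rule integral_cong_AE) (simp_all add: AE_measure_pmf_iff * del: One_nat_def)
  also have "\<dots> = pmf P (card A) / real (m choose card A)"
    by (simp add: measure_pmf_single)
  finally show ?thesis .
qed

definition active_sets :: "nat \<Rightarrow> nat \<Rightarrow> nat pmf \<Rightarrow> (nat \<Rightarrow> nat set) pmf" where
  "active_sets n m P = Pi_pmf {1..n} {} (\<lambda>_. random_subset m P)"

text \<open>
  Graphs on the vertex set \<open>{1..n}\<close> are given by their symmetric, irreflexive edge relation.
\<close>

definition intersection_edges :: "nat \<Rightarrow> nat \<Rightarrow> (nat \<Rightarrow> nat set) \<Rightarrow> (nat \<times> nat) set" where
  "intersection_edges s n D =
     {(i, j). i \<in> {1..n} \<and> j \<in> {1..n} \<and> i \<noteq> j \<and> s \<le> card (D i \<inter> D j)}"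

definition active_graph :: "nat \<Rightarrow> nat \<Rightarrow> nat \<Rightarrow> nat pmf \<Rightarrow> (nat \<times> nat) set pmf" where
  "active_graph s n m P = map_pmf (intersection_edges s n) (active_sets n m P)"

definition degree :: "(nat \<times> nat) set \<Rightarrow> nat \<Rightarrow> nat" where
  "degree E v = card {u. (v, u) \<in> E}"

text \<open>
  The random graph together with an independent uniform ordered pair of distinct vertices,
  conditioned on that pair being adjacent. For a fixed \<open>n\<close> this (and hence the assortativity
  coefficient below) is meaningful only if \<open>n \<ge> 2\<close> and an edge occurs with positive
  probability.
\<close>

definition edge_conditioned ::
    "nat \<Rightarrow> (nat \<times> nat) set pmf \<Rightarrow> ((nat \<times> nat) set \<times> nat \<times> nat) pmf" where
  "edge_conditioned n G =
     cond_pmf (pair_pmf G (pmf_of_set {(u, v). u \<in> {1..n} \<and> v \<in> {1..n} \<and> u \<noteq> v}))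
       {(E, u, v). (u, v) \<in> E}"

definition assortativity :: "nat \<Rightarrow> (nat \<times> nat) set pmf \<Rightarrow> real" where
  "assortativity n G =
     (let \<mu> = edge_conditioned n G;
          g = measure_pmf.expectation \<mu> (\<lambda>(E, u, v). real (degree E u) * real (degree E v));
          b = measure_pmf.expectation \<mu> (\<lambda>(E, u, v). real (degree E u));
          b' = measure_pmf.expectation \<mu> (\<lambda>(E, u, v). (real (degree E u))\<^sup>2)
      in (g - b\<^sup>2) / (b' - b\<^sup>2))"

definition size_moment :: "nat \<Rightarrow> nat \<Rightarrow> nat \<Rightarrow> nat pmf \<Rightarrow> nat \<Rightarrow> real" where
  "size_moment s n m P k =
     measure_pmf.expectation (active_sets n m P) (\<lambda>D. real (card (D 1) choose s) ^ k)"

definition scaled_size :: "nat \<Rightarrow> nat \<Rightarrow> nat \<Rightarrow> (nat \<Rightarrow> nat set) \<Rightarrow> real" where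
  "scaled_size s n m D = sqrt (real n) / sqrt (real (m choose s)) * real (card (D 1) choose s)"

text \<open>
  The mixed Poisson distribution with random mean \<open>z\<^sub>1 Z\<close>, where \<open>z\<^sub>1\<close> is the mean of \<open>Z\<close>;
  the lemma below shows that the point masses really are those given to \<^const>\<open>embed_pmf\<close>.
\<close>

definition limit_degree_mass :: "'a measure \<Rightarrow> ('a \<Rightarrow> real) \<Rightarrow> nat \<Rightarrow> real" where
  "limit_degree_mass M Z k =
     (let z1 = (\<integral>x. Z x \<partial>M) in (\<integral>x. (z1 * Z x) ^ k * exp (- z1 * Z x) \<partial>M) / fact k)"

definition limit_degree :: "'a measure \<Rightarrow> ('a \<Rightarrow> real) \<Rightarrow> nat pmf" where
  "limit_degree M Z = embed_pmf (limit_degree_mass M Z)"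

lemma pmf_limit_degree:
  assumes "prob_space M" and [measurable]: "Z \<in> borel_measurable M" and nn: "AE x in M. 0 \<le> Z x"
  shows "pmf (limit_degree M Z) k = limit_degree_mass M Z k"
proof -
  interpret prob_space M by fact
  define z1 where "z1 = (\<integral>x. Z x \<partial>M)"
  define p where "p x k = (z1 * Z x) ^ k * exp (- z1 * Z x) / fact k" for x and k :: nat
  have z1: "0 \<le> z1" unfolding z1_def using nn by (rule integral_nonneg_AE)
  have meas [measurable]: "(\<lambda>x. p x k) \<in> borel_measurable M" for k unfolding p_def by measurable
  have p_nn: "0 \<le> p x k" if "0 \<le> Z x" for x k using that z1 by (simp add: p_def)
  have p_sums: "p x sums 1" for x
  proof -
    have "(\<lambda>k. (z1 * Z x) ^ k /\<^sub>R fact k * exp (- z1 * Z x)) sums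
        (exp (z1 * Z x) * exp (- z1 * Z x))"
      by (intro sums_mult2 exp_converges)
    moreover have "(\<lambda>k. (z1 * Z x) ^ k /\<^sub>R fact k * exp (- z1 * Z x)) = p x"
      by (simp add: p_def fun_eq_iff divide_inverse)
    ultimately show ?thesis by (simp flip: exp_add)
  qed
  have p_le: "p x k \<le> 1" if "0 \<le> Z x" for x k
    using sum_le_suminf[of "p x" "{k}"] p_sums[of x] p_nn[OF that] by (auto simp: sums_iff)
  have int: "integrable M (\<lambda>x. p x k)" for k
    by (rule integrable_const_bound[of _ 1]) (use nn p_nn p_le in auto)
  have mass: "limit_degree_mass M Z k = (\<integral>x. p x k \<partial>M)" for k
    by (simp add: limit_degree_mass_def p_def z1_def[symmetric] Let_def)
  have mass_nn: "0 \<le> limit_degree_mass M Z k" for k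
    unfolding mass by (rule integral_nonneg_AE) (use nn p_nn in auto)
  have "(\<integral>\<^sup>+k. ennreal (limit_degree_mass M Z k) \<partial>count_space UNIV) =
      (\<Sum>k. ennreal (\<integral>x. p x k \<partial>M))"
    by (simp add: nn_integral_count_space_nat mass)
  also have "\<dots> = (\<Sum>k. \<integral>\<^sup>+x. ennreal (p x k) \<partial>M)"
    by (intro suminf_cong nn_integral_eq_integral[symmetric] int) (use nn p_nn in auto)
  also have "\<dots> = (\<integral>\<^sup>+x. (\<Sum>k. ennreal (p x k)) \<partial>M)"
    by (rule nn_integral_suminf[symmetric]) measurable
  also have "\<dots> = (\<integral>\<^sup>+x. 1 \<partial>M)"
  proof (rule nn_integral_cong_AE)
    show "AE x in M. (\<Sum>k. ennreal (p x k)) = 1"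
      using nn by eventually_elim
        (use p_sums p_nn in \<open>simp add: suminf_ennreal2 sums_iff\<close>)
  qed
  also have "\<dots> = 1" by (simp add: emeasure_space_1)
  finally show ?thesis
    unfolding limit_degree_def using mass_nn by (intro pmf_embed_pmf) auto
qed

definition factorial_moment :: "nat pmf \<Rightarrow> nat \<Rightarrow> real" where
  "factorial_moment p i = measure_pmf.expectation p (\<lambda>x. \<Prod>j<i. (real x - real j))"

end

theory Submission
  imports Defs
begin

text \<open>
  Write \<open>Y x\<close> for \<open>x choose s\<close>, \<open>N\<close> for \<open>m choose s\<close> and \<open>H A\<close> for the probability that a fixed set \<open>A\<close>
  shares \<open>s\<close> elements with an independent random set. Since the sets are independent and identically
  distributed, the conditional moments of the degrees at the two ends of an edge only involve the
  probabilities of five small graphs: the edge, the stars with two and with three leaves, the path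
  with three edges, and the triangle. This makes \<open>r\<close> an explicit rational function of these
  probabilities and \<open>n\<close> (\<open>assortativity_eq\<close>), in which the covariance of the end degrees is
  carried by triangles and paths, and the variance by stars.

  Because \<open>N\<close> has the order of \<open>n\<close>, the variable \<open>Y (X\<^sub>1)\<close> is a bounded multiple of \<open>Z\<^sub>1\<close>, so the sets have
  sizes of bounded order while \<open>m\<close> tends to infinity. Sets of sizes \<open>x\<close> and \<open>y\<close> then meet in \<open>s\<close> elements with
  probability about \<open>Y x * Y y / N\<close>, and hardly ever in more. So \<open>N * H A\<close> is close to
  \<open>a\<^sub>1 * Y (card A)\<close>, each further edge of a tree contributes one more such factor
  (\<open>size_approx_kernel\<close>), and a triangle arises, up to a negligible error, from one \<open>s\<close>-set common to
  all three sets (\<open>size_approx_triangle\<close>). With \<open>\<alpha>\<^sub>k\<close> the limit of \<open>a\<^sub>k\<close>, the rescaled probabilities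
  of edge, two-leaf star, three-leaf star, path and triangle tend to \<open>\<alpha>\<^sub>1\<^sup>2\<close>, \<open>\<alpha>\<^sub>1\<^sup>2 * \<alpha>\<^sub>2\<close>,
  \<open>\<alpha>\<^sub>1 ^ 3 * \<alpha>\<^sub>3\<close>, \<open>\<alpha>\<^sub>1\<^sup>2 * \<alpha>\<^sub>2\<^sup>2\<close> and \<open>\<alpha>\<^sub>1 ^ 3\<close>. In the covariance the path cancels against the square of the
  mean and \<open>\<alpha>\<^sub>1 / \<beta>\<close> is left; the variance tends to \<open>\<alpha>\<^sub>2 / \<beta> + (\<alpha>\<^sub>1 * \<alpha>\<^sub>3 - \<alpha>\<^sub>2\<^sup>2) / \<beta>\<^sup>2\<close>. Their quotient is
  the first formula (\<open>r_limit\<close>). The second one is the same number, as \<open>\<alpha>\<^sub>k = \<beta> powr (k/2) * E Z ^ k\<close> and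
  the factorial moments of a mixed Poisson variable are the moments of its random mean.

  All these limits are taken under expectations with respect to the varying laws \<open>P n\<close>. They are
  justified by dominated convergence (\<open>mean_vanishes\<close>), the dominating power of \<open>Y\<close> being uniformly
  integrable because \<open>Z\<^sub>1\<close> converges weakly together with the corresponding moment
  (\<open>uniform_tail_of_moment\<close>). If \<open>Z\<close> has a second but no third moment, the covariance still
  converges, whereas the star with three leaves, and with it the variance, becomes infinite
  (\<open>r_vanishes\<close>).
\<close>

section \<open>Expectations under finitely supported laws\<close>

abbreviation mean :: "'a pmf \<Rightarrow> ('a \<Rightarrow> real) \<Rightarrow> real" where
  "mean p f \<equiv> measure_pmf.expectation p f"

lemma mean_mono:
  assumes "finite (set_pmf p)" and "\<And>x. x \<in> set_pmf p \<Longrightarrow> f x \<le> g x"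
  shows "mean p f \<le> mean p g"
  by (rule integral_mono_AE)
    (use assms in \<open>simp_all add: integrable_measure_pmf_finite AE_measure_pmf_iff\<close>)

lemma mean_cong: "(\<And>x. x \<in> set_pmf p \<Longrightarrow> f x = g x) \<Longrightarrow> mean p f = mean p g"
  by (rule integral_cong_AE) (simp_all add: AE_measure_pmf_iff)

lemma mean_nonneg: "(\<And>x. x \<in> set_pmf p \<Longrightarrow> 0 \<le> f x) \<Longrightarrow> 0 \<le> mean p f"
  by (rule integral_nonneg_AE) (simp add: AE_measure_pmf_iff)

lemma mean_sum:
  assumes "finite (set_pmf p)"
  shows "mean p (\<lambda>x. \<Sum>i\<in>A. f i x) = (\<Sum>i\<in>A. mean p (f i))"
  by (rule Bochner_Integration.integral_sum) (simp add: integrable_measure_pmf_finite assms)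

lemma mean_add:
  assumes "finite (set_pmf p)"
  shows "mean p (\<lambda>x. f x + g x) = mean p f + mean p g"
  by (rule Bochner_Integration.integral_add) (simp_all add: integrable_measure_pmf_finite assms)

lemma mean_diff:
  assumes "finite (set_pmf p)"
  shows "mean p (\<lambda>x. f x - g x) = mean p f - mean p g"
  by (rule Bochner_Integration.integral_diff) (simp_all add: integrable_measure_pmf_finite assms)

lemma abs_mean_le:
  assumes "finite (set_pmf p)" and "\<And>x. x \<in> set_pmf p \<Longrightarrow> \<bar>f x\<bar> \<le> g x"
  shows "\<bar>mean p f\<bar> \<le> mean p g"
proof -
  have "\<bar>mean p f\<bar> \<le> mean p (\<lambda>x. \<bar>f x\<bar>)"
    by (rule integral_abs_bound)
  also have "\<dots> \<le> mean p g"
    by (rule mean_mono) (use assms in auto)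
  finally show ?thesis .
qed

lemma mean_bind:
  assumes "finite (set_pmf p)" and "\<And>x. x \<in> set_pmf p \<Longrightarrow> finite (set_pmf (f x))"
  shows "mean (bind_pmf p f) h = mean p (\<lambda>x. mean (f x) h)"
proof -
  have "mean (bind_pmf p f) h = (\<Sum>a\<in>set_pmf p. pmf p a *\<^sub>R mean (f a) h)"
    by (rule pmf_expectation_bind) (use assms in auto)
  also have "\<dots> = mean p (\<lambda>x. mean (f x) h)"
    by (subst integral_measure_pmf[of "set_pmf p"]) (use assms in \<open>auto simp: set_pmf_iff\<close>)
  finally show ?thesis .
qed

lemma mean_pair:
  assumes "finite (set_pmf p)" and "finite (set_pmf q)"
  shows "mean (pair_pmf p q) h = mean p (\<lambda>x. mean q (\<lambda>y. h (x, y)))"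
  unfolding pair_pmf_def using assms by (simp add: mean_bind)

lemma mean_swap:
  assumes "finite (set_pmf p)" and "finite (set_pmf q)"
  shows "mean p (\<lambda>x. mean q (\<lambda>y. h x y)) = mean q (\<lambda>y. mean p (\<lambda>x. h x y))"
proof -
  have "mean p (\<lambda>x. mean q (\<lambda>y. h x y)) = mean (pair_pmf p q) (\<lambda>(x, y). h x y)"
    using assms by (simp add: mean_pair)
  also have "\<dots> = mean (map_pmf (\<lambda>(x, y). (y, x)) (pair_pmf q p)) (\<lambda>(x, y). h x y)"
    by (subst pair_commute_pmf) simp
  also have "\<dots> = mean q (\<lambda>y. mean p (\<lambda>x. h x y))"
    using assms by (simp add: mean_pair case_prod_beta)
  finally show ?thesis .
qed

text \<open>
  The conditioning event becomes a factor inside an unconditional expectation, where independence of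
  the sets can be used.
\<close>

lemma mean_cond:
  assumes fin: "finite (set_pmf p)" and ne: "set_pmf p \<inter> S \<noteq> {}"
  shows "mean (cond_pmf p S) f = mean p (\<lambda>x. of_bool (x \<in> S) * f x) / mean p (\<lambda>x. of_bool (x \<in> S))"
proof -
  have "mean p (\<lambda>x. of_bool (x \<in> S)) = measure p S"
  proof -
    have "mean p (indicator S) = measure p S" by simp
    moreover have "(indicator S :: _ \<Rightarrow> real) = (\<lambda>x. of_bool (x \<in> S))"
      by (auto simp: indicator_def)
    ultimately show ?thesis by simp
  qed
  moreover have "mean (cond_pmf p S) f = (\<Sum>x\<in>set_pmf p. pmf (cond_pmf p S) x * f x)"
    by (subst integral_measure_pmf[of "set_pmf p"]) (use assms in \<open>auto simp: set_cond_pmf\<close>)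
  moreover have "\<dots> = (\<Sum>x\<in>set_pmf p. pmf p x * (of_bool (x \<in> S) * f x)) / measure p S"
    unfolding sum_divide_distrib
    by (rule sum.cong) (use ne in \<open>auto simp: pmf_cond\<close>)
  moreover have "(\<Sum>x\<in>set_pmf p. pmf p x * (of_bool (x \<in> S) * f x)) =
      mean p (\<lambda>x. of_bool (x \<in> S) * f x)"
    by (subst integral_measure_pmf[of "set_pmf p"]) (use assms in \<open>auto\<close>)
  ultimately show ?thesis by simp
qed

section \<open>Random subsets\<close>

text \<open>
  Removing \<open>S\<close> turns the supersets into subsets of the complement of \<open>S\<close>. The product form avoids
  the case distinction that truncated subtraction would need when \<open>x\<close> is smaller than \<open>card S\<close>.
\<close>

lemma card_supersets_of_size:
  assumes "S \<subseteq> {1..m}" and "x \<le> m"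
  shows "real (card {B. B \<subseteq> {1..m} \<and> card B = x \<and> S \<subseteq> B}) * real (m choose card S) =
    real (m choose x) * real (x choose card S)"
proof (cases "card S \<le> x")
  case True
  have fS: "finite S" using assms(1) finite_subset by blast
  have "bij_betw (\<lambda>B. B - S) {B. B \<subseteq> {1..m} \<and> card B = x \<and> S \<subseteq> B}
      {C. C \<subseteq> {1..m} - S \<and> card C = x - card S}"
  proof (rule bij_betw_byWitness[where f' = "\<lambda>C. C \<union> S"])
    show "(\<lambda>B. B - S) ` {B. B \<subseteq> {1..m} \<and> card B = x \<and> S \<subseteq> B} \<subseteq>
        {C. C \<subseteq> {1..m} - S \<and> card C = x - card S}"
      using fS by (auto simp: card_Diff_subset)
    show "(\<lambda>C. C \<union> S) ` {C. C \<subseteq> {1..m} - S \<and> card C = x - card S} \<subseteq>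
        {B. B \<subseteq> {1..m} \<and> card B = x \<and> S \<subseteq> B}"
    proof clarify
      fix C assume C: "C \<subseteq> {1..m} - S" "card C = x - card S"
      have "finite C" using C finite_subset by blast
      then have "card (C \<union> S) = card C + card S"
        using fS C by (intro card_Un_disjoint) auto
      then show "C \<union> S \<subseteq> {1..m} \<and> card (C \<union> S) = x \<and> S \<subseteq> C \<union> S"
        using C assms True by auto
    qed
  qed auto
  then have "card {B. B \<subseteq> {1..m} \<and> card B = x \<and> S \<subseteq> B} =
      card {C. C \<subseteq> {1..m} - S \<and> card C = x - card S}"
    by (rule bij_betw_same_card)
  also have "\<dots> = (m - card S) choose (x - card S)"
    using assms fS by (subst n_subsets) (auto simp: card_Diff_subset)
  finally have "card {B. B \<subseteq> {1..m} \<and> card B = x \<and> S \<subseteq> B} = (m - card S) choose (x - card S)" .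
  then show ?thesis
    using choose_mult[OF True assms(2)] by (simp flip: of_nat_mult add: mult.commute)
next
  case False
  have "{B. B \<subseteq> {1..m} \<and> card B = x \<and> S \<subseteq> B} = {}"
  proof (rule ccontr)
    assume "{B. B \<subseteq> {1..m} \<and> card B = x \<and> S \<subseteq> B} \<noteq> {}"
    then obtain B where "B \<subseteq> {1..m}" "card B = x" "S \<subseteq> B" by blast
    then show False
      using card_mono[of B S] False finite_subset[of B "{1..m}"] by auto
  qed
  then have "card {B. B \<subseteq> {1..m} \<and> card B = x \<and> S \<subseteq> B} = 0" by (metis card.empty)
  moreover have "x choose card S = 0" using False by simp
  ultimately show ?thesis by (simp only: of_nat_0 mult_zero_left mult_zero_right)
qed

lemma set_pmf_uniform_subsets:
  assumes "x \<le> m"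
  shows "set_pmf (pmf_of_set {A. A \<subseteq> {1..m} \<and> card A = x}) = {A. A \<subseteq> {1..m} \<and> card A = x}"
proof (rule set_pmf_of_set)
  have "card {A. A \<subseteq> {1..m} \<and> card A = x} \<noteq> 0"
    using assms n_subsets[of "{1..m}" x] by simp
  then show "{A. A \<subseteq> {1..m} \<and> card A = x} \<noteq> {}" by (metis card.empty)
qed simp

lemma set_random_subset:
  assumes "set_pmf P \<subseteq> {0..m}"
  shows "set_pmf (random_subset m P) \<subseteq> {A. A \<subseteq> {1..m} \<and> card A \<in> set_pmf P}"
  unfolding random_subset_def set_bind_pmf
proof clarify
  fix A x assume x: "x \<in> set_pmf P" and A: "A \<in> set_pmf (pmf_of_set {A. A \<subseteq> {1..m} \<and> card A = x})"
  have "x \<le> m" using x assms by auto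
  then show "A \<subseteq> {1..m} \<and> card A \<in> set_pmf P"
    using A x set_pmf_uniform_subsets by auto
qed

lemma finite_random_subset:
  assumes "set_pmf P \<subseteq> {0..m}"
  shows "finite (set_pmf (random_subset m P))"
  by (rule finite_subset[OF set_random_subset[OF assms]]) simp

lemma map_card_random_subset:
  assumes "set_pmf P \<subseteq> {0..m}"
  shows "map_pmf card (random_subset m P) = P"
proof -
  have "map_pmf card (random_subset m P) =
      bind_pmf P (\<lambda>x. map_pmf card (pmf_of_set {A. A \<subseteq> {1..m} \<and> card A = x}))"
    by (simp add: random_subset_def map_bind_pmf)
  also have "\<dots> = bind_pmf P return_pmf"
  proof (rule bind_pmf_cong[OF refl])
    fix x assume "x \<in> set_pmf P"
    then have "x \<le> m" using assms by auto
    then have "map_pmf card (pmf_of_set {A. A \<subseteq> {1..m} \<and> card A = x}) =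
        map_pmf (\<lambda>_. x) (pmf_of_set {A. A \<subseteq> {1..m} \<and> card A = x})"
      by (intro map_pmf_cong) (use set_pmf_uniform_subsets[of x m] in auto)
    then show "map_pmf card (pmf_of_set {A. A \<subseteq> {1..m} \<and> card A = x}) = return_pmf x"
      by simp
  qed
  finally show ?thesis by (simp add: bind_return_pmf')
qed

lemma mean_card_random_subset:
  assumes "set_pmf P \<subseteq> {0..m}"
  shows "mean (random_subset m P) (\<lambda>A. f (card A)) = mean P f"
  using integral_map_pmf[of card "random_subset m P" f] map_card_random_subset[OF assms] by simp

text \<open>
  All adjacency estimates reduce to this identity. The weight \<open>\<phi> (card B)\<close> is there because trees are
  explored edge by edge: the branches still hanging at \<open>B\<close> enter as a function of its size.
\<close>

lemma mean_inclusion: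
  assumes P: "set_pmf P \<subseteq> {0..m}" and S: "S \<subseteq> {1..m}"
  shows "mean (random_subset m P) (\<lambda>B. of_bool (S \<subseteq> B) * \<phi> (card B)) =
    mean P (\<lambda>x. \<phi> x * real (x choose card S)) / real (m choose card S)"
proof -
  have "card S \<le> m" using card_mono[OF _ S] by simp
  then have pos: "real (m choose card S) > 0" by simp
  have fP: "finite (set_pmf P)" using P finite_subset by blast
  have inner: "mean (pmf_of_set {A. A \<subseteq> {1..m} \<and> card A = x}) (\<lambda>B. of_bool (S \<subseteq> B) * \<phi> (card B)) =
      \<phi> x * real (x choose card S) / real (m choose card S)" if "x \<in> set_pmf P" for x
  proof -
    let ?U = "{A. A \<subseteq> {1..m} \<and> card A = x}"
    have x: "x \<le> m" using that P by auto
    have c: "card ?U = m choose x" using n_subsets[of "{1..m}" x] by simp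
    have cpos: "card ?U > 0" using x c by simp
    then have ne: "?U \<noteq> {}" by (metis card.empty less_irrefl)
    have fin: "finite ?U" by simp
    have "mean (pmf_of_set ?U) (\<lambda>B. of_bool (S \<subseteq> B) * \<phi> (card B)) =
        (\<Sum>B\<in>?U. of_bool (S \<subseteq> B) * \<phi> (card B)) / real (card ?U)"
      by (rule integral_pmf_of_set[OF ne fin])
    also have "(\<Sum>B\<in>?U. of_bool (S \<subseteq> B) * \<phi> (card B)) =
        (\<Sum>B\<in>?U. if S \<subseteq> B then \<phi> x else 0)"
      by (rule sum.cong) auto
    also have "\<dots> = (\<Sum>B\<in>{B\<in>?U. S \<subseteq> B}. \<phi> x)"
      by (rule sum.inter_filter[symmetric, OF fin])
    also have "\<dots> = real (card {B. B \<subseteq> {1..m} \<and> card B = x \<and> S \<subseteq> B}) * \<phi> x"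
      by (simp add: conj_ac)
    also have "real (card {B. B \<subseteq> {1..m} \<and> card B = x \<and> S \<subseteq> B}) =
        real (m choose x) * real (x choose card S) / real (m choose card S)"
      using card_supersets_of_size[OF S x] pos by (simp add: field_simps)
    finally show ?thesis using cpos c by simp
  qed
  have "mean (random_subset m P) (\<lambda>B. of_bool (S \<subseteq> B) * \<phi> (card B)) =
      mean P (\<lambda>x. mean (pmf_of_set {A. A \<subseteq> {1..m} \<and> card A = x}) (\<lambda>B. of_bool (S \<subseteq> B) * \<phi> (card B)))"
    unfolding random_subset_def
  proof (rule mean_bind[OF fP])
    fix x assume "x \<in> set_pmf P"
    then show "finite (set_pmf (pmf_of_set {A. A \<subseteq> {1..m} \<and> card A = x}))"
      using P by (subst set_pmf_uniform_subsets) auto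
  qed
  also have "\<dots> = mean P (\<lambda>x. \<phi> x * real (x choose card S) / real (m choose card S))"
    by (rule mean_cong) (rule inner)
  finally show ?thesis by simp
qed

section \<open>Adjacency of random subsets\<close>

definition meets :: "nat \<Rightarrow> nat set \<Rightarrow> nat set \<Rightarrow> real" where
  "meets s A B = of_bool (s \<le> card (A \<inter> B))"

abbreviation subsets_of_size :: "nat \<Rightarrow> nat set \<Rightarrow> nat set set" where
  "subsets_of_size s A \<equiv> {S. S \<subseteq> A \<and> card S = s}"

lemma meets_01: "0 \<le> meets s A B" "meets s A B \<le> 1"
  by (simp_all add: meets_def)

lemma meets_commute: "meets s A B = meets s B A"
  by (simp add: meets_def Int_commute)

lemma meets_idem: "meets s A B * meets s A B = meets s A B"
  by (simp add: meets_def)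

text \<open>
  The union bound over the \<open>s\<close>-subsets that witness adjacency.
\<close>

lemma meets_le_sum:
  assumes "finite A"
  shows "meets s A B \<le> (\<Sum>S\<in>subsets_of_size s A. of_bool (S \<subseteq> B))"
proof (cases "s \<le> card (A \<inter> B)")
  case True
  then obtain S where S: "S \<subseteq> A \<inter> B" "card S = s"
    by (meson obtain_subset_with_card_n)
  have "of_bool (S \<subseteq> B) \<le> (\<Sum>S\<in>subsets_of_size s A. of_bool (S \<subseteq> B) :: real)"
    by (rule member_le_sum) (use S assms in auto)
  then show ?thesis using S by (simp add: meets_def)
qed (simp add: meets_def sum_nonneg)

text \<open>
  Adjacencies through exactly \<open>s\<close> common elements: the traces of \<open>B\<close> on \<open>A\<close> are mutually exclusive, so
  they can be summed without overcounting. This is the lower counterpart of the union bound.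
\<close>

lemma sum_trace_le_meets:
  assumes "finite A"
  shows "(\<Sum>S\<in>subsets_of_size s A. of_bool (A \<inter> B = S)) \<le> meets s A B"
proof -
  have "(\<Sum>S\<in>subsets_of_size s A. of_bool (A \<inter> B = S) :: real) =
      (\<Sum>S\<in>subsets_of_size s A. if S = A \<inter> B then 1 else 0)"
    by (rule sum.cong) auto
  also have "\<dots> = (if card (A \<inter> B) = s then 1 else 0)"
    using assms by (subst sum.delta) auto
  also have "\<dots> \<le> meets s A B" by (simp add: meets_def)
  finally show ?thesis .
qed

text \<open>
  A Bonferroni inequality: if \<open>B\<close> contains \<open>S\<close> but meets \<open>A\<close> in more than \<open>S\<close>, it contains some further
  element of \<open>A\<close>.
\<close>

lemma trace_ge_inclusion:
  assumes "finite A" and "S \<subseteq> A"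
  shows "of_bool (S \<subseteq> B) - (\<Sum>w\<in>A - S. of_bool (insert w S \<subseteq> B)) \<le> (of_bool (A \<inter> B = S) :: real)"
proof (cases "S \<subseteq> B \<and> A \<inter> B \<noteq> S")
  case True
  then obtain w where w: "w \<in> A - S" "w \<in> B" using assms(2) by blast
  have "of_bool (insert w S \<subseteq> B) \<le> (\<Sum>w\<in>A - S. of_bool (insert w S \<subseteq> B) :: real)"
    by (rule member_le_sum) (use w assms in auto)
  then show ?thesis using True w by simp
next
  case False
  have "0 \<le> (\<Sum>w\<in>A - S. of_bool (insert w S \<subseteq> B) :: real)" by (simp add: sum_nonneg)
  then show ?thesis using False by (auto split: if_splits)
qed

text \<open>
  Asking for one more common element costs a factor \<open>(x - s) / (m - s)\<close>. It vanishes for sizes that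
  stay bounded, and it never exceeds one for sizes up to \<open>m\<close>, so it is also harmless in dominations.
\<close>

lemma binomial_Suc_scaled:
  assumes "s < m"
  shows "real (m choose s) * (real (x choose Suc s) / real (m choose Suc s)) =
    real (x choose s) * (real x - real s) / (real m - real s)"
proof -
  have step: "real (Suc s) * real (k choose Suc s) = real (k choose s) * (real k - real s)" for k
    by (metis binomial_gbinomial mult.commute gbinomial_absorb_comp gbinomial_absorption)
  have pos: "real (m choose s) > 0" "real m - real s > 0" using assms by simp_all
  have e: "real (k choose Suc s) = real (k choose s) * (real k - real s) / real (Suc s)" for k
    using step[of k] by (simp add: field_simps del: of_nat_Suc)
  show ?thesis
    unfolding e using pos by (simp add: field_simps del: of_nat_Suc)
qed

locale subset_law =
  fixes s m :: nat and P :: "nat pmf"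
  assumes P_le: "set_pmf P \<subseteq> {0..m}" and s_less: "s < m"
begin

abbreviation "\<rho> \<equiv> random_subset m P"

definition Y :: "nat \<Rightarrow> real" where "Y x = real (x choose s)"

definition N :: real where "N = real (m choose s)"

text \<open>
  For \<open>s \<le> x\<close>, the conditional probability that a random set of size \<open>x\<close> which contains \<open>s\<close> prescribed
  elements also contains one further prescribed element.
\<close>

definition excess :: "nat \<Rightarrow> real" where "excess x = (real x - real s) / (real m - real s)"

lemma N_pos: "N > 0"
  using s_less by (simp add: N_def)

lemma Y_nonneg: "0 \<le> Y x"
  by (simp add: Y_def)

lemma finite_P: "finite (set_pmf P)"
  using P_le finite_subset by blast

lemma finite_rho: "finite (set_pmf \<rho>)"
  using P_le by (rule finite_random_subset)

lemma set_rho: "B \<in> set_pmf \<rho> \<Longrightarrow> B \<subseteq> {1..m} \<and> card B \<in> set_pmf P"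
  using set_random_subset[OF P_le] by blast

lemma finite_subset_W: "A \<subseteq> {1..m} \<Longrightarrow> finite A"
  using finite_subset by blast

lemma card_subsets_of_size: "A \<subseteq> {1..m} \<Longrightarrow> real (card (subsets_of_size s A)) = Y (card A)"
  by (simp add: n_subsets finite_subset_W Y_def)

lemma Y_excess_nonneg: "x \<in> set_pmf P \<Longrightarrow> 0 \<le> Y x * excess x"
  using s_less by (cases "s \<le> x") (auto simp: Y_def excess_def not_le binomial_eq_0)

lemma mean_inclusion_s:
  assumes "S \<subseteq> {1..m}" and "card S = s"
  shows "N * mean \<rho> (\<lambda>B. of_bool (S \<subseteq> B) * \<phi> (card B)) = mean P (\<lambda>x. \<phi> x * Y x)"
  using mean_inclusion[OF P_le assms(1), of \<phi>] assms N_pos by (simp add: N_def Y_def)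

lemma mean_inclusion_Suc:
  assumes "S \<subseteq> {1..m}" and "card S = Suc s"
  shows "N * mean \<rho> (\<lambda>B. of_bool (S \<subseteq> B) * \<phi> (card B)) = mean P (\<lambda>x. \<phi> x * (Y x * excess x))"
proof -
  have "N * mean \<rho> (\<lambda>B. of_bool (S \<subseteq> B) * \<phi> (card B)) =
      mean P (\<lambda>x. N * (\<phi> x * real (x choose Suc s) / real (m choose Suc s)))"
    using mean_inclusion[OF P_le assms(1), of \<phi>] assms(2) by simp
  also have "\<dots> = mean P (\<lambda>x. \<phi> x * (Y x * excess x))"
  proof (rule mean_cong)
    fix x
    show "N * (\<phi> x * real (x choose Suc s) / real (m choose Suc s)) = \<phi> x * (Y x * excess x)"
      using arg_cong[OF binomial_Suc_scaled[OF s_less, of x], of "\<lambda>u. \<phi> x * u"]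
      by (simp add: N_def Y_def excess_def mult_ac)
  qed
  finally show ?thesis .
qed

text \<open>
  Each of the \<open>Y (card A)\<close> possible witnesses has the same inclusion probability. Together with
  \<open>mean_meets_lower\<close> this pins down the adjacency kernel applied to a function of the size, up to an
  error governed by \<open>excess\<close>.
\<close>

lemma mean_meets_upper:
  assumes A: "A \<subseteq> {1..m}" and nn: "\<And>x. x \<in> set_pmf P \<Longrightarrow> 0 \<le> \<phi> x"
  shows "N * mean \<rho> (\<lambda>B. meets s A B * \<phi> (card B)) \<le> Y (card A) * mean P (\<lambda>x. \<phi> x * Y x)"
proof -
  have "mean \<rho> (\<lambda>B. meets s A B * \<phi> (card B)) \<le>
      mean \<rho> (\<lambda>B. \<Sum>S\<in>subsets_of_size s A. of_bool (S \<subseteq> B) * \<phi> (card B))"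
  proof (rule mean_mono[OF finite_rho])
    fix B assume "B \<in> set_pmf \<rho>"
    then have "0 \<le> \<phi> (card B)" using set_rho nn by blast
    then show "meets s A B * \<phi> (card B) \<le> (\<Sum>S\<in>subsets_of_size s A. of_bool (S \<subseteq> B) * \<phi> (card B))"
      using meets_le_sum[OF finite_subset_W[OF A], of s B]
      by (simp flip: sum_distrib_right add: mult_right_mono)
  qed
  then have "N * mean \<rho> (\<lambda>B. meets s A B * \<phi> (card B)) \<le>
      (\<Sum>S\<in>subsets_of_size s A. N * mean \<rho> (\<lambda>B. of_bool (S \<subseteq> B) * \<phi> (card B)))"
    using N_pos by (simp add: mean_sum[OF finite_rho] flip: sum_distrib_left)
  also have "\<dots> = (\<Sum>S\<in>subsets_of_size s A. mean P (\<lambda>x. \<phi> x * Y x))"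
    by (rule sum.cong) (use A mean_inclusion_s in auto)
  also have "\<dots> = Y (card A) * mean P (\<lambda>x. \<phi> x * Y x)"
    using card_subsets_of_size[OF A] by simp
  finally show ?thesis .
qed

text \<open>
  Averaging \<open>trace_ge_inclusion\<close>: there are \<open>card A - s\<close> candidates for a further common element, each
  costing one factor \<open>excess\<close>.
\<close>

lemma mean_trace_lower:
  assumes A: "A \<subseteq> {1..m}" and S: "S \<subseteq> A" "card S = s"
    and nn: "\<And>x. x \<in> set_pmf P \<Longrightarrow> 0 \<le> \<phi> x"
  shows "mean P (\<lambda>x. \<phi> x * Y x) - (real (card A) - real s) * mean P (\<lambda>x. \<phi> x * (Y x * excess x))
    \<le> N * mean \<rho> (\<lambda>B. of_bool (A \<inter> B = S) * \<phi> (card B))"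
proof -
  have fA: "finite A" using A by (rule finite_subset_W)
  have fS: "finite S" using S fA finite_subset by blast
  have "real (card (A - S)) = real (card A) - real s"
    using S fS card_mono[OF fA S(1)] by (simp add: card_Diff_subset of_nat_diff)
  moreover have "N * mean \<rho> (\<lambda>B. of_bool (insert w S \<subseteq> B) * \<phi> (card B)) =
      mean P (\<lambda>x. \<phi> x * (Y x * excess x))" if "w \<in> A - S" for w
    using that A S fS by (intro mean_inclusion_Suc) auto
  ultimately have sum: "(\<Sum>w\<in>A - S. N * mean \<rho> (\<lambda>B. of_bool (insert w S \<subseteq> B) * \<phi> (card B))) =
      (real (card A) - real s) * mean P (\<lambda>x. \<phi> x * (Y x * excess x))"
    by simp
  have "mean \<rho> (\<lambda>B. of_bool (S \<subseteq> B) * \<phi> (card B) -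
        (\<Sum>w\<in>A - S. of_bool (insert w S \<subseteq> B) * \<phi> (card B))) \<le>
      mean \<rho> (\<lambda>B. of_bool (A \<inter> B = S) * \<phi> (card B))"
  proof (rule mean_mono[OF finite_rho])
    fix B assume "B \<in> set_pmf \<rho>"
    then have "0 \<le> \<phi> (card B)" using set_rho nn by blast
    then show "of_bool (S \<subseteq> B) * \<phi> (card B) - (\<Sum>w\<in>A - S. of_bool (insert w S \<subseteq> B) * \<phi> (card B))
        \<le> of_bool (A \<inter> B = S) * \<phi> (card B)"
      using mult_right_mono[OF trace_ge_inclusion[OF fA S(1), of B]]
      by (simp only: sum_distrib_right left_diff_distrib)
  qed
  then have "N * mean \<rho> (\<lambda>B. of_bool (S \<subseteq> B) * \<phi> (card B)) -
        (\<Sum>w\<in>A - S. N * mean \<rho> (\<lambda>B. of_bool (insert w S \<subseteq> B) * \<phi> (card B)))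
      \<le> N * mean \<rho> (\<lambda>B. of_bool (A \<inter> B = S) * \<phi> (card B))"
    using N_pos by (simp only: mean_diff[OF finite_rho] mean_sum[OF finite_rho]
        mult_le_cancel_left_pos flip: sum_distrib_left right_diff_distrib)
  moreover have "S \<subseteq> {1..m}" using S(1) A by blast
  ultimately show ?thesis
    using sum mean_inclusion_s[OF \<open>S \<subseteq> {1..m}\<close> S(2)] by simp
qed

text \<open>
  The cut-off at \<open>0\<close> keeps the bound usable for large \<open>A\<close>, where the Bonferroni estimate may be
  negative.
\<close>

lemma mean_meets_lower:
  assumes A: "A \<subseteq> {1..m}" and nn: "\<And>x. x \<in> set_pmf P \<Longrightarrow> 0 \<le> \<phi> x"
  shows "Y (card A) * max 0 (mean P (\<lambda>x. \<phi> x * Y x)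
      - (real (card A) - real s) * mean P (\<lambda>x. \<phi> x * (Y x * excess x)))
    \<le> N * mean \<rho> (\<lambda>B. meets s A B * \<phi> (card B))" (is "_ * max 0 ?L \<le> _")
proof -
  have "Y (card A) * max 0 ?L = (\<Sum>S\<in>subsets_of_size s A. max 0 ?L)"
    using card_subsets_of_size[OF A] by simp
  also have "\<dots> \<le> (\<Sum>S\<in>subsets_of_size s A. N * mean \<rho> (\<lambda>B. of_bool (A \<inter> B = S) * \<phi> (card B)))"
  proof (rule sum_mono)
    fix S assume S: "S \<in> subsets_of_size s A"
    have "0 \<le> mean \<rho> (\<lambda>B. of_bool (A \<inter> B = S) * \<phi> (card B))"
      by (rule mean_nonneg) (use set_rho nn in auto)
    then show "max 0 ?L \<le> N * mean \<rho> (\<lambda>B. of_bool (A \<inter> B = S) * \<phi> (card B))"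
      using mean_trace_lower[OF A, of S \<phi>] S nn N_pos by simp
  qed
  also have "\<dots> = N * mean \<rho> (\<lambda>B. \<Sum>S\<in>subsets_of_size s A. of_bool (A \<inter> B = S) * \<phi> (card B))"
    by (simp add: mean_sum[OF finite_rho] flip: sum_distrib_left)
  also have "\<dots> \<le> N * mean \<rho> (\<lambda>B. meets s A B * \<phi> (card B))"
  proof (intro mult_left_mono mean_mono[OF finite_rho])
    fix B assume "B \<in> set_pmf \<rho>"
    then have "0 \<le> \<phi> (card B)" using set_rho nn by blast
    then show "(\<Sum>S\<in>subsets_of_size s A. of_bool (A \<inter> B = S) * \<phi> (card B)) \<le> meets s A B * \<phi> (card B)"
      using sum_trace_le_meets[OF finite_subset_W[OF A], where s = s and B = B]
      by (simp flip: sum_distrib_right add: mult_right_mono)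
  qed (use N_pos in simp)
  finally show ?thesis .
qed

text \<open>
  Three pairwise adjacent sets either have \<open>s\<close> elements common to all of them, or \<open>B\<close> and \<open>C\<close> share an
  element \<open>w\<close> outside \<open>A\<close>, as their \<open>s\<close> common elements cannot all lie in \<open>A\<close>. The second alternative asks
  both \<open>B\<close> and \<open>C\<close> to contain \<open>s + 1\<close> prescribed elements, which makes it rare.
\<close>

lemma triangle_le_sum:
  assumes "A \<subseteq> {1..m}" "B \<subseteq> {1..m}"
  shows "meets s A B * meets s A C * meets s B C \<le>
    (\<Sum>S\<in>subsets_of_size s A. of_bool (S \<subseteq> B) * of_bool (S \<subseteq> C)) +
    (\<Sum>S\<in>subsets_of_size s A. \<Sum>S'\<in>subsets_of_size s A. \<Sum>w\<in>{1..m} - A.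
      of_bool (insert w S \<subseteq> B) * of_bool (insert w S' \<subseteq> C))" (is "?T \<le> ?common + ?other")
proof -
  have fA: "finite A" and fB: "finite B" using assms finite_subset_W by auto
  have nn: "0 \<le> ?common" "0 \<le> ?other" by (simp_all add: sum_nonneg)
  have triangle: "?T = of_bool (s \<le> card (A \<inter> B) \<and> s \<le> card (A \<inter> C) \<and> s \<le> card (B \<inter> C))"
    by (simp add: meets_def)
  consider "?T = 0" | "s \<le> card (A \<inter> B \<inter> C)"
    | "s \<le> card (A \<inter> B)" "s \<le> card (A \<inter> C)" "s \<le> card (B \<inter> C)" "card (A \<inter> B \<inter> C) < s"
    unfolding triangle by (metis not_le of_bool_eq(1))
  then show ?thesis
  proof cases
    case 1 then show ?thesis using nn by linarith
  next
    case 2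
    then obtain S where S: "S \<subseteq> A \<inter> B \<inter> C" "card S = s"
      by (meson obtain_subset_with_card_n)
    have "of_bool (S \<subseteq> B) * of_bool (S \<subseteq> C) \<le> ?common"
      by (rule member_le_sum) (use S fA in auto)
    then have "1 \<le> ?common" using S by simp
    moreover have "?T \<le> 1" unfolding triangle by simp
    ultimately show ?thesis using nn(2) by linarith
  next
    case 3
    obtain S where S: "S \<subseteq> A \<inter> B" "card S = s" using 3(1) by (meson obtain_subset_with_card_n)
    obtain S' where S': "S' \<subseteq> A \<inter> C" "card S' = s" using 3(2) by (meson obtain_subset_with_card_n)
    have "\<not> B \<inter> C \<subseteq> A \<inter> B \<inter> C"
      using card_mono[of "A \<inter> B \<inter> C" "B \<inter> C"] fA 3 by auto
    then obtain w where w: "w \<in> B" "w \<in> C" "w \<notin> A" by blast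
    have "of_bool (insert w S \<subseteq> B) * of_bool (insert w S' \<subseteq> C) \<le>
        (\<Sum>w\<in>{1..m} - A. of_bool (insert w S \<subseteq> B) * of_bool (insert w S' \<subseteq> C) :: real)"
      by (rule member_le_sum) (use w assms in auto)
    also have "\<dots> \<le> (\<Sum>S'\<in>subsets_of_size s A. \<Sum>w\<in>{1..m} - A.
        of_bool (insert w S \<subseteq> B) * of_bool (insert w S' \<subseteq> C))"
      by (rule member_le_sum[where i = S']) (use S' fA in \<open>auto intro!: sum_nonneg\<close>)
    also have "\<dots> \<le> ?other"
      by (rule member_le_sum[where i = S]) (use S fA in \<open>auto intro!: sum_nonneg\<close>)
    finally have "1 \<le> ?other" using w S S' by simp
    moreover have "?T \<le> 1" unfolding triangle by simp
    ultimately show ?thesis using nn(1) by linarith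
  qed
qed

lemma mean_product:
  "mean \<rho> (\<lambda>B. mean \<rho> (\<lambda>C. f B * g C)) = mean \<rho> f * mean \<rho> g"
  by simp

text \<open>
  The main term comes from a common \<open>s\<close>-subset of \<open>A\<close>. In the error term, the factor \<open>m\<close> counts the
  choices of the element outside \<open>A\<close> and is compensated by the two factors \<open>excess\<close>, each of order
  \<open>1 / m\<close>.
\<close>

lemma mean_triangle_upper:
  assumes A: "A \<subseteq> {1..m}"
  shows "N\<^sup>2 * mean \<rho> (\<lambda>B. mean \<rho> (\<lambda>C. meets s A B * meets s A C * meets s B C)) \<le>
    Y (card A) * (mean P Y)\<^sup>2 + (Y (card A))\<^sup>2 * (real m * (mean P (\<lambda>x. Y x * excess x))\<^sup>2)"
proof -
  let ?F = "subsets_of_size s A"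
  define \<eta> where "\<eta> = mean P (\<lambda>x. Y x * excess x)"
  have fA: "finite A" using A by (rule finite_subset_W)
  have s1: "N * mean \<rho> (\<lambda>B. of_bool (S \<subseteq> B)) = mean P Y" if "S \<in> ?F" for S
    using mean_inclusion_s[of S "\<lambda>_. 1"] that A by auto
  have s2: "N * mean \<rho> (\<lambda>B. of_bool (insert w S \<subseteq> B)) = \<eta>" if "S \<in> ?F" "w \<in> {1..m} - A" for S w
  proof -
    have "finite S" using that(1) fA finite_subset by auto
    then have "card (insert w S) = Suc s" using that by (subst card_insert_disjoint) auto
    then show ?thesis
      using mean_inclusion_Suc[of "insert w S" "\<lambda>_. 1"] that A by (auto simp: \<eta>_def)
  qed
  have "mean \<rho> (\<lambda>B. mean \<rho> (\<lambda>C. meets s A B * meets s A C * meets s B C)) \<le>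
      mean \<rho> (\<lambda>B. mean \<rho> (\<lambda>C. (\<Sum>S\<in>?F. of_bool (S \<subseteq> B) * of_bool (S \<subseteq> C)) +
        (\<Sum>S\<in>?F. \<Sum>S'\<in>?F. \<Sum>w\<in>{1..m} - A. of_bool (insert w S \<subseteq> B) * of_bool (insert w S' \<subseteq> C))))"
    using A set_rho by (intro mean_mono[OF finite_rho] triangle_le_sum) auto
  also have "\<dots> = (\<Sum>S\<in>?F. mean \<rho> (\<lambda>B. of_bool (S \<subseteq> B)) * mean \<rho> (\<lambda>C. of_bool (S \<subseteq> C))) +
        (\<Sum>S\<in>?F. \<Sum>S'\<in>?F. \<Sum>w\<in>{1..m} - A.
          mean \<rho> (\<lambda>B. of_bool (insert w S \<subseteq> B)) * mean \<rho> (\<lambda>C. of_bool (insert w S' \<subseteq> C)))"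
    by (simp only: mean_add[OF finite_rho] mean_sum[OF finite_rho] mean_product)
  finally have "N\<^sup>2 * mean \<rho> (\<lambda>B. mean \<rho> (\<lambda>C. meets s A B * meets s A C * meets s B C)) \<le>
      N\<^sup>2 * \<dots>"
    using N_pos by (intro mult_left_mono) auto
  also have "\<dots> = (\<Sum>S\<in>?F. (N * mean \<rho> (\<lambda>B. of_bool (S \<subseteq> B))) * (N * mean \<rho> (\<lambda>C. of_bool (S \<subseteq> C)))) +
        (\<Sum>S\<in>?F. \<Sum>S'\<in>?F. \<Sum>w\<in>{1..m} - A.
          (N * mean \<rho> (\<lambda>B. of_bool (insert w S \<subseteq> B))) * (N * mean \<rho> (\<lambda>C. of_bool (insert w S' \<subseteq> C))))"
    by (simp only: distrib_left sum_distrib_left) (simp only: power2_eq_square mult_ac)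
  also have "(\<Sum>S\<in>?F. (N * mean \<rho> (\<lambda>B. of_bool (S \<subseteq> B))) * (N * mean \<rho> (\<lambda>C. of_bool (S \<subseteq> C)))) =
      (\<Sum>S\<in>?F. (mean P Y)\<^sup>2)"
    by (rule sum.cong) (simp_all only: s1 power2_eq_square)
  also have "(\<Sum>S\<in>?F. \<Sum>S'\<in>?F. \<Sum>w\<in>{1..m} - A.
          (N * mean \<rho> (\<lambda>B. of_bool (insert w S \<subseteq> B))) * (N * mean \<rho> (\<lambda>C. of_bool (insert w S' \<subseteq> C)))) =
      (\<Sum>S\<in>?F. \<Sum>S'\<in>?F. \<Sum>w\<in>{1..m} - A. \<eta>\<^sup>2)"
    by (intro sum.cong refl) (simp only: s2 power2_eq_square)
  also have "\<dots> = (Y (card A))\<^sup>2 * (real (card ({1..m} - A)) * \<eta>\<^sup>2)"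
    by (simp only: sum_constant card_subsets_of_size[OF A]) (simp only: power2_eq_square mult_ac)
  also have "(\<Sum>S\<in>?F. (mean P Y)\<^sup>2) = Y (card A) * (mean P Y)\<^sup>2"
    by (simp only: sum_constant card_subsets_of_size[OF A])
  also have "(Y (card A))\<^sup>2 * (real (card ({1..m} - A)) * \<eta>\<^sup>2) \<le> (Y (card A))\<^sup>2 * (real m * \<eta>\<^sup>2)"
    using card_mono[of "{1..m}" "{1..m} - A"] by (intro mult_left_mono mult_right_mono) auto
  finally show ?thesis by (simp add: \<eta>_def)
qed

text \<open>
  If \<open>B\<close> and \<open>C\<close> have the same trace \<open>S\<close> of size \<open>s\<close> on \<open>A\<close>, then they also share \<open>S\<close> with each other.
\<close>

lemma mean_triangle_lower:
  assumes A: "A \<subseteq> {1..m}"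
  shows "Y (card A) * (max 0 (mean P Y - (real (card A) - real s) * mean P (\<lambda>x. Y x * excess x)))\<^sup>2
    \<le> N\<^sup>2 * mean \<rho> (\<lambda>B. mean \<rho> (\<lambda>C. meets s A B * meets s A C * meets s B C))"
    (is "_ * (max 0 ?L)\<^sup>2 \<le> _")
proof -
  let ?F = "subsets_of_size s A"
  define h where "h S = mean \<rho> (\<lambda>B. of_bool (A \<inter> B = S))" for S
  have fA: "finite A" using A by (rule finite_subset_W)
  have "Y (card A) * (max 0 ?L)\<^sup>2 = (\<Sum>S\<in>?F. (max 0 ?L)\<^sup>2)"
    using card_subsets_of_size[OF A] by simp
  also have "\<dots> \<le> (\<Sum>S\<in>?F. (N * h S)\<^sup>2)"
  proof (intro sum_mono power_mono)
    fix S assume S: "S \<in> ?F"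
    have "0 \<le> h S" unfolding h_def by (rule mean_nonneg) simp
    then show "max 0 ?L \<le> N * h S"
      using mean_trace_lower[OF A, of S "\<lambda>_. 1"] S N_pos by (simp add: h_def)
  qed simp
  also have "\<dots> = N\<^sup>2 * (\<Sum>S\<in>?F. h S * h S)"
    by (simp add: power2_eq_square sum_distrib_left mult_ac)
  also have "(\<Sum>S\<in>?F. h S * h S) =
      mean \<rho> (\<lambda>B. mean \<rho> (\<lambda>C. \<Sum>S\<in>?F. of_bool (A \<inter> B = S) * of_bool (A \<inter> C = S)))"
    unfolding h_def by (simp only: mean_sum[OF finite_rho] mean_product)
  also have "N\<^sup>2 * \<dots> \<le> N\<^sup>2 * mean \<rho> (\<lambda>B. mean \<rho> (\<lambda>C. meets s A B * meets s A C * meets s B C))"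
  proof (intro mult_left_mono mean_mono[OF finite_rho])
    fix B C assume "B \<in> set_pmf \<rho>" "C \<in> set_pmf \<rho>"
    then have fB: "finite B" using set_rho finite_subset_W by blast
    have "(\<Sum>S\<in>?F. of_bool (A \<inter> B = S) * of_bool (A \<inter> C = S) :: real) =
        (\<Sum>S\<in>?F. if S = A \<inter> B then of_bool (A \<inter> C = A \<inter> B) else 0)"
      by (rule sum.cong) auto
    also have "\<dots> = (if card (A \<inter> B) = s then of_bool (A \<inter> C = A \<inter> B) else 0)"
      using fA by (subst sum.delta) auto
    \<comment> \<open>equal traces of size \<open>s\<close> on \<open>A\<close> lie in \<open>B \<inter> C\<close>\<close>
    also have "\<dots> \<le> meets s A B * meets s A C * meets s B C"
    proof (cases "card (A \<inter> B) = s \<and> A \<inter> C = A \<inter> B")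
      case True
      have "card (A \<inter> B) \<le> card (B \<inter> C)"
        using True fB by (intro card_mono) auto
      then show ?thesis using True by (simp add: meets_def)
    qed (auto simp: meets_def)
    finally show "(\<Sum>S\<in>?F. of_bool (A \<inter> B = S) * of_bool (A \<inter> C = S)) \<le>
        meets s A B * meets s A C * meets s B C" .
  qed simp
  finally show ?thesis .
qed

end

section \<open>Assortativity of the finite graph\<close>

text \<open>
  Iterating this exposes finitely many distinct coordinates one after the other and turns joint
  expectations into nested expectations under the common law.
\<close>

lemma mean_Pi_split:
  assumes "finite A" "i \<in> A" "finite (set_pmf q)"
  shows "mean (Pi_pmf A d (\<lambda>_. q)) F =
    mean q (\<lambda>x. mean (Pi_pmf (A - {i}) d (\<lambda>_. q)) (\<lambda>f. F (f(i := x))))"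
proof -
  have "finite (set_pmf (Pi_pmf (A - {i}) d (\<lambda>_. q)))"
    by (rule finite_subset[OF set_Pi_pmf_subset']) (use assms in \<open>auto intro!: finite_PiE_dflt\<close>)
  moreover have "Pi_pmf A d (\<lambda>_. q) =
      map_pmf (\<lambda>(y, f). f(i := y)) (pair_pmf q (Pi_pmf (A - {i}) d (\<lambda>_. q)))"
    using Pi_pmf_insert[of "A - {i}" i d "\<lambda>_. q"] assms by (simp add: insert_absorb)
  ultimately show ?thesis using assms by (simp add: mean_pair)
qed

lemma mean_Pi_two:
  assumes "finite A" "finite (set_pmf q)" "i \<in> A" "j \<in> A" "distinct [i, j]"
  shows "mean (Pi_pmf A d (\<lambda>_. q)) (\<lambda>D. h (D i) (D j)) = mean q (\<lambda>a. mean q (\<lambda>b. h a b))"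
  using assms
  by (subst mean_Pi_split[of _ i], simp_all, subst mean_Pi_split[of _ j], simp_all)

lemma mean_Pi_three:
  assumes "finite A" "finite (set_pmf q)" "i \<in> A" "j \<in> A" "k \<in> A" "distinct [i, j, k]"
  shows "mean (Pi_pmf A d (\<lambda>_. q)) (\<lambda>D. h (D i) (D j) (D k)) =
    mean q (\<lambda>a. mean q (\<lambda>b. mean q (\<lambda>c. h a b c)))"
proof -
  have ne: "j \<noteq> i" "k \<noteq> i" using assms by auto
  have "mean (Pi_pmf A d (\<lambda>_. q)) (\<lambda>D. h (D i) (D j) (D k)) =
      mean q (\<lambda>a. mean (Pi_pmf (A - {i}) d (\<lambda>_. q)) (\<lambda>f. h a (f j) (f k)))"
    using mean_Pi_split[of A i q d "\<lambda>D. h (D i) (D j) (D k)"] assms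
    by (simp add: ne)
  also have "\<dots> = mean q (\<lambda>a. mean q (\<lambda>b. mean q (\<lambda>c. h a b c)))"
    by (intro mean_cong mean_Pi_two) (use assms in auto)
  finally show ?thesis .
qed

lemma mean_Pi_four:
  assumes "finite A" "finite (set_pmf q)" "i \<in> A" "j \<in> A" "k \<in> A" "l \<in> A" "distinct [i, j, k, l]"
  shows "mean (Pi_pmf A d (\<lambda>_. q)) (\<lambda>D. h (D i) (D j) (D k) (D l)) =
    mean q (\<lambda>a. mean q (\<lambda>b. mean q (\<lambda>c. mean q (\<lambda>e. h a b c e))))"
proof -
  have ne: "j \<noteq> i" "k \<noteq> i" "l \<noteq> i" using assms by auto
  have "mean (Pi_pmf A d (\<lambda>_. q)) (\<lambda>D. h (D i) (D j) (D k) (D l)) =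
      mean q (\<lambda>a. mean (Pi_pmf (A - {i}) d (\<lambda>_. q)) (\<lambda>f. h a (f j) (f k) (f l)))"
    using mean_Pi_split[of A i q d "\<lambda>D. h (D i) (D j) (D k) (D l)"] assms
    by (simp add: ne)
  also have "\<dots> = mean q (\<lambda>a. mean q (\<lambda>b. mean q (\<lambda>c. mean q (\<lambda>e. h a b c e))))"
    by (intro mean_cong mean_Pi_three) (use assms in auto)
  finally show ?thesis .
qed

lemma degree_intersection_edges:
  assumes "u \<in> {1..n}"
  shows "real (degree (intersection_edges s n D) u) = (\<Sum>k\<in>{1..n} - {u}. meets s (D u) (D k))"
proof -
  have "{k. (u, k) \<in> intersection_edges s n D} = {k \<in> {1..n} - {u}. s \<le> card (D u \<inter> D k)}"
    using assms by (auto simp: intersection_edges_def)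
  then have "real (degree (intersection_edges s n D) u) =
      (\<Sum>k\<in>{k \<in> {1..n} - {u}. s \<le> card (D u \<inter> D k)}. 1)"
    by (simp add: degree_def)
  also have "\<dots> = (\<Sum>k\<in>{1..n} - {u}. if s \<le> card (D u \<inter> D k) then 1 else 0)"
    by (rule sum.inter_filter) simp
  also have "\<dots> = (\<Sum>k\<in>{1..n} - {u}. meets s (D u) (D k))"
    by (rule sum.cong) (simp_all add: meets_def)
  finally show ?thesis .
qed

text \<open>
  Used for two further neighbours \<open>k\<close> and \<open>l\<close> of an edge: by exchangeability the expectation depends only
  on whether they coincide.
\<close>

lemma sum_diagonal_split:
  assumes "finite R" and "\<And>k. k \<in> R \<Longrightarrow> f k k = x"
    and "\<And>k l. k \<in> R \<Longrightarrow> l \<in> R \<Longrightarrow> k \<noteq> l \<Longrightarrow> f k l = y"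
  shows "(\<Sum>k\<in>R. \<Sum>l\<in>R. f k l) = real (card R) * x + real (card R) * (real (card R) - 1) * y"
proof -
  have "(\<Sum>l\<in>R. f k l) = x + (real (card R) - 1) * y" if k: "k \<in> R" for k
  proof -
    have "(\<Sum>l\<in>R. f k l) = f k k + (\<Sum>l\<in>R - {k}. f k l)"
      using assms(1) k by (rule sum.remove)
    also have "(\<Sum>l\<in>R - {k}. f k l) = (\<Sum>l\<in>R - {k}. y)"
      by (rule sum.cong) (use assms k in auto)
    moreover have "card R \<ge> 1" using assms(1) k by (metis One_nat_def Suc_leI card_gt_0_iff empty_iff)
    ultimately show ?thesis using assms k by (simp add: card_Diff_subset of_nat_diff)
  qed
  then have "(\<Sum>k\<in>R. \<Sum>l\<in>R. f k l) = (\<Sum>k\<in>R. x + (real (card R) - 1) * y)"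
    by (intro sum.cong) auto
  then show ?thesis by (simp add: algebra_simps)
qed

context subset_law
begin

text \<open>
  The constants below are the probabilities that prescribed edges between distinct prescribed
  vertices are all present. For trees, the leaves have been integrated out, each leaving a factor \<open>H\<close>
  at its neighbour.
\<close>

definition H :: "nat set \<Rightarrow> real" where "H A = mean \<rho> (meets s A)"

definition edge_prob :: real where "edge_prob = mean \<rho> H"
definition star2_prob :: real where "star2_prob = mean \<rho> (\<lambda>A. (H A)\<^sup>2)"
definition star3_prob :: real where "star3_prob = mean \<rho> (\<lambda>A. H A ^ 3)"
definition path4_prob :: real where
  "path4_prob = mean \<rho> (\<lambda>A. H A * mean \<rho> (\<lambda>B. meets s A B * H B))"
definition triangle_prob :: real where
  "triangle_prob =
    mean \<rho> (\<lambda>A. mean \<rho> (\<lambda>B. mean \<rho> (\<lambda>C. meets s A B * meets s A C * meets s B C)))"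

lemma finite_active_sets: "finite (set_pmf (active_sets n m P))"
  unfolding active_sets_def
  by (rule finite_subset[OF set_Pi_pmf_subset']) (auto intro!: finite_PiE_dflt finite_rho)

lemma mean_edge:
  assumes "u \<in> {1..n}" "v \<in> {1..n}" "u \<noteq> v"
  shows "mean (active_sets n m P) (\<lambda>D. meets s (D u) (D v)) = edge_prob"
  unfolding active_sets_def edge_prob_def H_def[abs_def]
  by (rule mean_Pi_two) (use assms finite_rho in auto)

lemma mean_star2:
  assumes "u \<in> {1..n}" "v \<in> {1..n}" "k \<in> {1..n}" "distinct [u, v, k]"
  shows "mean (active_sets n m P) (\<lambda>D. meets s (D u) (D v) * meets s (D u) (D k)) = star2_prob"
  unfolding active_sets_def star2_prob_def H_def[abs_def]
  by (subst mean_Pi_three) (use assms finite_rho in \<open>auto simp: power2_eq_square\<close>)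

lemma mean_star3:
  assumes "u \<in> {1..n}" "v \<in> {1..n}" "k \<in> {1..n}" "l \<in> {1..n}" "distinct [u, v, k, l]"
  shows "mean (active_sets n m P) (\<lambda>D. meets s (D u) (D v) * (meets s (D u) (D k) * meets s (D u) (D l))) = star3_prob"
  unfolding active_sets_def star3_prob_def H_def[abs_def]
  by (subst mean_Pi_four) (use assms finite_rho in \<open>auto simp: power3_eq_cube mult_ac\<close>)

lemma mean_path4:
  assumes "u \<in> {1..n}" "v \<in> {1..n}" "k \<in> {1..n}" "l \<in> {1..n}" "distinct [u, v, k, l]"
  shows "mean (active_sets n m P) (\<lambda>D. meets s (D u) (D v) * (meets s (D u) (D k) * meets s (D v) (D l))) = path4_prob"
proof -
  have "mean (active_sets n m P) (\<lambda>D. meets s (D u) (D v) * (meets s (D u) (D k) * meets s (D v) (D l))) =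
      mean \<rho> (\<lambda>a. mean \<rho> (\<lambda>b. meets s a b * (H a * H b)))"
    unfolding active_sets_def H_def
    by (subst mean_Pi_four[where h = "\<lambda>a b c e. meets s a b * (meets s a c * meets s b e)"])
      (use assms finite_rho in auto)
  also have "\<dots> = mean \<rho> (\<lambda>a. mean \<rho> (\<lambda>b. H a * (meets s a b * H b)))"
    by (simp add: mult_ac)
  finally show ?thesis by (simp add: path4_prob_def)
qed

lemma mean_triangle:
  assumes "u \<in> {1..n}" "v \<in> {1..n}" "k \<in> {1..n}" "distinct [u, v, k]"
  shows "mean (active_sets n m P) (\<lambda>D. meets s (D u) (D v) * (meets s (D u) (D k) * meets s (D v) (D k))) = triangle_prob"
  unfolding active_sets_def triangle_prob_def
  by (subst mean_Pi_three[where h = "\<lambda>a b c. meets s a b * (meets s a c * meets s b c)"])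
    (use assms finite_rho in \<open>auto simp: mult.assoc\<close>)

text \<open>
  Conditioning on a uniformly chosen pair being adjacent amounts to dividing by the edge probability,
  provided that the expectation does not depend on the pair. Exchangeability guarantees this for the
  functions of interest.
\<close>

lemma mean_edge_conditioned:
  assumes n: "n \<ge> 2" and p: "edge_prob \<noteq> 0"
    and f: "\<And>u v. u \<in> {1..n} \<Longrightarrow> v \<in> {1..n} \<Longrightarrow> u \<noteq> v \<Longrightarrow>
      mean (active_sets n m P) (\<lambda>D. meets s (D u) (D v) * f (intersection_edges s n D) u v) = c"
  shows "mean (edge_conditioned n (active_graph s n m P)) (\<lambda>(E, u, v). f E u v) = c / edge_prob"
proof -
  let ?V = "{(u, v). u \<in> {1..n} \<and> v \<in> {1..n} \<and> u \<noteq> v}"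
  let ?G = "active_graph s n m P"
  have "?V \<subseteq> {1..n} \<times> {1..n}" by auto
  then have finV: "finite ?V" by (rule finite_subset) simp
  have "(1, 2) \<in> ?V" using n by simp
  then have neV: "?V \<noteq> {}" by blast
  have finG: "finite (set_pmf ?G)" by (simp add: active_graph_def finite_active_sets)
  have edge: "of_bool ((u, v) \<in> intersection_edges s n D) = meets s (D u) (D v)"
    if "(u, v) \<in> ?V" for u v D
    using that by (auto simp: intersection_edges_def meets_def)
  have avg: "mean (pair_pmf ?G (pmf_of_set ?V)) (\<lambda>x. of_bool (x \<in> {(E, u, v). (u, v) \<in> E}) * (case x of (E, u, v) \<Rightarrow> g E u v)) = d"
    if g: "\<And>u v. u \<in> {1..n} \<Longrightarrow> v \<in> {1..n} \<Longrightarrow> u \<noteq> v \<Longrightarrow>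
      mean (active_sets n m P) (\<lambda>D. meets s (D u) (D v) * g (intersection_edges s n D) u v) = d" for g d
  proof -
    have "mean (pair_pmf ?G (pmf_of_set ?V)) (\<lambda>x. of_bool (x \<in> {(E, u, v). (u, v) \<in> E}) * (case x of (E, u, v) \<Rightarrow> g E u v)) =
        mean (pmf_of_set ?V) (\<lambda>(u, v). mean ?G (\<lambda>E. of_bool ((u, v) \<in> E) * g E u v))"
    proof -
      define Q where "Q = pmf_of_set ?V"
      have finQ: "finite (set_pmf Q)" using finV neV by (simp add: Q_def)
      have "mean (pair_pmf ?G Q) (\<lambda>x. of_bool (x \<in> {(E, u, v). (u, v) \<in> E}) * (case x of (E, u, v) \<Rightarrow> g E u v)) =
          mean ?G (\<lambda>E. mean Q (\<lambda>(u, v). of_bool ((u, v) \<in> E) * g E u v))"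
        unfolding mean_pair[OF finG finQ] by (intro mean_cong) (auto split: prod.splits)
      also have "\<dots> = mean Q (\<lambda>e. mean ?G (\<lambda>E. case e of (u, v) \<Rightarrow> of_bool ((u, v) \<in> E) * g E u v))"
        using finG finQ by (rule mean_swap)
      finally show ?thesis unfolding Q_def by (simp only: split_def)
    qed
    also have "\<dots> = mean (pmf_of_set ?V) (\<lambda>_. d)"
    proof (rule mean_cong, clarify)
      fix u v assume "(u, v) \<in> set_pmf (pmf_of_set ?V)"
      then have uv: "(u, v) \<in> ?V" using finV neV by simp
      show "mean ?G (\<lambda>E. of_bool ((u, v) \<in> E) * g E u v) = d"
        unfolding active_graph_def using uv g by (simp add: edge[OF uv])
    qed
    finally show ?thesis by simp
  qed
  have "mean (pair_pmf ?G (pmf_of_set ?V)) (\<lambda>x. of_bool (x \<in> {(E, u, v). (u, v) \<in> E})) = edge_prob"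
    using avg[of "\<lambda>_ _ _. 1" edge_prob] mean_edge by (simp add: case_prod_beta)
  moreover have "set_pmf (pair_pmf ?G (pmf_of_set ?V)) \<inter> {(E, u, v). (u, v) \<in> E} \<noteq> {}"
  proof
    assume "set_pmf (pair_pmf ?G (pmf_of_set ?V)) \<inter> {(E, u, v). (u, v) \<in> E} = {}"
    then have "mean (pair_pmf ?G (pmf_of_set ?V)) (\<lambda>x. of_bool (x \<in> {(E, u, v). (u, v) \<in> E})) =
        mean (pair_pmf ?G (pmf_of_set ?V)) (\<lambda>x. 0)"
      by (intro mean_cong) (auto simp: of_bool_def)
    then show False using calculation p by simp
  qed
  ultimately show ?thesis
    unfolding edge_conditioned_def using finG finV neV avg[OF f]
    by (subst mean_cond) auto
qed

text \<open>
  Given the edge \<open>uv\<close>, the vertex \<open>v\<close> is one neighbour of \<open>u\<close>, and the others range over the remaining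
  \<open>n - 2\<close> vertices.
\<close>

lemma degree_on_edge:
  assumes "u \<in> {1..n}" "v \<in> {1..n}" "u \<noteq> v"
  shows "meets s (D u) (D v) * real (degree (intersection_edges s n D) u) =
    meets s (D u) (D v) * (1 + (\<Sum>k\<in>{1..n} - {u, v}. meets s (D u) (D k)))"
proof -
  have "(\<Sum>k\<in>{1..n} - {u}. meets s (D u) (D k)) =
      meets s (D u) (D v) + (\<Sum>k\<in>{1..n} - {u} - {v}. meets s (D u) (D k))"
    by (rule sum.remove) (use assms in auto)
  moreover have "{1..n} - {u} - {v} = {1..n} - {u, v}" by auto
  ultimately have "meets s (D u) (D v) * real (degree (intersection_edges s n D) u) =
      meets s (D u) (D v) * meets s (D u) (D v) +
      meets s (D u) (D v) * (\<Sum>k\<in>{1..n} - {u, v}. meets s (D u) (D k))"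
    using degree_intersection_edges[OF assms(1)] by (simp add: distrib_left)
  then show ?thesis by (simp add: meets_idem distrib_left)
qed

text \<open>
  Conditionally on the edge \<open>uv\<close>, the degrees are \<open>1 + A\<close> and \<open>1 + B\<close>, where \<open>A\<close> and \<open>B\<close> count the further
  neighbours of \<open>u\<close> and of \<open>v\<close>. The coefficient is invariant under translation, so it is the quotient of
  the covariance of \<open>A\<close> and \<open>B\<close> by the variance of \<open>A\<close>. In \<open>A * B\<close>, equal neighbours form triangles and
  different ones paths with three edges; in \<open>A\<^sup>2\<close> they form stars with two and three leaves.
\<close>

lemma assortativity_eq:
  assumes n: "n \<ge> 2" and p: "edge_prob \<noteq> 0"
  defines "x \<equiv> real n - 2" and "y \<equiv> (real n - 2) * (real n - 3)"
  shows "assortativity n (active_graph s n m P) =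
    (x * triangle_prob / edge_prob + y * path4_prob / edge_prob - (x * star2_prob / edge_prob)\<^sup>2) /
    (x * star2_prob / edge_prob + y * star3_prob / edge_prob - (x * star2_prob / edge_prob)\<^sup>2)"
proof -
  let ?G = "active_graph s n m P"
  let ?\<mu> = "edge_conditioned n ?G"
  have R: "real (card ({1..n} - {u, v})) = x" if "u \<in> {1..n}" "v \<in> {1..n}" "u \<noteq> v" for u v
    using that n by (simp add: card_Diff_subset x_def of_nat_diff)
  have xy: "x * (x - 1) = y" by (simp add: x_def y_def)
  note lin = mean_add[OF finite_active_sets] mean_sum[OF finite_active_sets]
  have b: "mean ?\<mu> (\<lambda>(E, u, v). real (degree E u)) = (edge_prob + x * star2_prob) / edge_prob"
  proof (rule mean_edge_conditioned[OF n p])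
    fix u v assume uv: "u \<in> {1..n}" "v \<in> {1..n}" "u \<noteq> v"
    let ?R = "{1..n} - {u, v}"
    have "mean (active_sets n m P) (\<lambda>D. meets s (D u) (D v) * real (degree (intersection_edges s n D) u)) =
      mean (active_sets n m P) (\<lambda>D. meets s (D u) (D v) + (\<Sum>k\<in>?R. meets s (D u) (D v) * meets s (D u) (D k)))"
      by (simp only: degree_on_edge[OF uv] distrib_left sum_distrib_left mult_1_right)
    also have "\<dots> = edge_prob + (\<Sum>k\<in>?R. star2_prob)"
      unfolding lin mean_edge[OF uv] using uv by (intro arg_cong2[where f = "(+)"] refl sum.cong mean_star2) auto
    finally show "mean (active_sets n m P) (\<lambda>D. meets s (D u) (D v) * real (degree (intersection_edges s n D) u)) =
      edge_prob + x * star2_prob" using R[OF uv] by simp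
  qed
  have b': "mean ?\<mu> (\<lambda>(E, u, v). (real (degree E u))\<^sup>2) =
      (edge_prob + x * star2_prob + x * star2_prob + (x * star2_prob + y * star3_prob)) / edge_prob"
  proof (rule mean_edge_conditioned[OF n p])
    fix u v assume uv: "u \<in> {1..n}" "v \<in> {1..n}" "u \<noteq> v"
    let ?R = "{1..n} - {u, v}"
    have sq: "meets s (D u) (D v) * (real (degree (intersection_edges s n D) u))\<^sup>2 =
        meets s (D u) (D v) + (\<Sum>k\<in>?R. meets s (D u) (D v) * meets s (D u) (D k))
        + (\<Sum>k\<in>?R. meets s (D u) (D v) * meets s (D u) (D k))
        + (\<Sum>k\<in>?R. \<Sum>l\<in>?R. meets s (D u) (D v) * (meets s (D u) (D k) * meets s (D u) (D l)))" for D
    proof -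
      let ?i = "meets s (D u) (D v)" and ?S = "\<Sum>k\<in>?R. meets s (D u) (D k)"
      have "?i * (real (degree (intersection_edges s n D) u))\<^sup>2 = ?i * ((1 + ?S) * (1 + ?S))"
        using degree_on_edge[OF uv, of D] by (simp add: meets_def power2_eq_square)
      also have "\<dots> = ?i + ?i * ?S + ?i * ?S + ?i * (?S * ?S)" by (simp add: algebra_simps)
      also have "?S * ?S = (\<Sum>k\<in>?R. \<Sum>l\<in>?R. meets s (D u) (D k) * meets s (D u) (D l))"
        by (rule sum_product)
      finally show ?thesis by (simp only: sum_distrib_left)
    qed
    have s2: "(\<Sum>k\<in>?R. mean (active_sets n m P) (\<lambda>D. meets s (D u) (D v) * meets s (D u) (D k))) = (\<Sum>k\<in>?R. star2_prob)"
      using uv by (intro sum.cong mean_star2) auto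
    have "(\<Sum>k\<in>?R. \<Sum>l\<in>?R. mean (active_sets n m P) (\<lambda>D. meets s (D u) (D v) * (meets s (D u) (D k) * meets s (D u) (D l)))) =
      x * star2_prob + x * (x - 1) * star3_prob"
      unfolding R[OF uv, symmetric]
    proof (rule sum_diagonal_split)
      show "mean (active_sets n m P) (\<lambda>D. meets s (D u) (D v) * (meets s (D u) (D k) * meets s (D u) (D k))) = star2_prob"
        if "k \<in> ?R" for k
        unfolding meets_idem using uv that by (intro mean_star2) auto
      show "mean (active_sets n m P) (\<lambda>D. meets s (D u) (D v) * (meets s (D u) (D k) * meets s (D u) (D l))) = star3_prob"
        if "k \<in> ?R" "l \<in> ?R" "k \<noteq> l" for k l
        using uv that by (intro mean_star3) auto
    qed simp
    then show "mean (active_sets n m P) (\<lambda>D. meets s (D u) (D v) * (real (degree (intersection_edges s n D) u))\<^sup>2) =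
      edge_prob + x * star2_prob + x * star2_prob + (x * star2_prob + y * star3_prob)"
      unfolding sq lin mean_edge[OF uv] s2 xy using R[OF uv] by simp
  qed
  have g: "mean ?\<mu> (\<lambda>(E, u, v). real (degree E u) * real (degree E v)) =
      (edge_prob + x * star2_prob + x * star2_prob + (x * triangle_prob + y * path4_prob)) / edge_prob"
  proof (rule mean_edge_conditioned[OF n p])
    fix u v assume uv: "u \<in> {1..n}" "v \<in> {1..n}" "u \<noteq> v"
    let ?R = "{1..n} - {u, v}"
    have pr: "meets s (D u) (D v) * (real (degree (intersection_edges s n D) u) * real (degree (intersection_edges s n D) v)) =
        meets s (D u) (D v) + (\<Sum>k\<in>?R. meets s (D u) (D v) * meets s (D u) (D k))
        + (\<Sum>k\<in>?R. meets s (D v) (D u) * meets s (D v) (D k))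
        + (\<Sum>k\<in>?R. \<Sum>l\<in>?R. meets s (D u) (D v) * (meets s (D u) (D k) * meets s (D v) (D l)))" for D
    proof -
      let ?i = "meets s (D u) (D v)"
      let ?S = "\<Sum>k\<in>?R. meets s (D u) (D k)" and ?T = "\<Sum>k\<in>?R. meets s (D v) (D k)"
      have "{1..n} - {v, u} = ?R" by auto
      then have "?i * (real (degree (intersection_edges s n D) u) * real (degree (intersection_edges s n D) v)) =
          ?i * ((1 + ?S) * (1 + ?T))"
        using degree_on_edge[OF uv, of D] degree_on_edge[OF uv(2,1) uv(3)[symmetric], of D]
        by (simp add: meets_def Int_commute)
      also have "\<dots> = ?i + ?i * ?S + ?i * ?T + ?i * (?S * ?T)" by (simp add: algebra_simps)
      also have "?S * ?T = (\<Sum>k\<in>?R. \<Sum>l\<in>?R. meets s (D u) (D k) * meets s (D v) (D l))"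
        by (rule sum_product)
      finally show ?thesis
        by (simp only: sum_distrib_left meets_commute[of s "D v" "D u"])
    qed
    have s2: "(\<Sum>k\<in>?R. mean (active_sets n m P) (\<lambda>D. meets s (D u) (D v) * meets s (D u) (D k))) = (\<Sum>k\<in>?R. star2_prob)"
      "(\<Sum>k\<in>?R. mean (active_sets n m P) (\<lambda>D. meets s (D v) (D u) * meets s (D v) (D k))) = (\<Sum>k\<in>?R. star2_prob)"
      using uv by (intro sum.cong mean_star2; auto)+
    have "(\<Sum>k\<in>?R. \<Sum>l\<in>?R. mean (active_sets n m P) (\<lambda>D. meets s (D u) (D v) * (meets s (D u) (D k) * meets s (D v) (D l)))) =
      x * triangle_prob + x * (x - 1) * path4_prob"
      unfolding R[OF uv, symmetric]
    proof (rule sum_diagonal_split)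
      show "mean (active_sets n m P) (\<lambda>D. meets s (D u) (D v) * (meets s (D u) (D k) * meets s (D v) (D k))) = triangle_prob"
        if "k \<in> ?R" for k
        using uv that by (intro mean_triangle) auto
      show "mean (active_sets n m P) (\<lambda>D. meets s (D u) (D v) * (meets s (D u) (D k) * meets s (D v) (D l))) = path4_prob"
        if "k \<in> ?R" "l \<in> ?R" "k \<noteq> l" for k l
        using uv that by (intro mean_path4) auto
    qed simp
    then show "mean (active_sets n m P) (\<lambda>D. meets s (D u) (D v) * (real (degree (intersection_edges s n D) u) * real (degree (intersection_edges s n D) v))) =
      edge_prob + x * star2_prob + x * star2_prob + (x * triangle_prob + y * path4_prob)"
      unfolding pr lin mean_edge[OF uv] s2 xy using R[OF uv] by simp
  qed
  \<comment> \<open>\<open>w\<close> is the conditional mean of the number of further neighbours\<close>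
  define w where "w = x * star2_prob / edge_prob"
  have "assortativity n ?G =
      ((1 + w + w + (x * triangle_prob / edge_prob + y * path4_prob / edge_prob)) - (1 + w)\<^sup>2) /
      ((1 + w + w + (w + y * star3_prob / edge_prob)) - (1 + w)\<^sup>2)"
    unfolding assortativity_def Let_def b b' g w_def using p by (simp add: add_divide_distrib)
  also have "\<dots> = (x * triangle_prob / edge_prob + y * path4_prob / edge_prob - w\<^sup>2) /
      (w + y * star3_prob / edge_prob - w\<^sup>2)"
    by (intro arg_cong2[where f = "(/)"]) (simp_all add: power2_eq_square algebra_simps)
  finally show ?thesis by (simp only: w_def)
qed

end

section \<open>Limits along a sequence of size distributions\<close>

text \<open>
  This makes \<open>Y\<close> large whenever the size is large, so that cutting off large sizes and cutting off large
  values of \<open>Y\<close> are interchangeable.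
\<close>

lemma le_binomial:
  fixes s x :: nat
  assumes "1 \<le> s" "s \<le> x"
  shows "x - s + 1 \<le> x choose s"
  using assms(2)
proof (induction x rule: dec_induct)
  case base then show ?case by simp
next
  case (step x)
  obtain t where s: "s = Suc t" using assms(1) by (cases s) auto
  have "1 \<le> x choose t" using step s by (simp add: Suc_le_eq)
  then show ?case using step s by simp
qed

locale size_sequence =
  fixes s :: nat and m :: "nat \<Rightarrow> nat" and P :: "nat \<Rightarrow> nat pmf"
  assumes s_pos: "s > 0"
    and P_supp: "\<And>n. n \<ge> 1 \<Longrightarrow> set_pmf (P n) \<subseteq> {0..m n}"
    and m_top: "filterlim m at_top sequentially"
begin

abbreviation "Y \<equiv> subset_law.Y s"
abbreviation "N n \<equiv> subset_law.N s (m n)"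
abbreviation "\<rho> n \<equiv> random_subset (m n) (P n)"

lemma eventually_law: "\<forall>\<^sub>F n in sequentially. subset_law s (m n) (P n)"
proof -
  have "\<forall>\<^sub>F n in sequentially. Suc s \<le> m n"
    using m_top by (simp add: filterlim_at_top)
  with eventually_ge_at_top[of 1] show ?thesis
    by eventually_elim (use P_supp in \<open>simp add: subset_law_def Suc_le_eq\<close>)
qed

lemma Y_eq: "Y x = real (x choose s)"
proof -
  have "subset_law s (Suc s) (return_pmf 0)" by unfold_locales auto
  then show ?thesis by (rule subset_law.Y_def)
qed

lemma Y_nonneg: "0 \<le> Y x"
  by (simp add: Y_eq)

lemma Y_ge: "real x - real s + 1 \<le> Y x" if "s \<le> x"
  using le_binomial[of s x] s_pos that by (simp add: Y_eq)

lemma Y_cases: "Y x = 0 \<or> 1 \<le> Y x"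
  by (simp add: Y_eq Suc_le_eq) linarith

lemma Y_le_square: "Y x \<le> (Y x)\<^sup>2"
  using Y_cases[of x] by (auto simp: power2_eq_square)

text \<open>
  Uniform integrability of \<open>Y ^ k\<close> under the laws \<open>P n\<close>. The tail is cut at a size instead of a value of
  \<open>Y\<close>, so that only finitely many sizes remain and pointwise convergence on them is uniform.
\<close>

definition uniform_tail :: "nat \<Rightarrow> bool" where
  "uniform_tail k \<longleftrightarrow>
    (\<forall>\<epsilon>>0. \<exists>L. \<forall>\<^sub>F n in sequentially. mean (P n) (\<lambda>x. Y x ^ k * of_bool (L < x)) < \<epsilon>)"

definition moment_limit :: "nat \<Rightarrow> real \<Rightarrow> bool" where
  "moment_limit k \<alpha> \<longleftrightarrow> (\<lambda>n. mean (P n) (\<lambda>x. Y x ^ k)) \<longlonglongrightarrow> \<alpha>"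

text \<open>
  Dominated convergence for varying laws on the natural numbers: the finitely many sizes below the
  cut contribute little by pointwise convergence, those above it by uniform integrability.
\<close>

lemma mean_vanishes:
  assumes tail: "uniform_tail k"
    and bound: "\<forall>\<^sub>F n in sequentially. \<forall>x\<in>set_pmf (P n). \<bar>e n x\<bar> \<le> C * Y x ^ k"
    and lim: "\<And>x. (\<lambda>n. e n x) \<longlonglongrightarrow> (0 :: real)"
  shows "(\<lambda>n. mean (P n) (e n)) \<longlonglongrightarrow> 0"
proof (rule tendstoI)
  fix \<epsilon> :: real assume "\<epsilon> > 0"
  define c where "c = \<bar>C\<bar> + 1"
  have c: "c > 0" "C \<le> c" by (auto simp: c_def)
  have "\<epsilon> / (2 * c) > 0" using \<open>\<epsilon> > 0\<close> c by simp
  then obtain L where L: "\<forall>\<^sub>F n in sequentially. mean (P n) (\<lambda>x. Y x ^ k * of_bool (L < x)) < \<epsilon> / (2 * c)"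
    using tail unfolding uniform_tail_def by blast
  have "(\<lambda>n. \<Sum>x\<le>L. \<bar>e n x\<bar>) \<longlonglongrightarrow> (\<Sum>x\<le>L. \<bar>0 :: real\<bar>)"
    by (intro tendsto_intros lim)
  then have "\<forall>\<^sub>F n in sequentially. (\<Sum>x\<le>L. \<bar>e n x\<bar>) < \<epsilon> / 2"
    using \<open>\<epsilon> > 0\<close> by (intro order_tendstoD(2)) auto
  with L bound eventually_law show "\<forall>\<^sub>F n in sequentially. dist (mean (P n) (e n)) 0 < \<epsilon>"
  proof eventually_elim
    case (elim n)
    interpret L: subset_law s "m n" "P n" by fact
    have "\<bar>mean (P n) (e n)\<bar> \<le>
        mean (P n) (\<lambda>x. (\<Sum>x\<le>L. \<bar>e n x\<bar>) + c * (Y x ^ k * of_bool (L < x)))"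
    proof (rule abs_mean_le[OF L.finite_P])
      fix x assume x: "x \<in> set_pmf (P n)"
      have nn: "0 \<le> (\<Sum>x\<le>L. \<bar>e n x\<bar>)" by (simp add: sum_nonneg)
      show "\<bar>e n x\<bar> \<le> (\<Sum>x\<le>L. \<bar>e n x\<bar>) + c * (Y x ^ k * of_bool (L < x))"
      proof (cases "L < x")
        case True
        have "\<bar>e n x\<bar> \<le> C * Y x ^ k" using elim(2) x by blast
        also have "\<dots> \<le> c * Y x ^ k"
          using c Y_nonneg by (intro mult_right_mono) auto
        finally show ?thesis using True by (simp add: add_increasing[OF nn])
      next
        case False
        then have "\<bar>e n x\<bar> \<le> (\<Sum>x\<le>L. \<bar>e n x\<bar>)"
          by (intro member_le_sum) auto
        then show ?thesis using False by simp
      qed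
    qed
    also have "\<dots> = (\<Sum>x\<le>L. \<bar>e n x\<bar>) + c * mean (P n) (\<lambda>x. Y x ^ k * of_bool (L < x))"
      by (subst mean_add[OF L.finite_P]) simp
    also have "\<dots> < \<epsilon> / 2 + c * (\<epsilon> / (2 * c))"
      using elim(1) elim(4) c by (intro add_strict_mono mult_strict_left_mono) auto
    also have "\<dots> = \<epsilon>" using c by (simp add: field_simps)
    finally show ?case by simp
  qed
qed

text \<open>
  A function of the random set is replaced by a function of its size alone. The error \<open>e\<close> is also
  required to depend on the size only: then it can be integrated against the adjacency kernel with
  \<open>mean_meets_upper\<close>, and its expectation can be treated by \<open>mean_vanishes\<close>.
\<close>

definition size_approx :: "nat \<Rightarrow> (nat \<Rightarrow> nat set \<Rightarrow> real) \<Rightarrow> (nat \<Rightarrow> real) \<Rightarrow> bool" where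
  "size_approx k f g \<longleftrightarrow> (\<exists>e C. (\<forall>x. (\<lambda>n. e n x) \<longlonglongrightarrow> 0) \<and>
    (\<forall>\<^sub>F n in sequentially. (\<forall>x\<in>set_pmf (P n). 0 \<le> e n x \<and> e n x \<le> C * Y x ^ k) \<and>
      (\<forall>A\<in>set_pmf (\<rho> n). \<bar>f n A - g (card A)\<bar> \<le> e n (card A))))"

lemma size_approxI:
  assumes "\<And>x. (\<lambda>n. e n x) \<longlonglongrightarrow> 0"
    and "\<forall>\<^sub>F n in sequentially. (\<forall>x\<in>set_pmf (P n). 0 \<le> e n x \<and> e n x \<le> C * Y x ^ k) \<and>
      (\<forall>A\<in>set_pmf (\<rho> n). \<bar>f n A - g (card A)\<bar> \<le> e n (card A))"
  shows "size_approx k f g"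
  unfolding size_approx_def using assms by blast

lemma mean_size_approx_diff:
  assumes f: "size_approx k f g" and tail: "uniform_tail k"
  shows "(\<lambda>n. mean (\<rho> n) (f n) - mean (P n) g) \<longlonglongrightarrow> 0"
proof -
  from f obtain e C where e: "\<And>x. (\<lambda>n. e n x) \<longlonglongrightarrow> 0"
    and bound: "\<forall>\<^sub>F n in sequentially. (\<forall>x\<in>set_pmf (P n). 0 \<le> e n x \<and> e n x \<le> C * Y x ^ k) \<and>
      (\<forall>A\<in>set_pmf (\<rho> n). \<bar>f n A - g (card A)\<bar> \<le> e n (card A))"
    unfolding size_approx_def by blast
  have lim: "(\<lambda>n. mean (P n) (e n)) \<longlonglongrightarrow> 0"
    by (rule mean_vanishes[OF tail _ e, where C = C]) (use bound in eventually_elim, auto)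
  show ?thesis
  proof (rule Lim_null_comparison[OF _ lim])
    show "\<forall>\<^sub>F n in sequentially. norm (mean (\<rho> n) (f n) - mean (P n) g) \<le> mean (P n) (e n)"
      using bound eventually_law
    proof eventually_elim
      case (elim n)
      interpret L: subset_law s "m n" "P n" by fact
      have "mean (\<rho> n) (f n) - mean (P n) g = mean (\<rho> n) (\<lambda>A. f n A - g (card A))"
        by (simp add: mean_diff[OF L.finite_rho] mean_card_random_subset[OF L.P_le])
      also have "\<bar>\<dots>\<bar> \<le> mean (\<rho> n) (\<lambda>A. e n (card A))"
        using elim by (intro abs_mean_le[OF L.finite_rho]) auto
      also have "\<dots> = mean (P n) (e n)"
        by (rule mean_card_random_subset[OF L.P_le])
      finally show ?case by simp
    qed
  qed
qed

lemma mean_size_approx: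
  assumes "size_approx k f (\<lambda>x. c * Y x ^ j)" and "uniform_tail k" and "moment_limit j \<alpha>"
  shows "(\<lambda>n. mean (\<rho> n) (f n)) \<longlonglongrightarrow> c * \<alpha>"
proof -
  have "(\<lambda>n. mean (P n) (\<lambda>x. c * Y x ^ j)) \<longlonglongrightarrow> c * \<alpha>"
    using assms(3) unfolding moment_limit_def by (simp add: tendsto_mult_left)
  from tendsto_add[OF mean_size_approx_diff[OF assms(1,2)] this] show ?thesis by simp
qed

lemma size_approx_mult:
  assumes f: "size_approx j f (\<lambda>x. c * Y x ^ j)" and g: "size_approx k g (\<lambda>x. d * Y x ^ k)"
  shows "size_approx (j + k) (\<lambda>n A. f n A * g n A) (\<lambda>x. (c * d) * Y x ^ (j + k))"
proof -
  from f obtain e C where e: "\<And>x. (\<lambda>n. e n x) \<longlonglongrightarrow> 0"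
    and be: "\<forall>\<^sub>F n in sequentially. (\<forall>x\<in>set_pmf (P n). 0 \<le> e n x \<and> e n x \<le> C * Y x ^ j) \<and>
      (\<forall>A\<in>set_pmf (\<rho> n). \<bar>f n A - c * Y (card A) ^ j\<bar> \<le> e n (card A))"
    unfolding size_approx_def by blast
  from g obtain e' C' where e': "\<And>x. (\<lambda>n. e' n x) \<longlonglongrightarrow> 0"
    and be': "\<forall>\<^sub>F n in sequentially. (\<forall>x\<in>set_pmf (P n). 0 \<le> e' n x \<and> e' n x \<le> C' * Y x ^ k) \<and>
      (\<forall>A\<in>set_pmf (\<rho> n). \<bar>g n A - d * Y (card A) ^ k\<bar> \<le> e' n (card A))"
    unfolding size_approx_def by blast
  let ?e = "\<lambda>n x. e n x * e' n x + e n x * (\<bar>d\<bar> * Y x ^ k) + (\<bar>c\<bar> * Y x ^ j) * e' n x"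
  show ?thesis
  proof (rule size_approxI[where e = ?e and C = "C * C' + C * \<bar>d\<bar> + \<bar>c\<bar> * C'"])
    show "(\<lambda>n. ?e n x) \<longlonglongrightarrow> 0" for x
      by (auto intro!: tendsto_eq_intros e e')
    show "\<forall>\<^sub>F n in sequentially.
      (\<forall>x\<in>set_pmf (P n). 0 \<le> ?e n x \<and> ?e n x \<le> (C * C' + C * \<bar>d\<bar> + \<bar>c\<bar> * C') * Y x ^ (j + k)) \<and>
      (\<forall>A\<in>set_pmf (\<rho> n). \<bar>f n A * g n A - (c * d) * Y (card A) ^ (j + k)\<bar> \<le> ?e n (card A))"
      using be be' eventually_law
    proof eventually_elim
      case (elim n)
      interpret L: subset_law s "m n" "P n" by fact
      have ey: "0 \<le> e n x" "e n x \<le> C * Y x ^ j" "0 \<le> e' n x" "e' n x \<le> C' * Y x ^ k"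
        if "x \<in> set_pmf (P n)" for x
        using elim that by auto
      show ?case
      proof (intro conjI ballI)
        fix x assume x: "x \<in> set_pmf (P n)"
        show "0 \<le> ?e n x" using ey[OF x] Y_nonneg by simp
        have "?e n x \<le> (C * Y x ^ j) * (C' * Y x ^ k) + (C * Y x ^ j) * (\<bar>d\<bar> * Y x ^ k)
            + (\<bar>c\<bar> * Y x ^ j) * (C' * Y x ^ k)"
          using ey[OF x] Y_nonneg
          by (intro add_mono mult_mono mult_left_mono mult_right_mono) auto
        also have "\<dots> = (C * C' + C * \<bar>d\<bar> + \<bar>c\<bar> * C') * Y x ^ (j + k)"
          by (simp add: power_add algebra_simps)
        finally show "?e n x \<le> (C * C' + C * \<bar>d\<bar> + \<bar>c\<bar> * C') * Y x ^ (j + k)" .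
      next
        fix A assume A: "A \<in> set_pmf (\<rho> n)"
        let ?x = "card A"
        define u where "u = f n A - c * Y ?x ^ j"
        define v where "v = g n A - d * Y ?x ^ k"
        have u: "\<bar>u\<bar> \<le> e n ?x" and v: "\<bar>v\<bar> \<le> e' n ?x" using elim A by (auto simp: u_def v_def)
        have "f n A * g n A - (c * d) * Y ?x ^ (j + k) = u * v + u * (d * Y ?x ^ k) + (c * Y ?x ^ j) * v"
          by (simp add: u_def v_def power_add algebra_simps)
        also have "\<bar>\<dots>\<bar> \<le> \<bar>u * v\<bar> + \<bar>u * (d * Y ?x ^ k)\<bar> + \<bar>(c * Y ?x ^ j) * v\<bar>" by linarith
        also have "\<dots> = \<bar>u\<bar> * \<bar>v\<bar> + \<bar>u\<bar> * (\<bar>d\<bar> * Y ?x ^ k) + (\<bar>c\<bar> * Y ?x ^ j) * \<bar>v\<bar>"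
          using Y_nonneg[of ?x] by (simp add: abs_mult)
        also have "\<dots> \<le> ?e n ?x"
          using u v Y_nonneg[of ?x] ey[of ?x] L.set_rho[OF A]
          by (intro add_mono mult_mono mult_left_mono mult_right_mono) auto
        finally show "\<bar>f n A * g n A - (c * d) * Y ?x ^ (j + k)\<bar> \<le> ?e n ?x" .
      qed
    qed
  qed
qed

lemma size_approx_one: "size_approx 0 (\<lambda>n A. 1) (\<lambda>x. 1 * Y x ^ 0)"
  by (rule size_approxI[where e = "\<lambda>_ _. 0" and C = 0]) auto

lemma excess_le:
  assumes "subset_law s (m n) (P n)" "x \<in> set_pmf (P n)"
  shows "Y x * subset_law.excess s (m n) x \<le> Y x"
proof -
  interpret L: subset_law s "m n" "P n" by fact
  have "x \<le> m n" using L.P_le assms(2) by auto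
  then have "L.excess x \<le> 1" using L.s_less by (simp add: L.excess_def divide_le_eq)
  then show ?thesis using mult_left_mono[of "L.excess x" 1 "Y x"] Y_nonneg by simp
qed

lemma m_minus_s_top: "filterlim (\<lambda>n. real (m n) - real s) at_top sequentially"
proof -
  have "filterlim (\<lambda>n. - real s + real (m n)) at_top sequentially"
    by (rule filterlim_tendsto_add_at_top[OF tendsto_const])
      (rule filterlim_compose[OF filterlim_real_sequentially m_top])
  then show ?thesis by simp
qed

lemma excess_tendsto: "(\<lambda>n. subset_law.excess s (m n) x) \<longlonglongrightarrow> 0"
proof -
  have "(\<lambda>n. (real x - real s) / (real (m n) - real s)) \<longlonglongrightarrow> 0"
    by (rule real_tendsto_divide_at_top[OF tendsto_const m_minus_s_top])
  then show ?thesis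
    by (rule Lim_transform_eventually)
      (use eventually_law in eventually_elim, simp add: subset_law.excess_def)
qed

text \<open>
  Attaching one more edge to a tree. If the branches at \<open>B\<close> contribute about \<open>c * Y (card B) ^ j\<close>, then the
  edge from \<open>A\<close> to \<open>B\<close> and everything behind it contributes about \<open>c * \<alpha> * Y (card A)\<close> with \<open>\<alpha>\<close> the limiting
  moment of order \<open>j + 1\<close>: one factor \<open>Y\<close> for the choice of the common elements goes to either end.
\<close>

lemma size_approx_kernel:
  assumes f: "size_approx j f (\<lambda>x. c * Y x ^ j)" and "c \<ge> 0"
    and tail: "uniform_tail (Suc j)" and moment: "moment_limit (Suc j) \<alpha>"
  shows "size_approx 1 (\<lambda>n A. N n * mean (\<rho> n) (\<lambda>B. meets s A B * f n B)) (\<lambda>x. (c * \<alpha>) * Y x ^ 1)"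
proof -
  from f obtain e C where e: "\<And>x. (\<lambda>n. e n x) \<longlonglongrightarrow> 0"
    and be: "\<forall>\<^sub>F n in sequentially. (\<forall>x\<in>set_pmf (P n). 0 \<le> e n x \<and> e n x \<le> C * Y x ^ j) \<and>
      (\<forall>A\<in>set_pmf (\<rho> n). \<bar>f n A - c * Y (card A) ^ j\<bar> \<le> e n (card A))"
    unfolding size_approx_def by blast
  define \<phi> where "\<phi> x = c * Y x ^ j" for x
  define G where "G n = mean (P n) (\<lambda>x. \<phi> x * Y x)" for n
  define R where "R n = mean (P n) (\<lambda>x. \<phi> x * (Y x * subset_law.excess s (m n) x))" for n
  define \<eta> where "\<eta> n = mean (P n) (\<lambda>x. e n x * Y x)" for n
  have \<phi>_nn: "0 \<le> \<phi> x" for x using \<open>c \<ge> 0\<close> Y_nonneg by (simp add: \<phi>_def)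
  have "\<alpha> \<ge> 0"
    using moment unfolding moment_limit_def
    by (rule tendsto_lowerbound) (auto intro!: always_eventually mean_nonneg Y_nonneg mult_nonneg_nonneg zero_le_power)
  have G: "G \<longlonglongrightarrow> c * \<alpha>"
    using tendsto_mult_left[OF moment[unfolded moment_limit_def], of c]
    by (simp add: G_def[abs_def] \<phi>_def mult_ac)
  have R: "R \<longlonglongrightarrow> 0"
    unfolding R_def
  proof (rule mean_vanishes[OF tail, where C = c])
    show "\<forall>\<^sub>F n in sequentially. \<forall>x\<in>set_pmf (P n).
        \<bar>\<phi> x * (Y x * subset_law.excess s (m n) x)\<bar> \<le> c * Y x ^ Suc j"
      using eventually_law
    proof eventually_elim
      case (elim n)
      interpret L: subset_law s "m n" "P n" by fact
      show ?case
      proof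
        fix x assume x: "x \<in> set_pmf (P n)"
        have "\<bar>\<phi> x * (Y x * L.excess x)\<bar> = \<phi> x * (Y x * L.excess x)"
          using \<phi>_nn L.Y_excess_nonneg[OF x] by simp
        also have "\<dots> \<le> \<phi> x * Y x"
          using excess_le[OF elim x] \<phi>_nn by (intro mult_left_mono)
        finally show "\<bar>\<phi> x * (Y x * L.excess x)\<bar> \<le> c * Y x ^ Suc j"
          by (simp add: \<phi>_def mult_ac)
      qed
    qed
    show "(\<lambda>n. \<phi> x * (Y x * subset_law.excess s (m n) x)) \<longlonglongrightarrow> 0" for x
      by (auto intro!: tendsto_eq_intros excess_tendsto)
  qed
  \<comment> \<open>\<open>\<eta>\<close> accounts for replacing \<open>f n\<close> by \<open>\<phi>\<close>\<close>
  have \<eta>: "\<eta> \<longlonglongrightarrow> 0"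
    unfolding \<eta>_def
  proof (rule mean_vanishes[OF tail, where C = C])
    show "\<forall>\<^sub>F n in sequentially. \<forall>x\<in>set_pmf (P n). \<bar>e n x * Y x\<bar> \<le> C * Y x ^ Suc j"
      using be
    proof eventually_elim
      case (elim n)
      show ?case
      proof
        fix x assume x: "x \<in> set_pmf (P n)"
        have "0 \<le> e n x" "e n x \<le> C * Y x ^ j" using elim x by auto
        then show "\<bar>e n x * Y x\<bar> \<le> C * Y x ^ Suc j"
          using mult_right_mono[of "e n x" "C * Y x ^ j" "Y x"] Y_nonneg[of x] by (simp add: mult_ac)
      qed
    qed
    show "(\<lambda>n. e n x * Y x) \<longlonglongrightarrow> 0" for x
      by (auto intro!: tendsto_eq_intros e)
  qed
  \<comment> \<open>\<open>gap\<close> is the distance between the upper and the lower bound for the kernel applied to \<open>\<phi>\<close>\<close>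
  define gap where "gap n x = \<bar>G n - max 0 (G n - (real x - real s) * R n)\<bar>" for n x
  let ?e = "\<lambda>n x. Y x * (\<bar>G n - c * \<alpha>\<bar> + gap n x + \<eta> n)"
  have "\<forall>\<^sub>F n in sequentially. \<bar>G n - c * \<alpha>\<bar> < 1"
    using G by (auto dest!: tendstoD[where e = 1] simp: dist_real_def)
  moreover have "\<forall>\<^sub>F n in sequentially. \<eta> n < 1" using \<eta> by (rule order_tendstoD) simp
  ultimately have ev: "\<forall>\<^sub>F n in sequentially. \<bar>G n - c * \<alpha>\<bar> < 1 \<and> \<eta> n < 1"
    by (rule eventually_conj)
  show ?thesis
  proof (rule size_approxI[where e = ?e and C = "c * \<alpha> + 3"])
    fix x
    have "(\<lambda>n. gap n x) \<longlonglongrightarrow> \<bar>c * \<alpha> - max 0 (c * \<alpha> - (real x - real s) * 0)\<bar>"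
      unfolding gap_def by (intro tendsto_intros G R)
    then have "(\<lambda>n. gap n x) \<longlonglongrightarrow> 0" using \<open>c \<ge> 0\<close> \<open>\<alpha> \<ge> 0\<close> by simp
    moreover have "(\<lambda>n. \<bar>G n - c * \<alpha>\<bar>) \<longlonglongrightarrow> 0"
      using tendsto_rabs_zero[OF LIM_zero[OF G]] by simp
    ultimately have "(\<lambda>n. \<bar>G n - c * \<alpha>\<bar> + gap n x + \<eta> n) \<longlonglongrightarrow> 0 + 0 + 0"
      by (intro tendsto_add \<eta>)
    from tendsto_mult_left[OF this, of "Y x"] show "(\<lambda>n. ?e n x) \<longlonglongrightarrow> 0" by simp
  next
    show "\<forall>\<^sub>F n in sequentially. (\<forall>x\<in>set_pmf (P n). 0 \<le> ?e n x \<and> ?e n x \<le> (c * \<alpha> + 3) * Y x ^ 1) \<and>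
      (\<forall>A\<in>set_pmf (\<rho> n). \<bar>N n * mean (\<rho> n) (\<lambda>B. meets s A B * f n B) - (c * \<alpha>) * Y (card A) ^ 1\<bar>
        \<le> ?e n (card A))"
      using be eventually_law ev
    proof eventually_elim
      case (elim n)
      interpret L: subset_law s "m n" "P n" by fact
      have \<eta>_nn: "0 \<le> \<eta> n" unfolding \<eta>_def using elim(1) Y_nonneg by (intro mean_nonneg) auto
      have R_nn: "0 \<le> R n" unfolding R_def using \<phi>_nn L.Y_excess_nonneg by (intro mean_nonneg) auto
      have G_nn: "0 \<le> G n" unfolding G_def using \<phi>_nn Y_nonneg by (intro mean_nonneg) auto
      show ?case
      proof (intro conjI ballI)
        fix x assume x: "x \<in> set_pmf (P n)"
        show "0 \<le> ?e n x" using Y_nonneg[of x] \<eta>_nn by (simp add: gap_def)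
        show "?e n x \<le> (c * \<alpha> + 3) * Y x ^ 1"
        proof (cases "s \<le> x")
          case True
          have "0 \<le> (real x - real s) * R n" using True R_nn by simp
          then have "gap n x \<le> G n" using G_nn by (simp add: gap_def)
          then have "\<bar>G n - c * \<alpha>\<bar> + gap n x + \<eta> n \<le> c * \<alpha> + 3" using elim(3) by linarith
          from mult_left_mono[OF this Y_nonneg[of x]] show ?thesis by (simp add: mult.commute[of "Y x"])
        next
          case False then show ?thesis by (simp add: Y_eq not_le binomial_eq_0)
        qed
      next
        fix A assume "A \<in> set_pmf (\<rho> n)"
        then have A: "A \<subseteq> {1..m n}" using L.set_rho by blast
        let ?T = "\<lambda>h. N n * mean (\<rho> n) (\<lambda>B. meets s A B * h B)"
        have upper: "?T (\<lambda>B. \<phi> (card B)) \<le> Y (card A) * G n"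
          unfolding G_def by (rule L.mean_meets_upper[OF A]) (rule \<phi>_nn)
        have lower: "Y (card A) * max 0 (G n - (real (card A) - real s) * R n) \<le> ?T (\<lambda>B. \<phi> (card B))"
          unfolding G_def R_def by (rule L.mean_meets_lower[OF A]) (rule \<phi>_nn)
        have "?T (f n) - ?T (\<lambda>B. \<phi> (card B)) = N n * mean (\<rho> n) (\<lambda>B. meets s A B * (f n B - \<phi> (card B)))"
          by (simp add: right_diff_distrib mean_diff[OF L.finite_rho])
        also have "\<bar>\<dots>\<bar> = N n * \<bar>mean (\<rho> n) (\<lambda>B. meets s A B * (f n B - \<phi> (card B)))\<bar>"
          using L.N_pos by (simp add: abs_mult)
        also have "\<dots> \<le> N n * mean (\<rho> n) (\<lambda>B. meets s A B * e n (card B))"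
        proof (intro mult_left_mono abs_mean_le[OF L.finite_rho])
          fix B assume "B \<in> set_pmf (\<rho> n)"
          then have "\<bar>f n B - \<phi> (card B)\<bar> \<le> e n (card B)" using elim(1) by (auto simp: \<phi>_def)
          then show "\<bar>meets s A B * (f n B - \<phi> (card B))\<bar> \<le> meets s A B * e n (card B)"
            using meets_01(1)[of s A B] by (simp add: abs_mult mult_left_mono)
        qed (use L.N_pos in simp)
        also have "\<dots> \<le> Y (card A) * \<eta> n"
          unfolding \<eta>_def by (rule L.mean_meets_upper[OF A]) (use elim(1) in auto)
        finally have diff: "\<bar>?T (f n) - ?T (\<lambda>B. \<phi> (card B))\<bar> \<le> Y (card A) * \<eta> n" .
        have "Y (card A) * (G n - gap n (card A)) \<le> ?T (\<lambda>B. \<phi> (card B))"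
          by (rule order_trans[OF _ lower]) (auto intro!: mult_left_mono Y_nonneg simp: gap_def)
        with upper diff have "?T (f n) \<le> Y (card A) * (G n + \<eta> n)"
          "Y (card A) * (G n - gap n (card A) - \<eta> n) \<le> ?T (f n)"
          by (simp_all add: algebra_simps)
        moreover have "Y (card A) * (G n + \<eta> n) \<le> Y (card A) * (c * \<alpha> + (\<bar>G n - c * \<alpha>\<bar> + gap n (card A) + \<eta> n))"
          by (intro mult_left_mono Y_nonneg) (simp add: gap_def)
        moreover have "Y (card A) * (c * \<alpha> - (\<bar>G n - c * \<alpha>\<bar> + gap n (card A) + \<eta> n)) \<le>
            Y (card A) * (G n - gap n (card A) - \<eta> n)"
          by (intro mult_left_mono Y_nonneg) simp
        ultimately show "\<bar>?T (f n) - (c * \<alpha>) * Y (card A) ^ 1\<bar> \<le> ?e n (card A)"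
          unfolding abs_le_iff by (simp add: algebra_simps)
      qed
    qed
  qed
qed

end

section \<open>Limits of the subgraph probabilities\<close>

context size_sequence
begin

text \<open>
  Since \<open>x - s\<close> is at most \<open>Y x\<close>, a bounded second moment of \<open>Y\<close> gives the rate \<open>1 / m\<close>, which the
  triangle estimate needs.
\<close>

lemma mean_excess_le:
  assumes "subset_law s (m n) (P n)"
  shows "mean (P n) (\<lambda>x. Y x * subset_law.excess s (m n) x) \<le>
    mean (P n) (\<lambda>x. Y x ^ 2) / (real (m n) - real s)"
proof -
  interpret L: subset_law s "m n" "P n" by fact
  have pos: "0 < real (m n) - real s" using L.s_less by simp
  have "mean (P n) (\<lambda>x. Y x * L.excess x) \<le> mean (P n) (\<lambda>x. Y x ^ 2 / (real (m n) - real s))"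
  proof (rule mean_mono[OF L.finite_P])
    fix x
    have "Y x * (real x - real s) \<le> Y x ^ 2"
    proof (cases "s \<le> x")
      case True
      then show ?thesis using mult_left_mono[of "real x - real s" "Y x" "Y x"] Y_ge[of x] Y_nonneg[of x]
        by (simp add: power2_eq_square)
    qed (simp add: Y_eq not_le binomial_eq_0)
    then show "Y x * L.excess x \<le> Y x ^ 2 / (real (m n) - real s)"
      using pos by (simp add: L.excess_def divide_right_mono)
  qed
  then show ?thesis by simp
qed

text \<open>
  Two independent neighbours of \<open>A\<close> close a triangle essentially only if they share the same \<open>s\<close>-subset
  of \<open>A\<close>. Hence the limit has one factor \<open>Y\<close>, although the error is controlled only by \<open>Y\<^sup>2\<close>.
\<close>

lemma size_approx_triangle:
  assumes m1: "moment_limit 1 \<alpha>\<^sub>1" and m2: "moment_limit 2 \<alpha>\<^sub>2"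
  shows "size_approx 2
    (\<lambda>n A. (N n)\<^sup>2 * mean (\<rho> n) (\<lambda>B. mean (\<rho> n) (\<lambda>C. meets s A B * meets s A C * meets s B C)))
    (\<lambda>x. \<alpha>\<^sub>1\<^sup>2 * Y x ^ 1)"
proof -
  define a where "a n = mean (P n) Y" for n
  define q where "q n = mean (P n) (\<lambda>x. Y x ^ 2)" for n
  define \<eta> where "\<eta> n = mean (P n) (\<lambda>x. Y x * subset_law.excess s (m n) x)" for n
  have a: "a \<longlonglongrightarrow> \<alpha>\<^sub>1" using m1 by (simp add: moment_limit_def a_def[abs_def])
  have q: "q \<longlonglongrightarrow> \<alpha>\<^sub>2" using m2 by (simp add: moment_limit_def q_def[abs_def])
  have a_nn: "0 \<le> a n" for n unfolding a_def by (rule mean_nonneg) (rule Y_nonneg)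
  have \<alpha>1_nn: "0 \<le> \<alpha>\<^sub>1" using a by (rule LIMSEQ_le_const) (use a_nn in auto)
  have \<eta>_nn: "\<forall>\<^sub>F n in sequentially. 0 \<le> \<eta> n"
    using eventually_law unfolding \<eta>_def
    by eventually_elim (rule mean_nonneg, rule subset_law.Y_excess_nonneg)
  have \<eta>_le: "\<forall>\<^sub>F n in sequentially. \<eta> n \<le> q n / (real (m n) - real s)"
    using eventually_law unfolding \<eta>_def q_def by eventually_elim (rule mean_excess_le)
  have \<eta>: "\<eta> \<longlonglongrightarrow> 0"
    by (rule tendsto_sandwich[OF \<eta>_nn \<eta>_le tendsto_const])
      (rule real_tendsto_divide_at_top[OF q m_minus_s_top])
  \<comment> \<open>the union over the elements outside \<open>A\<close> is affordable, as \<open>\<eta>\<close> is of order \<open>1 / m\<close>\<close>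
  have m\<eta>2: "(\<lambda>n. real (m n) * (\<eta> n)\<^sup>2) \<longlonglongrightarrow> 0"
  proof (rule tendsto_sandwich[OF _ _ tendsto_const])
    show "\<forall>\<^sub>F n in sequentially. 0 \<le> real (m n) * (\<eta> n)\<^sup>2" by simp
    have "\<forall>\<^sub>F n in sequentially. real s + 1 \<le> real (m n) - real s"
      using m_minus_s_top unfolding filterlim_at_top by blast
    with \<eta>_nn \<eta>_le
    show "\<forall>\<^sub>F n in sequentially. real (m n) * (\<eta> n)\<^sup>2 \<le> (2 * (q n)\<^sup>2) / (real (m n) - real s)"
    proof eventually_elim
      case (elim n)
      define d where "d = real (m n) - real s"
      have d: "d > 0" "real (m n) \<le> 2 * d" using elim by (auto simp: d_def)
      have "real (m n) * (\<eta> n)\<^sup>2 \<le> (2 * d) * (q n / d)\<^sup>2"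
        using elim d by (intro mult_mono power_mono) (auto simp: d_def)
      also have "\<dots> = 2 * (q n)\<^sup>2 / d" using d by (simp add: power2_eq_square field_simps)
      finally show ?case by (simp add: d_def)
    qed
    show "(\<lambda>n. (2 * (q n)\<^sup>2) / (real (m n) - real s)) \<longlonglongrightarrow> 0"
      by (rule real_tendsto_divide_at_top[OF tendsto_mult_left[OF tendsto_power[OF q]] m_minus_s_top])
  qed
  define gap where "gap n x = \<bar>(a n)\<^sup>2 - (max 0 (a n - (real x - real s) * \<eta> n))\<^sup>2\<bar>" for n x
  let ?e = "\<lambda>n x. Y x * (\<bar>(a n)\<^sup>2 - \<alpha>\<^sub>1\<^sup>2\<bar> + gap n x) + (Y x)\<^sup>2 * (real (m n) * (\<eta> n)\<^sup>2)"
  have a2: "(\<lambda>n. \<bar>(a n)\<^sup>2 - \<alpha>\<^sub>1\<^sup>2\<bar>) \<longlonglongrightarrow> 0"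
    using tendsto_power[OF a, of 2] by (simp add: tendsto_rabs_zero_iff LIM_zero)
  have "\<forall>\<^sub>F n in sequentially. \<bar>(a n)\<^sup>2 - \<alpha>\<^sub>1\<^sup>2\<bar> < 1" using a2 by (rule order_tendstoD) simp
  moreover have "\<forall>\<^sub>F n in sequentially. real (m n) * (\<eta> n)\<^sup>2 < 1" using m\<eta>2 by (rule order_tendstoD) simp
  ultimately have ev: "\<forall>\<^sub>F n in sequentially. \<bar>(a n)\<^sup>2 - \<alpha>\<^sub>1\<^sup>2\<bar> < 1 \<and> real (m n) * (\<eta> n)\<^sup>2 < 1"
    by (rule eventually_conj)
  show ?thesis
  proof (rule size_approxI[where e = ?e and C = "\<alpha>\<^sub>1\<^sup>2 + 3"])
    fix x
    have "(\<lambda>n. gap n x) \<longlonglongrightarrow> \<bar>\<alpha>\<^sub>1\<^sup>2 - (max 0 (\<alpha>\<^sub>1 - (real x - real s) * 0))\<^sup>2\<bar>"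
      unfolding gap_def by (intro tendsto_intros a \<eta>)
    then have "(\<lambda>n. gap n x) \<longlonglongrightarrow> 0" using \<alpha>1_nn by simp
    then have "(\<lambda>n. ?e n x) \<longlonglongrightarrow> Y x * (0 + 0) + (Y x)\<^sup>2 * 0"
      by (intro tendsto_add tendsto_mult_left a2 m\<eta>2)
    then show "(\<lambda>n. ?e n x) \<longlonglongrightarrow> 0" by simp
  next
    show "\<forall>\<^sub>F n in sequentially. (\<forall>x\<in>set_pmf (P n). 0 \<le> ?e n x \<and> ?e n x \<le> (\<alpha>\<^sub>1\<^sup>2 + 3) * Y x ^ 2) \<and>
      (\<forall>A\<in>set_pmf (\<rho> n). \<bar>(N n)\<^sup>2 * mean (\<rho> n) (\<lambda>B. mean (\<rho> n) (\<lambda>C. meets s A B * meets s A C * meets s B C))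
        - \<alpha>\<^sub>1\<^sup>2 * Y (card A) ^ 1\<bar> \<le> ?e n (card A))"
      using eventually_law ev \<eta>_nn
    proof eventually_elim
      case (elim n)
      interpret L: subset_law s "m n" "P n" by fact
      show ?case
      proof (intro conjI ballI)
        fix x
        show "0 \<le> ?e n x" using Y_nonneg[of x] by (simp add: gap_def)
        show "?e n x \<le> (\<alpha>\<^sub>1\<^sup>2 + 3) * Y x ^ 2"
        proof (cases "s \<le> x")
          case True
          have "0 \<le> (real x - real s) * \<eta> n" using True elim by simp
          then have "(max 0 (a n - (real x - real s) * \<eta> n))\<^sup>2 \<le> (a n)\<^sup>2"
            using a_nn[of n] by (intro power_mono) auto
          then have "gap n x \<le> (a n)\<^sup>2" by (simp add: gap_def)
          then have "\<bar>(a n)\<^sup>2 - \<alpha>\<^sub>1\<^sup>2\<bar> + gap n x \<le> \<alpha>\<^sub>1\<^sup>2 + 2" using elim(2) by linarith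
          then have "Y x * (\<bar>(a n)\<^sup>2 - \<alpha>\<^sub>1\<^sup>2\<bar> + gap n x) \<le> (Y x)\<^sup>2 * (\<alpha>\<^sub>1\<^sup>2 + 2)"
            by (intro mult_mono Y_le_square) (auto simp: gap_def)
          moreover have "(Y x)\<^sup>2 * (real (m n) * (\<eta> n)\<^sup>2) \<le> (Y x)\<^sup>2 * 1"
            using elim(2) by (intro mult_left_mono) auto
          ultimately have "?e n x \<le> (Y x)\<^sup>2 * (\<alpha>\<^sub>1\<^sup>2 + 2) + (Y x)\<^sup>2 * 1" by linarith
          then show ?thesis by (simp add: algebra_simps)
        qed (simp add: Y_eq not_le binomial_eq_0)
      next
        fix A assume "A \<in> set_pmf (\<rho> n)"
        then have A: "A \<subseteq> {1..m n}" using L.set_rho by blast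
        let ?T = "(N n)\<^sup>2 * mean (\<rho> n) (\<lambda>B. mean (\<rho> n) (\<lambda>C. meets s A B * meets s A C * meets s B C))"
        have upper: "?T \<le> Y (card A) * (a n)\<^sup>2 + (Y (card A))\<^sup>2 * (real (m n) * (\<eta> n)\<^sup>2)"
          unfolding a_def \<eta>_def by (rule L.mean_triangle_upper[OF A])
        have "Y (card A) * ((a n)\<^sup>2 - gap n (card A)) \<le>
            Y (card A) * (max 0 (a n - (real (card A) - real s) * \<eta> n))\<^sup>2"
          by (intro mult_left_mono Y_nonneg) (simp add: gap_def)
        also have "\<dots> \<le> ?T"
          unfolding a_def \<eta>_def by (rule L.mean_triangle_lower[OF A])
        finally have lower: "Y (card A) * ((a n)\<^sup>2 - gap n (card A)) \<le> ?T" .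
        have "Y (card A) * (a n)\<^sup>2 \<le> Y (card A) * (\<alpha>\<^sub>1\<^sup>2 + (\<bar>(a n)\<^sup>2 - \<alpha>\<^sub>1\<^sup>2\<bar> + gap n (card A)))"
          by (intro mult_left_mono Y_nonneg) (simp add: gap_def)
        moreover have "Y (card A) * (\<alpha>\<^sub>1\<^sup>2 - (\<bar>(a n)\<^sup>2 - \<alpha>\<^sub>1\<^sup>2\<bar> + gap n (card A))) \<le>
            Y (card A) * ((a n)\<^sup>2 - gap n (card A))"
          by (intro mult_left_mono Y_nonneg) simp
        moreover have "0 \<le> (Y (card A))\<^sup>2 * (real (m n) * (\<eta> n)\<^sup>2)" by simp
        ultimately show "\<bar>?T - \<alpha>\<^sub>1\<^sup>2 * Y (card A) ^ 1\<bar> \<le> ?e n (card A)"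
          using upper lower unfolding abs_le_iff distrib_left right_diff_distrib power_one_right mult.commute[of "\<alpha>\<^sub>1\<^sup>2"]
          by (intro conjI; linarith)
      qed
    qed
  qed
qed

text \<open>
  The rescaled conditional edge probability \<open>N * H A\<close>. All limits below are expectations of
  polynomials in it and in its image under the adjacency kernel.
\<close>

definition neighbourhood :: "nat \<Rightarrow> nat set \<Rightarrow> real" where
  "neighbourhood n A = N n * mean (\<rho> n) (meets s A)"

lemma neighbourhood_eq:
  assumes "subset_law s (m n) (P n)"
  shows "neighbourhood n A = N n * subset_law.H s (m n) (P n) A"
  by (simp add: neighbourhood_def subset_law.H_def[OF assms])

lemma neighbourhood_nonneg:
  assumes "subset_law s (m n) (P n)"
  shows "0 \<le> neighbourhood n A"
  using subset_law.N_pos[OF assms] meets_01(1) by (auto simp: neighbourhood_def intro!: mult_nonneg_nonneg mean_nonneg)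

lemma neighbourhood_approx:
  assumes "uniform_tail 1" and "moment_limit 1 \<alpha>\<^sub>1"
  shows "size_approx 1 neighbourhood (\<lambda>x. \<alpha>\<^sub>1 * Y x ^ 1)"
  using size_approx_kernel[OF size_approx_one _ assms[unfolded One_nat_def]]
  by (simp add: neighbourhood_def[abs_def])

lemma edge_prob_limit:
  assumes "uniform_tail 1" and "moment_limit 1 \<alpha>\<^sub>1"
  shows "(\<lambda>n. N n * subset_law.edge_prob s (m n) (P n)) \<longlonglongrightarrow> \<alpha>\<^sub>1\<^sup>2"
proof -
  have "(\<lambda>n. mean (\<rho> n) (neighbourhood n)) \<longlonglongrightarrow> \<alpha>\<^sub>1 * \<alpha>\<^sub>1"
    by (rule mean_size_approx[OF neighbourhood_approx]) (use assms in auto)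
  then have "(\<lambda>n. mean (\<rho> n) (\<lambda>A. neighbourhood n A)) \<longlonglongrightarrow> \<alpha>\<^sub>1\<^sup>2" by (simp add: power2_eq_square)
  then show ?thesis
    by (rule Lim_transform_eventually)
      (use eventually_law in eventually_elim, simp add: neighbourhood_eq subset_law.edge_prob_def cong: mean_cong)
qed

lemma neighbourhood_square_approx:
  assumes "uniform_tail 1" and "moment_limit 1 \<alpha>\<^sub>1"
  shows "size_approx 2 (\<lambda>n A. neighbourhood n A * neighbourhood n A) (\<lambda>x. (\<alpha>\<^sub>1 * \<alpha>\<^sub>1) * Y x ^ 2)"
  using size_approx_mult[OF neighbourhood_approx[OF assms] neighbourhood_approx[OF assms]]
  unfolding one_add_one .

lemma star2_prob_limit:
  assumes "uniform_tail 1" "moment_limit 1 \<alpha>\<^sub>1" "uniform_tail 2" "moment_limit 2 \<alpha>\<^sub>2"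
  shows "(\<lambda>n. (N n)\<^sup>2 * subset_law.star2_prob s (m n) (P n)) \<longlonglongrightarrow> \<alpha>\<^sub>1\<^sup>2 * \<alpha>\<^sub>2"
proof -
  have "(\<lambda>n. mean (\<rho> n) (\<lambda>A. neighbourhood n A * neighbourhood n A)) \<longlonglongrightarrow> \<alpha>\<^sub>1 * \<alpha>\<^sub>1 * \<alpha>\<^sub>2"
    by (rule mean_size_approx[OF neighbourhood_square_approx]) (use assms in auto)
  then have "(\<lambda>n. mean (\<rho> n) (\<lambda>A. neighbourhood n A * neighbourhood n A)) \<longlonglongrightarrow> \<alpha>\<^sub>1\<^sup>2 * \<alpha>\<^sub>2"
    by (simp add: power2_eq_square)
  then show ?thesis
    by (rule Lim_transform_eventually)
      (use eventually_law in eventually_elim,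
        simp add: neighbourhood_def subset_law.star2_prob_def subset_law.H_def power2_eq_square mult_ac)
qed

lemma neighbourhood_cube_eq:
  assumes "subset_law s (m n) (P n)"
  shows "(N n) ^ 3 * subset_law.star3_prob s (m n) (P n) = mean (\<rho> n) (\<lambda>A. neighbourhood n A ^ 3)"
  by (simp add: neighbourhood_def subset_law.star3_prob_def[OF assms] subset_law.H_def[OF assms]
      power_mult_distrib)

lemma star3_prob_limit:
  assumes "uniform_tail 1" "moment_limit 1 \<alpha>\<^sub>1" "uniform_tail 3" "moment_limit 3 \<alpha>\<^sub>3"
  shows "(\<lambda>n. (N n) ^ 3 * subset_law.star3_prob s (m n) (P n)) \<longlonglongrightarrow> \<alpha>\<^sub>1 ^ 3 * \<alpha>\<^sub>3"
proof -
  have "size_approx (2 + 1) (\<lambda>n A. neighbourhood n A * neighbourhood n A * neighbourhood n A)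
      (\<lambda>x. (\<alpha>\<^sub>1 * \<alpha>\<^sub>1 * \<alpha>\<^sub>1) * Y x ^ (2 + 1))"
    by (rule size_approx_mult[OF neighbourhood_square_approx[OF assms(1,2)] neighbourhood_approx[OF assms(1,2)]])
  then have "size_approx 3 (\<lambda>n A. neighbourhood n A ^ 3) (\<lambda>x. \<alpha>\<^sub>1 ^ 3 * Y x ^ 3)"
    by (simp add: power3_eq_cube[symmetric])
  then have "(\<lambda>n. mean (\<rho> n) (\<lambda>A. neighbourhood n A ^ 3)) \<longlonglongrightarrow> \<alpha>\<^sub>1 ^ 3 * \<alpha>\<^sub>3"
    by (rule mean_size_approx) (use assms in auto)
  then show ?thesis
    by (rule Lim_transform_eventually)
      (use eventually_law in eventually_elim, simp add: neighbourhood_cube_eq)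
qed

text \<open>
  The path is cut at its middle edge: one inner vertex carries a leaf, and the other one, with its
  leaf, is reached through the kernel.
\<close>

lemma path4_prob_limit:
  assumes "uniform_tail 1" "moment_limit 1 \<alpha>\<^sub>1" "uniform_tail 2" "moment_limit 2 \<alpha>\<^sub>2" and "\<alpha>\<^sub>1 \<ge> 0"
  shows "(\<lambda>n. (N n) ^ 3 * subset_law.path4_prob s (m n) (P n)) \<longlonglongrightarrow> \<alpha>\<^sub>1\<^sup>2 * \<alpha>\<^sub>2\<^sup>2"
proof -
  let ?T = "\<lambda>n A. N n * mean (\<rho> n) (\<lambda>B. meets s A B * neighbourhood n B)"
  have "size_approx 1 ?T (\<lambda>x. (\<alpha>\<^sub>1 * \<alpha>\<^sub>2) * Y x ^ 1)"
    by (rule size_approx_kernel[OF neighbourhood_approx[OF assms(1,2)]])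
      (use assms in \<open>simp_all add: numeral_2_eq_2\<close>)
  from size_approx_mult[OF neighbourhood_approx[OF assms(1,2)] this]
  have "size_approx 2 (\<lambda>n A. neighbourhood n A * ?T n A) (\<lambda>x. (\<alpha>\<^sub>1 * (\<alpha>\<^sub>1 * \<alpha>\<^sub>2)) * Y x ^ 2)"
    unfolding one_add_one .
  then have "(\<lambda>n. mean (\<rho> n) (\<lambda>A. neighbourhood n A * ?T n A)) \<longlonglongrightarrow> \<alpha>\<^sub>1 * (\<alpha>\<^sub>1 * \<alpha>\<^sub>2) * \<alpha>\<^sub>2"
    by (rule mean_size_approx) (use assms in auto)
  then have "(\<lambda>n. mean (\<rho> n) (\<lambda>A. neighbourhood n A * ?T n A)) \<longlonglongrightarrow> \<alpha>\<^sub>1\<^sup>2 * \<alpha>\<^sub>2\<^sup>2"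
    by (simp add: power2_eq_square mult_ac)
  then show ?thesis
  proof (rule Lim_transform_eventually)
    show "\<forall>\<^sub>F n in sequentially. mean (\<rho> n) (\<lambda>A. neighbourhood n A * ?T n A) =
        (N n) ^ 3 * subset_law.path4_prob s (m n) (P n)"
      using eventually_law
    proof eventually_elim
      case (elim n)
      interpret L: subset_law s "m n" "P n" by fact
      have nb: "neighbourhood n A = N n * L.H A" for A
        by (simp add: neighbourhood_def L.H_def)
      have "neighbourhood n A * ?T n A = (N n) ^ 3 * (L.H A * mean (\<rho> n) (\<lambda>B. meets s A B * L.H B))" for A
      proof -
        have "mean (\<rho> n) (\<lambda>B. meets s A B * neighbourhood n B) =
            mean (\<rho> n) (\<lambda>B. N n * (meets s A B * L.H B))"
          by (rule mean_cong) (simp add: nb)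
        also have "\<dots> = N n * mean (\<rho> n) (\<lambda>B. meets s A B * L.H B)" by simp
        finally show ?thesis by (simp add: nb power3_eq_cube)
      qed
      then show ?case by (simp add: L.path4_prob_def)
    qed
  qed
qed

lemma triangle_prob_limit:
  assumes "uniform_tail 2" "moment_limit 1 \<alpha>\<^sub>1" "moment_limit 2 \<alpha>\<^sub>2"
  shows "(\<lambda>n. (N n)\<^sup>2 * subset_law.triangle_prob s (m n) (P n)) \<longlonglongrightarrow> \<alpha>\<^sub>1 ^ 3"
proof -
  from mean_size_approx[OF size_approx_triangle[OF assms(2,3)] assms(1,2)]
  have "(\<lambda>n. (N n)\<^sup>2 * mean (\<rho> n) (\<lambda>A. mean (\<rho> n) (\<lambda>B. mean (\<rho> n) (\<lambda>C. meets s A B * meets s A C * meets s B C))))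
      \<longlonglongrightarrow> \<alpha>\<^sub>1 ^ 3"
    by (simp add: power2_eq_square power3_eq_cube)
  then show ?thesis
    by (rule Lim_transform_eventually)
      (use eventually_law in eventually_elim, simp add: subset_law.triangle_prob_def)
qed

lemma truncated_cube_lipschitz:
  fixes u v c :: real
  assumes "0 \<le> u" "0 \<le> v" "0 \<le> c"
  shows "\<bar>(min u c) ^ 3 - (min v c) ^ 3\<bar> \<le> 3 * c\<^sup>2 * \<bar>u - v\<bar>"
proof -
  define a b where "a = min u c" and "b = min v c"
  have ab: "0 \<le> a" "a \<le> c" "0 \<le> b" "b \<le> c" "\<bar>a - b\<bar> \<le> \<bar>u - v\<bar>"
    using assms by (auto simp: a_def b_def min_def)
  have "a ^ 3 - b ^ 3 = (a * a + a * b + b * b) * (a - b)"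
    by (simp add: power3_eq_cube algebra_simps)
  then have "\<bar>a ^ 3 - b ^ 3\<bar> = (a * a + a * b + b * b) * \<bar>a - b\<bar>"
    using ab by (simp add: abs_mult)
  also have "\<dots> \<le> (c * c + c * c + c * c) * \<bar>u - v\<bar>"
    using ab by (intro mult_mono add_mono) auto
  also have "\<dots> = 3 * c\<^sup>2 * \<bar>u - v\<bar>" by (simp add: power2_eq_square algebra_simps)
  finally show ?thesis by (simp add: a_def b_def)
qed

text \<open>
  Without a third moment of \<open>Z\<close> the cube of \<open>neighbourhood\<close> is not dominated by an integrable power of
  \<open>Y\<close>. Truncation makes the cube a Lipschitz function, which inherits the approximation at order \<open>k\<close>.
\<close>

lemma size_approx_truncated_cube:
  assumes f: "size_approx k f g" and f_nn: "\<forall>\<^sub>F n in sequentially. \<forall>A. 0 \<le> f n A"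
    and g_nn: "\<And>x. 0 \<le> g x" and c: "c \<ge> 0"
  shows "size_approx k (\<lambda>n A. (min (f n A) c) ^ 3) (\<lambda>x. (min (g x) c) ^ 3)"
proof -
  from f obtain e C where e: "\<And>x. (\<lambda>n. e n x) \<longlonglongrightarrow> 0"
    and be: "\<forall>\<^sub>F n in sequentially. (\<forall>x\<in>set_pmf (P n). 0 \<le> e n x \<and> e n x \<le> C * Y x ^ k) \<and>
      (\<forall>A\<in>set_pmf (\<rho> n). \<bar>f n A - g (card A)\<bar> \<le> e n (card A))"
    unfolding size_approx_def by blast
  show ?thesis
  proof (rule size_approxI[where e = "\<lambda>n x. 3 * c\<^sup>2 * e n x" and C = "3 * c\<^sup>2 * C"])
    show "(\<lambda>n. 3 * c\<^sup>2 * e n x) \<longlonglongrightarrow> 0" for x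
      by (auto intro!: tendsto_eq_intros e)
    show "\<forall>\<^sub>F n in sequentially.
        (\<forall>x\<in>set_pmf (P n). 0 \<le> 3 * c\<^sup>2 * e n x \<and> 3 * c\<^sup>2 * e n x \<le> 3 * c\<^sup>2 * C * Y x ^ k) \<and>
        (\<forall>A\<in>set_pmf (\<rho> n). \<bar>(min (f n A) c) ^ 3 - (min (g (card A)) c) ^ 3\<bar> \<le> 3 * c\<^sup>2 * e n (card A))"
      using be f_nn
    proof eventually_elim
      case (elim n)
      show ?case
      proof (intro conjI ballI)
        fix x assume "x \<in> set_pmf (P n)"
        then have x: "0 \<le> e n x" "e n x \<le> C * Y x ^ k" using elim by auto
        show "0 \<le> 3 * c\<^sup>2 * e n x" using x by simp
        show "3 * c\<^sup>2 * e n x \<le> 3 * c\<^sup>2 * C * Y x ^ k"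
          using mult_left_mono[OF x(2), of "3 * c\<^sup>2"] by (simp add: mult_ac)
      next
        fix A assume "A \<in> set_pmf (\<rho> n)"
        then have "\<bar>f n A - g (card A)\<bar> \<le> e n (card A)" using elim by blast
        then have "3 * c\<^sup>2 * \<bar>f n A - g (card A)\<bar> \<le> 3 * c\<^sup>2 * e n (card A)"
          by (intro mult_left_mono) auto
        then show "\<bar>(min (f n A) c) ^ 3 - (min (g (card A)) c) ^ 3\<bar> \<le> 3 * c\<^sup>2 * e n (card A)"
          using truncated_cube_lipschitz[of "f n A" "g (card A)" c] elim(2) g_nn[of "card A"] c by fastforce
      qed
    qed
  qed
qed

end

text \<open>
  The regime in which \<open>m choose s\<close> grows linearly in \<open>n\<close>. Only two moments are assumed here, as this is what
  both parts of the theorem have in common.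
\<close>

locale size_sequence_critical = size_sequence +
  fixes \<beta> \<alpha>\<^sub>1 \<alpha>\<^sub>2 :: real
  assumes \<beta>_pos: "\<beta> > 0" and ratio: "(\<lambda>n. real (m n choose s) / real n) \<longlonglongrightarrow> \<beta>"
    and tail1: "uniform_tail 1" and tail2: "uniform_tail 2"
    and moment1: "moment_limit 1 \<alpha>\<^sub>1" and moment2: "moment_limit 2 \<alpha>\<^sub>2" and \<alpha>1_pos: "\<alpha>\<^sub>1 > 0"
begin

abbreviation "r n \<equiv> assortativity n (active_graph s n (m n) (P n))"

definition edge where "edge n = N n * subset_law.edge_prob s (m n) (P n)"

text \<open>
  Numerator and denominator of \<open>assortativity_eq\<close> with every probability multiplied by its natural
  power of \<open>N\<close>. The denominator is split because only the three-leaf star involves the third moment.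
\<close>

definition numerator where "numerator n =
  (real n - 2) / N n * ((N n)\<^sup>2 * subset_law.triangle_prob s (m n) (P n)) / edge n
  + (real n - 2) / N n * ((real n - 3) / N n) * ((N n) ^ 3 * subset_law.path4_prob s (m n) (P n)) / edge n
  - ((real n - 2) / N n * ((N n)\<^sup>2 * subset_law.star2_prob s (m n) (P n)) / edge n)\<^sup>2"

definition star_part where "star_part n =
  (real n - 2) / N n * ((real n - 3) / N n) * ((N n) ^ 3 * subset_law.star3_prob s (m n) (P n)) / edge n"

definition wedge_part where "wedge_part n =
  (real n - 2) / N n * ((N n)\<^sup>2 * subset_law.star2_prob s (m n) (P n)) / edge n
  - ((real n - 2) / N n * ((N n)\<^sup>2 * subset_law.star2_prob s (m n) (P n)) / edge n)\<^sup>2"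

lemma edge_limit: "edge \<longlonglongrightarrow> \<alpha>\<^sub>1\<^sup>2"
  using edge_prob_limit[OF tail1 moment1] by (simp add: edge_def[abs_def])

lemma eventually_r_eq: "\<forall>\<^sub>F n in sequentially. numerator n / (wedge_part n + star_part n) = r n"
proof -
  have "\<forall>\<^sub>F n in sequentially. edge n > 0"
    using edge_limit by (rule order_tendstoD) (use \<alpha>1_pos in simp)
  with eventually_law eventually_ge_at_top[of 2] show ?thesis
  proof eventually_elim
    case (elim n)
    interpret L: subset_law s "m n" "P n" by fact
    have p: "L.edge_prob \<noteq> 0" using elim by (auto simp: edge_def)
    have "L.N \<noteq> 0" using L.N_pos by simp
    then have scale: "x / L.N * (L.N\<^sup>2 * t) / edge n = x * t / L.edge_prob"
      "x / L.N * (y / L.N) * (L.N ^ 3 * t) / edge n = x * y * t / L.edge_prob" for x y t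
      using p by (simp_all add: edge_def power2_eq_square power3_eq_cube field_simps)
    show ?case
      unfolding numerator_def wedge_part_def star_part_def scale L.assortativity_eq[OF elim(2) p]
      by (simp add: algebra_simps)
  qed
qed

lemma shifted_ratio_limit: "(\<lambda>n. (real n - c) / N n) \<longlonglongrightarrow> 1 / \<beta>"
proof -
  have "(\<lambda>n. (1 - c / real n) / (real (m n choose s) / real n)) \<longlonglongrightarrow> (1 - 0) / \<beta>"
    by (intro tendsto_intros ratio lim_const_over_n) (use \<beta>_pos in simp)
  then have "(\<lambda>n. (1 - c / real n) / (real (m n choose s) / real n)) \<longlonglongrightarrow> 1 / \<beta>" by simp
  then show ?thesis
  proof (rule Lim_transform_eventually)
    show "\<forall>\<^sub>F n in sequentially. (1 - c / real n) / (real (m n choose s) / real n) = (real n - c) / N n"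
      using eventually_law eventually_gt_at_top[of 0]
    proof eventually_elim
      case (elim n)
      then have "1 - c / real n = (real n - c) / real n" by (simp add: field_simps)
      then show ?case using elim by (simp add: subset_law.N_def)
    qed
  qed
qed

lemma numerator_limit: "numerator \<longlonglongrightarrow> \<alpha>\<^sub>1 / \<beta>"
proof -
  have "numerator \<longlonglongrightarrow> 1 / \<beta> * \<alpha>\<^sub>1 ^ 3 / \<alpha>\<^sub>1\<^sup>2 + 1 / \<beta> * (1 / \<beta>) * (\<alpha>\<^sub>1\<^sup>2 * \<alpha>\<^sub>2\<^sup>2) / \<alpha>\<^sub>1\<^sup>2
      - (1 / \<beta> * (\<alpha>\<^sub>1\<^sup>2 * \<alpha>\<^sub>2) / \<alpha>\<^sub>1\<^sup>2)\<^sup>2"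
    unfolding numerator_def[abs_def]
    by (intro tendsto_intros shifted_ratio_limit edge_limit
        triangle_prob_limit[OF tail2 moment1 moment2]
        path4_prob_limit[OF tail1 moment1 tail2 moment2]
        star2_prob_limit[OF tail1 moment1 tail2 moment2]) (use \<alpha>1_pos in auto)
  also have "1 / \<beta> * \<alpha>\<^sub>1 ^ 3 / \<alpha>\<^sub>1\<^sup>2 + 1 / \<beta> * (1 / \<beta>) * (\<alpha>\<^sub>1\<^sup>2 * \<alpha>\<^sub>2\<^sup>2) / \<alpha>\<^sub>1\<^sup>2
      - (1 / \<beta> * (\<alpha>\<^sub>1\<^sup>2 * \<alpha>\<^sub>2) / \<alpha>\<^sub>1\<^sup>2)\<^sup>2 = \<alpha>\<^sub>1 / \<beta>"
    using \<alpha>1_pos \<beta>_pos by (simp add: power2_eq_square power3_eq_cube field_simps)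
  finally show ?thesis .
qed

lemma wedge_part_limit: "wedge_part \<longlonglongrightarrow> \<alpha>\<^sub>2 / \<beta> - (\<alpha>\<^sub>2 / \<beta>)\<^sup>2"
proof -
  have "wedge_part \<longlonglongrightarrow> 1 / \<beta> * (\<alpha>\<^sub>1\<^sup>2 * \<alpha>\<^sub>2) / \<alpha>\<^sub>1\<^sup>2 - (1 / \<beta> * (\<alpha>\<^sub>1\<^sup>2 * \<alpha>\<^sub>2) / \<alpha>\<^sub>1\<^sup>2)\<^sup>2"
    unfolding wedge_part_def[abs_def]
    by (intro tendsto_intros shifted_ratio_limit edge_limit
        star2_prob_limit[OF tail1 moment1 tail2 moment2]) (use \<alpha>1_pos in auto)
  then show ?thesis using \<alpha>1_pos by simp
qed

text \<open>
  The positivity assumption keeps the limiting degree variance away from zero.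
\<close>

lemma r_limit:
  assumes "uniform_tail 3" and "moment_limit 3 \<alpha>\<^sub>3" and pos: "1 / \<beta> * (\<alpha>\<^sub>1 * \<alpha>\<^sub>3 - \<alpha>\<^sub>2\<^sup>2) + \<alpha>\<^sub>2 > 0"
  shows "r \<longlonglongrightarrow> \<alpha>\<^sub>1 / (1 / \<beta> * (\<alpha>\<^sub>1 * \<alpha>\<^sub>3 - \<alpha>\<^sub>2\<^sup>2) + \<alpha>\<^sub>2)"
proof -
  let ?d = "1 / \<beta> * (\<alpha>\<^sub>1 * \<alpha>\<^sub>3 - \<alpha>\<^sub>2\<^sup>2) + \<alpha>\<^sub>2"
  have "star_part \<longlonglongrightarrow> 1 / \<beta> * (1 / \<beta>) * (\<alpha>\<^sub>1 ^ 3 * \<alpha>\<^sub>3) / \<alpha>\<^sub>1\<^sup>2"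
    unfolding star_part_def[abs_def]
    by (intro tendsto_intros shifted_ratio_limit edge_limit
        star3_prob_limit[OF tail1 moment1 assms(1,2)]) (use \<alpha>1_pos in auto)
  then have "(\<lambda>n. wedge_part n + star_part n) \<longlonglongrightarrow>
      \<alpha>\<^sub>2 / \<beta> - (\<alpha>\<^sub>2 / \<beta>)\<^sup>2 + 1 / \<beta> * (1 / \<beta>) * (\<alpha>\<^sub>1 ^ 3 * \<alpha>\<^sub>3) / \<alpha>\<^sub>1\<^sup>2"
    by (intro tendsto_add wedge_part_limit)
  also have "\<alpha>\<^sub>2 / \<beta> - (\<alpha>\<^sub>2 / \<beta>)\<^sup>2 + 1 / \<beta> * (1 / \<beta>) * (\<alpha>\<^sub>1 ^ 3 * \<alpha>\<^sub>3) / \<alpha>\<^sub>1\<^sup>2 = ?d / \<beta>"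
    using \<alpha>1_pos \<beta>_pos by (simp add: power2_eq_square power3_eq_cube field_simps)
  finally have "(\<lambda>n. numerator n / (wedge_part n + star_part n)) \<longlonglongrightarrow> (\<alpha>\<^sub>1 / \<beta>) / (?d / \<beta>)"
    by (intro tendsto_divide numerator_limit) (use pos \<beta>_pos in auto)
  moreover have "(\<alpha>\<^sub>1 / \<beta>) / (?d / \<beta>) = \<alpha>\<^sub>1 / ?d" using \<beta>_pos by simp
  ultimately have "(\<lambda>n. numerator n / (wedge_part n + star_part n)) \<longlonglongrightarrow> \<alpha>\<^sub>1 / ?d" by (simp only:)
  then show ?thesis by (rule Lim_transform_eventually[OF _ eventually_r_eq])
qed

text \<open>
  The numerator converges, and the three-leaf star dominates its truncations, whose limits exceed any
  bound.
\<close>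

lemma r_vanishes:
  assumes big: "\<And>b. \<exists>K\<ge>0. \<forall>\<^sub>F n in sequentially. b \<le> mean (P n) (\<lambda>x. (min (Y x) K) ^ 3)"
  shows "r \<longlonglongrightarrow> 0"
proof -
  have "filterlim (\<lambda>n. (N n) ^ 3 * subset_law.star3_prob s (m n) (P n)) at_top sequentially"
    unfolding filterlim_at_top
  proof
    fix z :: real
    obtain K where K: "K \<ge> 0"
      "\<forall>\<^sub>F n in sequentially. (z + 1) / \<alpha>\<^sub>1 ^ 3 \<le> mean (P n) (\<lambda>x. (min (Y x) K) ^ 3)"
      using big by blast
    define c where "c = \<alpha>\<^sub>1 * K"
    have c: "c \<ge> 0" using K \<alpha>1_pos by (simp add: c_def)
    have "size_approx 1 (\<lambda>n A. (min (neighbourhood n A) c) ^ 3) (\<lambda>x. (min (\<alpha>\<^sub>1 * Y x ^ 1) c) ^ 3)"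
      by (rule size_approx_truncated_cube[OF neighbourhood_approx[OF tail1 moment1]])
        (use c \<alpha>1_pos Y_nonneg eventually_law in \<open>auto elim!: eventually_mono simp: neighbourhood_nonneg\<close>)
    from mean_size_approx_diff[OF this tail1]
    have "\<forall>\<^sub>F n in sequentially. -1 < mean (\<rho> n) (\<lambda>A. (min (neighbourhood n A) c) ^ 3) -
        mean (P n) (\<lambda>x. (min (\<alpha>\<^sub>1 * Y x ^ 1) c) ^ 3)"
      by (rule order_tendstoD) simp
    with K(2) eventually_law
    show "\<forall>\<^sub>F n in sequentially. z \<le> (N n) ^ 3 * subset_law.star3_prob s (m n) (P n)"
    proof eventually_elim
      case (elim n)
      interpret L: subset_law s "m n" "P n" by fact
      have "(min (\<alpha>\<^sub>1 * Y x ^ 1) c) ^ 3 = \<alpha>\<^sub>1 ^ 3 * (min (Y x) K) ^ 3" for x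
      proof -
        have "min (\<alpha>\<^sub>1 * Y x) (\<alpha>\<^sub>1 * K) = \<alpha>\<^sub>1 * min (Y x) K"
          using \<alpha>1_pos by (simp add: min_mult_distrib_left)
        then show ?thesis by (simp add: c_def power_mult_distrib)
      qed
      then have "mean (P n) (\<lambda>x. (min (\<alpha>\<^sub>1 * Y x ^ 1) c) ^ 3) = \<alpha>\<^sub>1 ^ 3 * mean (P n) (\<lambda>x. (min (Y x) K) ^ 3)"
        by simp
      moreover have "z + 1 \<le> \<alpha>\<^sub>1 ^ 3 * mean (P n) (\<lambda>x. (min (Y x) K) ^ 3)"
        using elim(1) \<alpha>1_pos by (simp add: divide_le_eq mult.commute)
      moreover have "mean (\<rho> n) (\<lambda>A. (min (neighbourhood n A) c) ^ 3) \<le> mean (\<rho> n) (\<lambda>A. neighbourhood n A ^ 3)"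
        using c by (intro mean_mono[OF L.finite_rho] power_mono) (auto simp: neighbourhood_nonneg elim)
      ultimately show ?case using elim by (simp add: neighbourhood_cube_eq)
    qed
  qed
  note top = this
  have lim: "(\<lambda>n. (real n - 2) / N n * ((real n - 3) / N n) / edge n) \<longlonglongrightarrow> 1 / \<beta> * (1 / \<beta>) / \<alpha>\<^sub>1\<^sup>2"
    by (intro tendsto_intros shifted_ratio_limit edge_limit) (use \<alpha>1_pos in auto)
  have "filterlim (\<lambda>n. (real n - 2) / N n * ((real n - 3) / N n) / edge n *
      ((N n) ^ 3 * subset_law.star3_prob s (m n) (P n))) at_top sequentially"
    by (rule filterlim_tendsto_pos_mult_at_top[OF lim _ top]) (use \<beta>_pos \<alpha>1_pos in simp)
  then have "filterlim star_part at_top sequentially"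
    by (simp add: star_part_def[abs_def] mult_ac)
  then have "filterlim (\<lambda>n. wedge_part n + star_part n) at_top sequentially"
    by (rule filterlim_tendsto_add_at_top[OF wedge_part_limit])
  then have "(\<lambda>n. numerator n / (wedge_part n + star_part n)) \<longlonglongrightarrow> 0"
    by (rule real_tendsto_divide_at_top[OF numerator_limit])
  then show ?thesis by (rule Lim_transform_eventually[OF _ eventually_r_eq])
qed

end

section \<open>Moments and tails from weak convergence\<close>

text \<open>
  Above the level \<open>K\<close>, which is at least one, powers grow faster for larger exponents. Hence uniform
  integrability of the highest moment controls the truncation error of all lower ones.
\<close>

lemma power_minus_truncation_mono:
  fixes z K :: real
  assumes "0 \<le> z" "1 \<le> K" "j \<le> k"
  shows "z ^ j - (min z K) ^ j \<le> z ^ k - (min z K) ^ k"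
proof (cases "z \<le> K")
  case False
  have "K ^ j * (K ^ (k - j) - 1) \<le> z ^ j * (z ^ (k - j) - 1)"
    using False assms by (intro mult_mono power_mono diff_right_mono) (auto simp: one_le_power)
  then have "K ^ k - K ^ j \<le> z ^ k - z ^ j"
    using assms(3) by (simp add: right_diff_distrib flip: power_add)
  then show ?thesis using False by (simp add: min_def)
qed simp

locale weak_size_sequence = size_sequence +
  fixes M :: "'a measure" and Z :: "'a \<Rightarrow> real" and \<beta> :: real
  assumes M: "prob_space M" and Z [measurable]: "Z \<in> borel_measurable M"
    and weak: "weak_conv_m
      (\<lambda>n. distr (measure_pmf (active_sets n (m n) (P n))) borel (scaled_size s n (m n))) (distr M borel Z)"
    and \<beta>_pos: "\<beta> > 0" and ratio: "(\<lambda>n. real (m n choose s) / real n) \<longlonglongrightarrow> \<beta>"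
begin

sublocale prob_space M by (rule M)

text \<open>
  The variable \<open>Z\<^sub>1\<close> as a function of the size of the set.
\<close>

definition \<zeta> where "\<zeta> n x = sqrt (real n) / sqrt (real (m n choose s)) * Y x"

lemma \<zeta>_nonneg: "0 \<le> \<zeta> n x"
  by (simp add: \<zeta>_def Y_nonneg)

lemma mean_first_set:
  assumes "n \<ge> 1"
  shows "mean (active_sets n (m n) (P n)) (\<lambda>D. f (card (D 1))) = mean (P n) f"
proof -
  have "map_pmf (\<lambda>D. D 1) (active_sets n (m n) (P n)) = \<rho> n"
    unfolding active_sets_def using assms by (subst Pi_pmf_component) auto
  then have "mean (active_sets n (m n) (P n)) (\<lambda>D. f (card (D 1))) = mean (\<rho> n) (\<lambda>A. f (card A))"
    using integral_map_pmf[of "\<lambda>D. D 1" "active_sets n (m n) (P n)" "\<lambda>A. f (card A)"] by simp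
  also have "\<dots> = mean (P n) f"
    by (rule mean_card_random_subset) (rule P_supp[OF assms])
  finally show ?thesis .
qed

lemma mean_scaled_size:
  assumes "n \<ge> 1"
  shows "mean (active_sets n (m n) (P n)) (\<lambda>D. \<phi> (scaled_size s n (m n) D)) = mean (P n) (\<lambda>x. \<phi> (\<zeta> n x))"
  using mean_first_set[OF assms, of "\<lambda>x. \<phi> (\<zeta> n x)"] by (simp add: scaled_size_def \<zeta>_def Y_eq)

lemma size_moment_eq:
  assumes "n \<ge> 1"
  shows "size_moment s n (m n) (P n) k = mean (P n) (\<lambda>x. Y x ^ k)"
  using mean_first_set[OF assms, of "\<lambda>x. Y x ^ k"] by (simp add: size_moment_def Y_eq)

text \<open>
  Weak convergence, transported from the law of the whole family of sets to the law \<open>P n\<close> of a single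
  size.
\<close>

lemma weak_limit:
  fixes \<phi> :: "real \<Rightarrow> real"
  assumes cont: "\<And>z. isCont \<phi> z" and bound: "\<And>z. \<bar>\<phi> z\<bar> \<le> b"
  shows "(\<lambda>n. mean (P n) (\<lambda>x. \<phi> (\<zeta> n x))) \<longlonglongrightarrow> (\<integral>x. \<phi> (Z x) \<partial>M)"
proof -
  have [measurable]: "\<phi> \<in> borel_measurable borel"
    using cont by (intro borel_measurable_continuous_onI continuous_at_imp_continuous_on) auto
  have "(\<lambda>n. \<integral>z. \<phi> z \<partial>distr (measure_pmf (active_sets n (m n) (P n))) borel (scaled_size s n (m n)))
      \<longlonglongrightarrow> (\<integral>z. \<phi> z \<partial>distr M borel Z)"
    using cont bound
    by (intro weak_conv_imp_integral_bdd_continuous_conv[OF _ _ weak, where B = b]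
        prob_space.real_distribution_distr[OF prob_space_measure_pmf] real_distribution_distr) auto
  then have "(\<lambda>n. mean (active_sets n (m n) (P n)) (\<lambda>D. \<phi> (scaled_size s n (m n) D)))
      \<longlonglongrightarrow> (\<integral>x. \<phi> (Z x) \<partial>M)"
    by (simp add: integral_distr)
  then show ?thesis
    by (rule Lim_transform_eventually)
      (use eventually_ge_at_top[of 1] in eventually_elim, rule mean_scaled_size)
qed

lemma truncated_moment_limit:
  assumes "K \<ge> 0"
  shows "(\<lambda>n. mean (P n) (\<lambda>x. (min (\<zeta> n x) K) ^ k)) \<longlonglongrightarrow> (\<integral>x. (min \<bar>Z x\<bar> K) ^ k \<partial>M)"
proof -
  have "(\<lambda>n. mean (P n) (\<lambda>x. (min \<bar>\<zeta> n x\<bar> K) ^ k)) \<longlonglongrightarrow> (\<integral>x. (min \<bar>Z x\<bar> K) ^ k \<partial>M)"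
  proof (rule weak_limit[where b = "K ^ k"])
    show "isCont (\<lambda>z. (min \<bar>z\<bar> K) ^ k) z" for z by (intro continuous_intros)
    show "\<bar>(min \<bar>z\<bar> K) ^ k\<bar> \<le> K ^ k" for z
      unfolding power_abs by (intro power_mono) (use assms in auto)
  qed
  then show ?thesis by (simp add: \<zeta>_nonneg)
qed

text \<open>
  Inherited from the approximating variables by testing against a bounded continuous function that is
  positive exactly on the negative half-line.
\<close>

lemma Z_nonneg: "AE x in M. 0 \<le> Z x"
proof -
  let ?\<phi> = "\<lambda>z :: real. min 1 (max 0 (- z))"
  have "(\<lambda>n. mean (P n) (\<lambda>x. ?\<phi> (\<zeta> n x))) \<longlonglongrightarrow> (\<integral>x. ?\<phi> (Z x) \<partial>M)"
    by (rule weak_limit[where b = 1]) (auto intro!: continuous_intros)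
  moreover have "?\<phi> (\<zeta> n x) = 0" for n x using \<zeta>_nonneg[of n x] by simp
  ultimately have "(\<lambda>n :: nat. 0 :: real) \<longlonglongrightarrow> (\<integral>x. ?\<phi> (Z x) \<partial>M)" by simp
  then have "(\<integral>x. ?\<phi> (Z x) \<partial>M) = 0" using LIMSEQ_unique tendsto_const by blast
  moreover have "integrable M (\<lambda>x. ?\<phi> (Z x))"
    by (rule integrable_const_bound[where B = 1]) auto
  ultimately have "AE x in M. ?\<phi> (Z x) = 0"
    by (subst (asm) integral_nonneg_eq_0_iff_AE) auto
  then show ?thesis by eventually_elim (auto simp: min_def max_def split: if_splits)
qed

lemma abs_Z_moment: "(\<integral>x. \<bar>Z x\<bar> ^ k \<partial>M) = (\<integral>x. Z x ^ k \<partial>M)"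
  by (rule integral_cong_AE) (use Z_nonneg in auto)

lemma integrable_truncated:
  assumes "K \<ge> 0"
  shows "integrable M (\<lambda>x. (min \<bar>Z x\<bar> K) ^ k)"
  by (rule integrable_const_bound[where B = "K ^ k"])
    (use assms in \<open>auto simp: power_abs intro!: power_mono\<close>)

lemma scale_limit: "(\<lambda>n. sqrt (real (m n choose s)) / sqrt (real n)) \<longlonglongrightarrow> sqrt \<beta>"
  using tendsto_real_sqrt[OF ratio] by (simp add: real_sqrt_divide)

lemma Y_eq_scaled:
  assumes "subset_law s (m n) (P n)" "n \<ge> 1"
  shows "Y x = sqrt (real (m n choose s)) / sqrt (real n) * \<zeta> n x"
proof -
  have "m n choose s > 0" using assms(1) by (simp add: subset_law_def)
  then show ?thesis using assms(2) by (simp add: \<zeta>_def)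
qed

definition moment_converges :: "nat \<Rightarrow> bool" where
  "moment_converges k \<longleftrightarrow> integrable M (\<lambda>x. Z x ^ k) \<and>
    (\<lambda>n. mean (P n) (\<lambda>x. \<zeta> n x ^ k)) \<longlonglongrightarrow> (\<integral>x. Z x ^ k \<partial>M)"

text \<open>
  Truncated moments converge by weak convergence and full moments by assumption, so the truncation
  errors of \<open>Z\<^sub>1\<close> converge to the truncation error of \<open>Z\<close>, which is small by dominated convergence.
\<close>

lemma truncation_error_small:
  assumes k: "moment_converges k" and "\<epsilon> > 0"
  obtains K where "K \<ge> 1" and "(\<integral>x. Z x ^ k \<partial>M) - (\<integral>x. (min \<bar>Z x\<bar> K) ^ k \<partial>M) < \<epsilon>"
    and "\<forall>\<^sub>F n in sequentially.
      mean (P n) (\<lambda>x. \<zeta> n x ^ k) - mean (P n) (\<lambda>x. (min (\<zeta> n x) K) ^ k) < \<epsilon>"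
proof -
  have int: "integrable M (\<lambda>x. \<bar>Z x\<bar> ^ k)"
    using k integrable_abs[of M "\<lambda>x. Z x ^ k"] by (simp add: moment_converges_def power_abs)
  have "(\<lambda>i. \<integral>x. (min \<bar>Z x\<bar> (real i)) ^ k \<partial>M) \<longlonglongrightarrow> (\<integral>x. \<bar>Z x\<bar> ^ k \<partial>M)"
  proof (rule integral_dominated_convergence[OF _ _ int])
    show "AE x in M. (\<lambda>i. (min \<bar>Z x\<bar> (real i)) ^ k) \<longlonglongrightarrow> \<bar>Z x\<bar> ^ k"
    proof (rule AE_I2)
      fix x
      have "\<forall>\<^sub>F i in sequentially. \<bar>Z x\<bar> ^ k = (min \<bar>Z x\<bar> (real i)) ^ k"
        using eventually_ge_at_top[of "nat \<lceil>\<bar>Z x\<bar>\<rceil>"]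
      proof eventually_elim
        case (elim i)
        then have "min \<bar>Z x\<bar> (real i) = \<bar>Z x\<bar>" by linarith
        then show ?case by simp
      qed
      then show "(\<lambda>i. (min \<bar>Z x\<bar> (real i)) ^ k) \<longlonglongrightarrow> \<bar>Z x\<bar> ^ k"
        by (rule Lim_transform_eventually[OF tendsto_const])
    qed
    show "AE x in M. norm ((min \<bar>Z x\<bar> (real i)) ^ k) \<le> \<bar>Z x\<bar> ^ k" for i
      by (auto simp: power_abs intro!: power_mono)
  qed auto
  then have "\<forall>\<^sub>F i in sequentially. (\<integral>x. Z x ^ k \<partial>M) - \<epsilon> < (\<integral>x. (min \<bar>Z x\<bar> (real i)) ^ k \<partial>M)"
    using \<open>\<epsilon> > 0\<close> by (intro order_tendstoD(1)) (auto simp: abs_Z_moment)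
  then have "\<forall>\<^sub>F i in sequentially. 1 \<le> i \<and> (\<integral>x. Z x ^ k \<partial>M) - \<epsilon> < (\<integral>x. (min \<bar>Z x\<bar> (real i)) ^ k \<partial>M)"
    using eventually_ge_at_top[of 1] by eventually_elim auto
  from eventually_happens'[OF sequentially_bot this]
  obtain i :: nat where i: "1 \<le> i" "(\<integral>x. Z x ^ k \<partial>M) - \<epsilon> < (\<integral>x. (min \<bar>Z x\<bar> (real i)) ^ k \<partial>M)"
    by (elim exE conjE)
  have "(\<lambda>n. mean (P n) (\<lambda>x. \<zeta> n x ^ k) - mean (P n) (\<lambda>x. (min (\<zeta> n x) (real i)) ^ k))
      \<longlonglongrightarrow> (\<integral>x. Z x ^ k \<partial>M) - (\<integral>x. (min \<bar>Z x\<bar> (real i)) ^ k \<partial>M)"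
    using k by (intro tendsto_diff truncated_moment_limit) (auto simp: moment_converges_def)
  then have "\<forall>\<^sub>F n in sequentially.
      mean (P n) (\<lambda>x. \<zeta> n x ^ k) - mean (P n) (\<lambda>x. (min (\<zeta> n x) (real i)) ^ k) < \<epsilon>"
    by (rule order_tendstoD) (use i in linarith)
  then show ?thesis using i by (intro that[of "real i"]) auto
qed

text \<open>
  A value above \<open>2 * K\<close> is counted with at least half its weight in the truncation error at level \<open>K\<close>.
  A large size forces such a value, since \<open>Y\<close> and \<open>\<zeta>\<close> differ by a bounded factor.
\<close>

lemma uniform_tail_of_moment:
  assumes k: "moment_converges k" and j: "1 \<le> j" "j \<le> k"
  shows "uniform_tail j"
  unfolding uniform_tail_def
proof (intro allI impI)
  fix \<epsilon> :: real assume "\<epsilon> > 0"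
  define c where "c = sqrt \<beta> + 1"
  have c: "c > 0" "sqrt \<beta> < c" using \<beta>_pos by (auto simp: c_def add_pos_pos)
  have "\<epsilon> / (2 * c ^ k) > 0" using \<open>\<epsilon> > 0\<close> c by simp
  then obtain K where K: "K \<ge> 1" and small: "\<forall>\<^sub>F n in sequentially.
      mean (P n) (\<lambda>x. \<zeta> n x ^ k) - mean (P n) (\<lambda>x. (min (\<zeta> n x) K) ^ k) < \<epsilon> / (2 * c ^ k)"
    by (rule truncation_error_small[OF k])
  \<comment> \<open>sizes beyond \<open>L\<close> have \<open>Y\<close> above \<open>2 * K * c\<close>, hence \<open>\<zeta>\<close> above \<open>2 * K\<close>\<close>
  define L where "L = s + nat \<lceil>2 * K * c\<rceil>"
  have "\<forall>\<^sub>F n in sequentially. sqrt (real (m n choose s)) / sqrt (real n) < c"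
    using scale_limit c(2) by (rule order_tendstoD)
  with small eventually_law eventually_ge_at_top[of 1]
  have "\<forall>\<^sub>F n in sequentially. mean (P n) (\<lambda>x. Y x ^ j * of_bool (L < x)) < \<epsilon>"
  proof eventually_elim
    case (elim n)
    interpret L: subset_law s "m n" "P n" by fact
    define c' where "c' = sqrt (real (m n choose s)) / sqrt (real n)"
    have c': "0 \<le> c'" "c' < c" using elim by (auto simp: c'_def)
    have Yc: "Y x = c' * \<zeta> n x" for x using Y_eq_scaled elim by (simp add: c'_def)
    have "mean (P n) (\<lambda>x. Y x ^ j * of_bool (L < x)) \<le>
        mean (P n) (\<lambda>x. 2 * c ^ k * (\<zeta> n x ^ k - (min (\<zeta> n x) K) ^ k))"
    proof (rule mean_mono[OF L.finite_P])
      fix x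
      have nn: "0 \<le> \<zeta> n x ^ k - (min (\<zeta> n x) K) ^ k"
        using K \<zeta>_nonneg[of n x] by (auto intro!: power_mono)
      show "Y x ^ j * of_bool (L < x) \<le> 2 * c ^ k * (\<zeta> n x ^ k - (min (\<zeta> n x) K) ^ k)"
      proof (cases "L < x")
        case True
        have xs: "s \<le> x" and big: "2 * K * c \<le> real x - real s"
          using True by (auto simp: L_def) linarith+
        then have Y: "1 \<le> Y x" "2 * K * c \<le> Y x" using Y_ge[OF xs] by auto
        have "2 * K * c \<le> c * \<zeta> n x"
          using Y(2) c' \<zeta>_nonneg[of n x] mult_right_mono[of c' c "\<zeta> n x"] unfolding Yc by linarith
        then have \<zeta>: "2 * K \<le> \<zeta> n x" using c by (simp add: mult.commute)
        have "(min (\<zeta> n x) K) ^ k \<le> (\<zeta> n x / 2) ^ k"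
          using \<zeta> K by (intro power_mono) auto
        also have "\<dots> = \<zeta> n x ^ k / 2 ^ k" by (simp add: power_divide)
        also have "\<dots> \<le> \<zeta> n x ^ k / 2"
        proof (rule divide_left_mono)
          have "(2 :: real) ^ 1 \<le> 2 ^ k" using j by (intro power_increasing) auto
          then show "(2 :: real) \<le> 2 ^ k" by simp
        qed (use \<zeta>_nonneg[of n x] in auto)
        finally have half: "\<zeta> n x ^ k \<le> 2 * (\<zeta> n x ^ k - (min (\<zeta> n x) K) ^ k)" by simp
        have "Y x ^ j \<le> Y x ^ k" using Y(1) j by (intro power_increasing) auto
        also have "\<dots> = c' ^ k * \<zeta> n x ^ k" by (simp add: Yc power_mult_distrib)
        also have "\<dots> \<le> c ^ k * (2 * (\<zeta> n x ^ k - (min (\<zeta> n x) K) ^ k))"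
          using c' half \<zeta>_nonneg[of n x] by (intro mult_mono power_mono) auto
        finally show ?thesis using True by (simp add: algebra_simps)
      next
        case False
        have "0 \<le> 2 * c ^ k * (\<zeta> n x ^ k - (min (\<zeta> n x) K) ^ k)"
          using nn c by (intro mult_nonneg_nonneg) auto
        then show ?thesis using False by simp
      qed
    qed
    also have "\<dots> = 2 * c ^ k * (mean (P n) (\<lambda>x. \<zeta> n x ^ k) - mean (P n) (\<lambda>x. (min (\<zeta> n x) K) ^ k))"
      by (simp add: mean_diff[OF L.finite_P])
    also have "\<dots> < 2 * c ^ k * (\<epsilon> / (2 * c ^ k))"
      using elim c by (intro mult_strict_left_mono) auto
    also have "\<dots> = \<epsilon>" using c by simp
    finally show ?case .
  qed
  then show "\<exists>L. \<forall>\<^sub>F n in sequentially. mean (P n) (\<lambda>x. Y x ^ j * of_bool (L < x)) < \<epsilon>" by blast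
qed

lemma integrable_lower_moment:
  assumes "integrable M (\<lambda>x. Z x ^ k)" and "j \<le> k"
  shows "integrable M (\<lambda>x. Z x ^ j)"
proof (rule Bochner_Integration.integrable_bound)
  show "integrable M (\<lambda>x. 1 + \<bar>Z x ^ k\<bar>)" using assms by simp
  show "AE x in M. norm (Z x ^ j) \<le> norm (1 + \<bar>Z x ^ k\<bar>)"
  proof (rule AE_I2)
    fix x
    have "\<bar>Z x\<bar> ^ j \<le> 1 + \<bar>Z x\<bar> ^ k"
    proof (cases "\<bar>Z x\<bar> \<le> 1")
      case True
      then have "\<bar>Z x\<bar> ^ j \<le> 1" by (intro power_le_one) auto
      then show ?thesis by (simp add: add_increasing2)
    next
      case False
      then have "\<bar>Z x\<bar> ^ j \<le> \<bar>Z x\<bar> ^ k" using assms(2) by (intro power_increasing) auto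
      then show ?thesis by simp
    qed
    then show "norm (Z x ^ j) \<le> norm (1 + \<bar>Z x ^ k\<bar>)" by (simp add: power_abs)
  qed
qed measurable

text \<open>
  Both truncation errors of order \<open>j\<close> are bounded by those of order \<open>k\<close>, and truncated moments converge
  weakly; the three errors add up to \<open>\<epsilon>\<close>.
\<close>

lemma lower_moment_converges:
  assumes k: "moment_converges k" and j: "j \<le> k"
  shows "moment_converges j"
  unfolding moment_converges_def
proof
  have intk: "integrable M (\<lambda>x. Z x ^ k)" using k by (simp add: moment_converges_def)
  show intj: "integrable M (\<lambda>x. Z x ^ j)" by (rule integrable_lower_moment[OF intk j])
  show "(\<lambda>n. mean (P n) (\<lambda>x. \<zeta> n x ^ j)) \<longlonglongrightarrow> (\<integral>x. Z x ^ j \<partial>M)"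
  proof (rule tendstoI)
    fix \<epsilon> :: real assume "\<epsilon> > 0"
    then have "\<epsilon> / 3 > 0" by simp
    then obtain K where K: "K \<ge> 1" and Zsmall: "(\<integral>x. Z x ^ k \<partial>M) - (\<integral>x. (min \<bar>Z x\<bar> K) ^ k \<partial>M) < \<epsilon> / 3"
      and small: "\<forall>\<^sub>F n in sequentially.
        mean (P n) (\<lambda>x. \<zeta> n x ^ k) - mean (P n) (\<lambda>x. (min (\<zeta> n x) K) ^ k) < \<epsilon> / 3"
      by (rule truncation_error_small[OF k])
    have K0: "0 \<le> K" using K by simp
    have int: "integrable M (\<lambda>x. \<bar>Z x\<bar> ^ i)" if "integrable M (\<lambda>x. Z x ^ i)" for i
      using integrable_abs[OF that] by (simp add: power_abs)
    have Zj: "\<bar>(\<integral>x. Z x ^ j \<partial>M) - (\<integral>x. (min \<bar>Z x\<bar> K) ^ j \<partial>M)\<bar> < \<epsilon> / 3"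
    proof -
      have "(\<integral>x. \<bar>Z x\<bar> ^ j - (min \<bar>Z x\<bar> K) ^ j \<partial>M) \<le> (\<integral>x. \<bar>Z x\<bar> ^ k - (min \<bar>Z x\<bar> K) ^ k \<partial>M)"
        by (intro integral_mono Bochner_Integration.integrable_diff int intj intk integrable_truncated K0
            power_minus_truncation_mono K j) auto
      moreover have "0 \<le> (\<integral>x. \<bar>Z x\<bar> ^ j - (min \<bar>Z x\<bar> K) ^ j \<partial>M)"
        using K0 by (intro integral_nonneg_AE) (auto intro!: power_mono)
      ultimately show ?thesis
        using Zsmall int[OF intj] int[OF intk] integrable_truncated[OF K0]
        by (simp add: Bochner_Integration.integral_diff abs_Z_moment)
    qed
    have "\<forall>\<^sub>F n in sequentially.
        dist (mean (P n) (\<lambda>x. (min (\<zeta> n x) K) ^ j)) (\<integral>x. (min \<bar>Z x\<bar> K) ^ j \<partial>M) < \<epsilon> / 3"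
      using truncated_moment_limit[OF K0] \<open>\<epsilon> / 3 > 0\<close> by (rule tendstoD)
    with small eventually_law
    show "\<forall>\<^sub>F n in sequentially. dist (mean (P n) (\<lambda>x. \<zeta> n x ^ j)) (\<integral>x. Z x ^ j \<partial>M) < \<epsilon>"
    proof eventually_elim
      case (elim n)
      interpret L: subset_law s "m n" "P n" by fact
      have "mean (P n) (\<lambda>x. \<zeta> n x ^ j - (min (\<zeta> n x) K) ^ j) \<le>
          mean (P n) (\<lambda>x. \<zeta> n x ^ k - (min (\<zeta> n x) K) ^ k)"
        by (intro mean_mono[OF L.finite_P] power_minus_truncation_mono \<zeta>_nonneg K j)
      moreover have "0 \<le> mean (P n) (\<lambda>x. \<zeta> n x ^ j - (min (\<zeta> n x) K) ^ j)"
        using K0 \<zeta>_nonneg by (intro mean_nonneg) (auto intro!: power_mono)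
      ultimately have "\<bar>mean (P n) (\<lambda>x. \<zeta> n x ^ j) - mean (P n) (\<lambda>x. (min (\<zeta> n x) K) ^ j)\<bar> < \<epsilon> / 3"
        using elim(1) by (simp add: mean_diff[OF L.finite_P])
      then show ?case using Zj elim(3) unfolding dist_real_def by linarith
    qed
  qed
qed

lemma moment_limit_of_converges:
  assumes "moment_converges k"
  shows "moment_limit k (sqrt \<beta> ^ k * (\<integral>x. Z x ^ k \<partial>M))"
proof -
  have "(\<lambda>n. (sqrt (real (m n choose s)) / sqrt (real n)) ^ k * mean (P n) (\<lambda>x. \<zeta> n x ^ k))
      \<longlonglongrightarrow> sqrt \<beta> ^ k * (\<integral>x. Z x ^ k \<partial>M)"
    using assms by (intro tendsto_mult tendsto_power scale_limit) (simp add: moment_converges_def)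
  then show ?thesis
    unfolding moment_limit_def
  proof (rule Lim_transform_eventually)
    show "\<forall>\<^sub>F n in sequentially. (sqrt (real (m n choose s)) / sqrt (real n)) ^ k * mean (P n) (\<lambda>x. \<zeta> n x ^ k) =
        mean (P n) (\<lambda>x. Y x ^ k)"
      using eventually_law eventually_ge_at_top[of 1]
      by eventually_elim (simp only: Y_eq_scaled power_mult_distrib integral_mult_right_zero)
  qed
qed

text \<open>
  By monotone convergence some truncated third moment of \<open>Z\<close> exceeds any given bound, and weak
  convergence transfers it to \<open>Z\<^sub>1\<close>.
\<close>

lemma truncated_third_moment_unbounded:
  assumes inf: "(\<integral>\<^sup>+x. ennreal (Z x ^ 3) \<partial>M) = \<infinity>"
  shows "\<exists>K\<ge>0. \<forall>\<^sub>F n in sequentially. b \<le> mean (P n) (\<lambda>x. (min (Y x) K) ^ 3)"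
proof -
  \<comment> \<open>the ratio \<open>Y / \<zeta>\<close> tends to \<open>sqrt \<beta>\<close>, so it eventually exceeds \<open>c\<close>\<close>
  define c where "c = sqrt \<beta> / 2"
  have c: "c > 0" "c < sqrt \<beta>" using \<beta>_pos by (auto simp: c_def)
  have "(\<integral>\<^sup>+x. ennreal (Z x ^ 3) \<partial>M) \<le> (\<integral>\<^sup>+x. (SUP i. ennreal ((min \<bar>Z x\<bar> (real i)) ^ 3)) \<partial>M)"
  proof (rule nn_integral_mono_AE, use Z_nonneg in eventually_elim)
    case (elim x)
    have "Z x ^ 3 = (min \<bar>Z x\<bar> (real (nat \<lceil>\<bar>Z x\<bar>\<rceil>))) ^ 3"
    proof -
      have "min \<bar>Z x\<bar> (real (nat \<lceil>\<bar>Z x\<bar>\<rceil>)) = Z x" using elim by linarith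
      then show ?thesis by simp
    qed
    then show ?case by (metis SUP_upper UNIV_I)
  qed
  also have "\<dots> = (SUP i. \<integral>\<^sup>+x. ennreal ((min \<bar>Z x\<bar> (real i)) ^ 3) \<partial>M)"
    by (rule nn_integral_monotone_convergence_SUP)
      (auto simp: incseq_def le_fun_def intro!: ennreal_leI power_mono)
  finally have unbounded: "(SUP i. \<integral>\<^sup>+x. ennreal ((min \<bar>Z x\<bar> (real i)) ^ 3) \<partial>M) = top"
    using inf by (simp add: top_unique)
  have "ennreal (\<bar>b\<bar> / c ^ 3) < (SUP i. \<integral>\<^sup>+x. ennreal ((min \<bar>Z x\<bar> (real i)) ^ 3) \<partial>M)"
    unfolding unbounded by simp
  then obtain i where "ennreal (\<bar>b\<bar> / c ^ 3) < (\<integral>\<^sup>+x. ennreal ((min \<bar>Z x\<bar> (real i)) ^ 3) \<partial>M)"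
    unfolding less_SUP_iff by blast
  also have "\<dots> = ennreal (\<integral>x. (min \<bar>Z x\<bar> (real i)) ^ 3 \<partial>M)"
    by (rule nn_integral_eq_integral) (auto intro!: integrable_truncated)
  finally have "\<bar>b\<bar> / c ^ 3 < (\<integral>x. (min \<bar>Z x\<bar> (real i)) ^ 3 \<partial>M)"
    using c by (simp add: ennreal_less_iff)
  with truncated_moment_limit[of "real i" 3]
  have "\<forall>\<^sub>F n in sequentially. \<bar>b\<bar> / c ^ 3 < mean (P n) (\<lambda>x. (min (\<zeta> n x) (real i)) ^ 3)"
    by (intro order_tendstoD(1)) auto
  moreover have "\<forall>\<^sub>F n in sequentially. c < sqrt (real (m n choose s)) / sqrt (real n)"
    using scale_limit c(2) by (rule order_tendstoD)
  ultimately have "\<forall>\<^sub>F n in sequentially. b \<le> mean (P n) (\<lambda>x. (min (Y x) (c * real i)) ^ 3)"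
    using eventually_law eventually_ge_at_top[of 1]
  proof eventually_elim
    case (elim n)
    interpret L: subset_law s "m n" "P n" by fact
    have "b \<le> \<bar>b\<bar>" by simp
    also have "\<dots> \<le> c ^ 3 * mean (P n) (\<lambda>x. (min (\<zeta> n x) (real i)) ^ 3)"
      using elim(1) c by (simp add: divide_less_eq mult.commute)
    also have "\<dots> = mean (P n) (\<lambda>x. (c * min (\<zeta> n x) (real i)) ^ 3)"
      by (simp add: power_mult_distrib)
    also have "\<dots> \<le> mean (P n) (\<lambda>x. (min (Y x) (c * real i)) ^ 3)"
    proof (intro mean_mono[OF L.finite_P] power_mono)
      fix x
      have "c * \<zeta> n x \<le> Y x"
        unfolding Y_eq_scaled[OF elim(3,4)] using elim(2) \<zeta>_nonneg by (intro mult_right_mono) auto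
      show "c * min (\<zeta> n x) (real i) \<le> min (Y x) (c * real i)"
      proof (rule min.boundedI)
        have "c * min (\<zeta> n x) (real i) \<le> c * \<zeta> n x" using c by (intro mult_left_mono) auto
        also note \<open>c * \<zeta> n x \<le> Y x\<close>
        finally show "c * min (\<zeta> n x) (real i) \<le> Y x" .
        show "c * min (\<zeta> n x) (real i) \<le> c * real i" using c by (intro mult_left_mono) auto
      qed
      show "0 \<le> c * min (\<zeta> n x) (real i)" using c \<zeta>_nonneg[of n x] by simp
    qed
    finally show ?case .
  qed
  then show ?thesis using c by (intro exI[of _ "c * real i"]) auto
qed

lemma first_moment_pos:
  assumes "0 < (\<integral>x. Z x ^ k \<partial>M)" and "integrable M Z" and "k \<ge> 1"
  shows "0 < (\<integral>x. Z x \<partial>M)"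
proof (rule ccontr)
  assume "\<not> 0 < (\<integral>x. Z x \<partial>M)"
  moreover have "0 \<le> (\<integral>x. Z x \<partial>M)" using Z_nonneg by (rule integral_nonneg_AE)
  ultimately have "(\<integral>x. Z x \<partial>M) = 0" by simp
  then have "AE x in M. Z x = 0"
    using integral_nonneg_eq_0_iff_AE[OF assms(2) Z_nonneg] by simp
  then have "(\<integral>x. Z x ^ k \<partial>M) = (\<integral>x. 0 \<partial>M)"
    by (intro integral_cong_AE) (use assms(3) in \<open>auto elim!: eventually_mono\<close>)
  then show False using assms(1) by simp
qed

end

section \<open>Factorial moments of the limiting degree\<close>

lemma falling_product_eq: "(\<Prod>j<i. (real k - real j)) = fact i * real (k choose i)"
  by (simp add: binomial_gbinomial gbinomial_prod_rev atLeast0LessThan)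

text \<open>
  The factorial moments of a Poisson distribution are the powers of its mean: the falling factorial
  cancels against \<open>fact k\<close> and shifts the exponential series by \<open>i\<close>.
\<close>

lemma poisson_factorial_sums:
  fixes \<Lambda> :: real
  shows "(\<lambda>k. \<Lambda> ^ k * exp (- \<Lambda>) / fact k * (\<Prod>j<i. (real k - real j))) sums \<Lambda> ^ i"
proof -
  let ?f = "\<lambda>k. \<Lambda> ^ k * exp (- \<Lambda>) / fact k * (\<Prod>j<i. (real k - real j))"
  have shift: "?f (k + i) = (\<Lambda> ^ k /\<^sub>R fact k) * (\<Lambda> ^ i * exp (- \<Lambda>))" for k
  proof -
    have "real (k + i choose i) = fact (k + i) / (fact i * fact k)"
      using binomial_fact[of i "k + i", where 'a = real] by simp
    then show ?thesis
      unfolding falling_product_eq by (simp add: power_add field_simps)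
  qed
  have "(\<lambda>k. (\<Lambda> ^ k /\<^sub>R fact k) * (\<Lambda> ^ i * exp (- \<Lambda>))) sums (exp \<Lambda> * (\<Lambda> ^ i * exp (- \<Lambda>)))"
    by (intro sums_mult2 exp_converges)
  also have "exp \<Lambda> * (\<Lambda> ^ i * exp (- \<Lambda>)) = \<Lambda> ^ i"
    by (simp add: exp_minus field_simps)
  finally have "(\<lambda>k. ?f (k + i)) sums \<Lambda> ^ i" by (simp only: shift)
  moreover have "?f k = 0" if "k < i" for k
    using that unfolding falling_product_eq by simp
  ultimately show ?thesis using sums_zero_iff_shift[of i ?f "\<Lambda> ^ i"] by blast
qed

text \<open>
  Tonelli's theorem reduces the mixture to a Poisson distribution with fixed mean.
\<close>

lemma factorial_moment_limit_degree:
  assumes M: "prob_space M" and Z [measurable]: "Z \<in> borel_measurable M" and nn: "AE x in M. 0 \<le> Z x"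
    and int: "integrable M (\<lambda>x. Z x ^ i)"
  shows "factorial_moment (limit_degree M Z) i = (\<integral>x. Z x \<partial>M) ^ i * (\<integral>x. Z x ^ i \<partial>M)"
proof -
  interpret prob_space M by fact
  define z1 where "z1 = (\<integral>x. Z x \<partial>M)"
  define p where "p k x = (z1 * Z x) ^ k * exp (- (z1 * Z x)) / fact k" for x and k :: nat
  define f where "f k = (\<Prod>j<i. (real k - real j))" for k
  have z1: "0 \<le> z1" unfolding z1_def using nn by (rule integral_nonneg_AE)
  have [measurable]: "p k \<in> borel_measurable M" for k unfolding p_def[abs_def] by measurable
  have f_nn: "0 \<le> f k" for k unfolding f_def falling_product_eq by simp
  have p_nn: "0 \<le> p k x" if "0 \<le> Z x" for k x using that z1 by (simp add: p_def)
  have p_sums: "(\<lambda>k. p k x) sums 1" for x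
    using poisson_factorial_sums[of "z1 * Z x" 0] by (simp add: p_def)
  have p_le: "p k x \<le> 1" if "0 \<le> Z x" for k x
    using sum_le_suminf[of "\<lambda>k. p k x" "{k}"] p_sums[of x] p_nn[OF that] by (auto simp: sums_iff)
  have p_int: "integrable M (p k)" for k
    by (rule integrable_const_bound[of _ 1]) (use nn p_nn p_le in \<open>auto elim!: eventually_mono\<close>)
  have pmf: "pmf (limit_degree M Z) k = (\<integral>x. p k x \<partial>M)" for k
    unfolding pmf_limit_degree[OF M Z nn] limit_degree_mass_def p_def z1_def[symmetric] Let_def by simp
  have "(\<integral>\<^sup>+k. ennreal (f k) \<partial>measure_pmf (limit_degree M Z)) =
      (\<Sum>k. ennreal (\<integral>x. p k x \<partial>M) * ennreal (f k))"
    by (simp add: nn_integral_measure_pmf nn_integral_count_space_nat pmf)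
  also have "\<dots> = (\<Sum>k. \<integral>\<^sup>+x. ennreal (p k x * f k) \<partial>M)"
  proof (rule suminf_cong)
    fix k
    have "ennreal (\<integral>x. p k x \<partial>M) = (\<integral>\<^sup>+x. ennreal (p k x) \<partial>M)"
      by (rule nn_integral_eq_integral[symmetric, OF p_int]) (use nn p_nn in \<open>auto elim!: eventually_mono\<close>)
    then show "ennreal (\<integral>x. p k x \<partial>M) * ennreal (f k) = (\<integral>\<^sup>+x. ennreal (p k x * f k) \<partial>M)"
      using f_nn by (simp add: nn_integral_multc ennreal_mult'')
  qed
  also have "\<dots> = (\<integral>\<^sup>+x. (\<Sum>k. ennreal (p k x * f k)) \<partial>M)"
    by (rule nn_integral_suminf[symmetric]) measurable
  also have "\<dots> = (\<integral>\<^sup>+x. ennreal ((z1 * Z x) ^ i) \<partial>M)"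
  proof (rule nn_integral_cong_AE, use nn in eventually_elim)
    case (elim x)
    have "(\<lambda>k. p k x * f k) sums (z1 * Z x) ^ i"
      using poisson_factorial_sums[of "z1 * Z x" i] by (simp add: p_def f_def)
    then show ?case
      using p_nn[OF elim] f_nn by (simp add: suminf_ennreal2 sums_iff)
  qed
  also have "\<dots> = ennreal (\<integral>x. (z1 * Z x) ^ i \<partial>M)"
    by (rule nn_integral_eq_integral)
      (use int nn z1 in \<open>auto simp: power_mult_distrib elim!: eventually_mono\<close>)
  also have "(\<integral>x. (z1 * Z x) ^ i \<partial>M) = z1 ^ i * (\<integral>x. Z x ^ i \<partial>M)"
    by (simp add: power_mult_distrib)
  finally have nni: "(\<integral>\<^sup>+k. ennreal (f k) \<partial>measure_pmf (limit_degree M Z)) = ennreal (z1 ^ i * (\<integral>x. Z x ^ i \<partial>M))" .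
  have "0 \<le> (\<integral>x. Z x ^ i \<partial>M)"
    by (rule integral_nonneg_AE) (use nn in \<open>auto elim!: eventually_mono\<close>)
  then have "0 \<le> z1 ^ i * (\<integral>x. Z x ^ i \<partial>M)" using z1 by simp
  then show ?thesis
    unfolding factorial_moment_def f_def[symmetric] z1_def[symmetric]
    using f_nn nni by (subst integral_eq_nn_integral) auto
qed

section \<open>The assortativity coefficient\<close>

context weak_size_sequence
begin

abbreviation "z k \<equiv> (\<integral>x. Z x ^ k \<partial>M)"

lemma moment_convergesI:
  assumes "integrable M (\<lambda>x. Z x ^ k)"
    and "(\<lambda>n. \<integral>D. scaled_size s n (m n) D ^ k \<partial>measure_pmf (active_sets n (m n) (P n))) \<longlonglongrightarrow> z k"
  shows "moment_converges k"
  unfolding moment_converges_def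
proof
  show "(\<lambda>n. mean (P n) (\<lambda>x. \<zeta> n x ^ k)) \<longlonglongrightarrow> z k"
    using assms(2) by (rule Lim_transform_eventually)
      (use eventually_ge_at_top[of 1] in eventually_elim, rule mean_scaled_size)
qed (rule assms)

lemma mean_pos:
  assumes "moment_converges k" "k \<ge> 1" "0 < z k"
  shows "0 < z 1"
proof -
  have "integrable M (\<lambda>x. Z x ^ 1)"
    using integrable_lower_moment[of k 1] assms by (simp add: moment_converges_def)
  then show ?thesis using first_moment_pos[OF assms(3) _ assms(2)] by simp
qed

lemma critical:
  assumes "moment_converges k" "k \<ge> 2" "0 < z k"
  shows "size_sequence_critical s m P \<beta> (sqrt \<beta> ^ 1 * z 1) (sqrt \<beta> ^ 2 * z 2)"
proof unfold_locales
  show "uniform_tail 1" "uniform_tail 2"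
    using uniform_tail_of_moment[OF assms(1)] assms(2) by auto
  show "moment_limit 1 (sqrt \<beta> ^ 1 * z 1)" "moment_limit 2 (sqrt \<beta> ^ 2 * z 2)"
    by (rule moment_limit_of_converges, rule lower_moment_converges[OF assms(1)], use assms(2) in simp)+
  show "0 < sqrt \<beta> ^ 1 * z 1"
    using mean_pos[OF assms(1) _ assms(3)] assms(2) \<beta>_pos by simp
qed (use \<beta>_pos ratio in auto)

text \<open>
  The Cauchy-Schwarz inequality for the measure with density \<open>Z\<close>; it makes the limiting denominator
  positive.
\<close>

lemma moment_variance:
  assumes "integrable M (\<lambda>x. Z x ^ 3)" and "0 < z 1"
  shows "(z 2)\<^sup>2 \<le> z 1 * z 3"
proof -
  \<comment> \<open>the mean of \<open>Z\<close> under the size-biased law, for which the expansion of the square is smallest\<close>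
  define c where "c = z 2 / z 1"
  have int: "integrable M (\<lambda>x. Z x ^ j)" if "j \<le> 3" for j
    using integrable_lower_moment[OF assms(1) that] .
  have int1: "integrable M Z" using int[of 1] by simp
  have "0 \<le> (\<integral>x. Z x * (Z x - c)\<^sup>2 \<partial>M)"
    by (rule integral_nonneg_AE) (use Z_nonneg in \<open>auto elim!: eventually_mono\<close>)
  also have "\<dots> = (\<integral>x. Z x ^ 3 - 2 * c * Z x ^ 2 + c\<^sup>2 * Z x ^ 1 \<partial>M)"
    by (rule Bochner_Integration.integral_cong)
      (simp_all add: power2_eq_square power3_eq_cube algebra_simps)
  also have "\<dots> = z 3 - 2 * c * z 2 + c\<^sup>2 * z 1"
    using int[of 1] int[of 2] int[of 3] int1 by simp
  finally have "0 \<le> z 1 * (z 3 - 2 * c * z 2 + c\<^sup>2 * z 1)" using assms(2) by simp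
  also have "\<dots> = z 1 * z 3 - (z 2)\<^sup>2"
    using assms(2) by (simp add: c_def power2_eq_square field_simps)
  finally show ?thesis by simp
qed

text \<open>
  The three expressions are compared through their common value \<open>l\<close> in terms of the moments of \<open>Z\<close>: the
  powers of \<open>sqrt \<beta>\<close> in the limits of the \<open>a\<^sub>k\<close> and the powers of the mean \<open>z 1\<close> in the factorial moments cancel
  except for a factor \<open>1 / sqrt \<beta>\<close>.
\<close>

lemma finite_third_moment_limits:
  assumes conv: "moment_converges 3" and pos: "0 < z 3"
  defines "l \<equiv> 1 / sqrt \<beta> * (z 1 / (z 1 * z 3 - (z 2)\<^sup>2 + z 2))"
  shows "(\<lambda>n. assortativity n (active_graph s n (m n) (P n))) \<longlonglongrightarrow> l"
    and "(\<lambda>n. size_moment s n (m n) (P n) 1 /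
      (1 / \<beta> * (size_moment s n (m n) (P n) 1 * size_moment s n (m n) (P n) 3
        - (size_moment s n (m n) (P n) 2)\<^sup>2) + size_moment s n (m n) (P n) 2)) \<longlonglongrightarrow> l"
    and "1 / sqrt \<beta> * (factorial_moment (limit_degree M Z) 1 powr (5/2) /
      (factorial_moment (limit_degree M Z) 3 * factorial_moment (limit_degree M Z) 1
        - (factorial_moment (limit_degree M Z) 2)\<^sup>2
        + factorial_moment (limit_degree M Z) 2 * factorial_moment (limit_degree M Z) 1)) = l"
proof -
  have int3: "integrable M (\<lambda>x. Z x ^ 3)" using conv by (simp add: moment_converges_def)
  have int: "integrable M (\<lambda>x. Z x ^ j)" if "j \<le> 3" for j
    using integrable_lower_moment[OF int3 that] .
  have z1: "0 < z 1" using mean_pos[OF conv _ pos] by simp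
  have var: "0 \<le> z 1 * z 3 - (z 2)\<^sup>2" using moment_variance[OF int3 z1] by simp
  have z2_ne: "z 2 \<noteq> 0"
  proof
    assume "z 2 = 0"
    then have "AE x in M. Z x ^ 2 = 0"
      using integral_nonneg_eq_0_iff_AE[OF int[of 2]] by simp
    then have "z 1 = (\<integral>x. 0 \<partial>M)" by (intro integral_cong_AE) auto
    then show False using z1 by simp
  qed
  have "0 \<le> z 2" by (rule integral_nonneg_AE) simp
  then have z2: "0 < z 2" using z2_ne by (rule order_le_neq_trans[OF _ not_sym])
  define b where "b = sqrt \<beta>"
  have b: "b > 0" "\<beta> = b\<^sup>2" using \<beta>_pos by (auto simp: b_def)
  interpret size_sequence_critical s m P \<beta> "sqrt \<beta> ^ 1 * z 1" "sqrt \<beta> ^ 2 * z 2"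
    by (rule critical[OF conv _ pos]) simp
  define d where "d = 1 / \<beta> * ((sqrt \<beta> ^ 1 * z 1) * (sqrt \<beta> ^ 3 * z 3) - (sqrt \<beta> ^ 2 * z 2)\<^sup>2) + sqrt \<beta> ^ 2 * z 2"
  have d_eq: "d = b\<^sup>2 * (z 1 * z 3 - (z 2)\<^sup>2 + z 2)"
    unfolding d_def b_def[symmetric] using b by (simp add: power2_eq_square power3_eq_cube field_simps)
  have d_pos: "d > 0" unfolding d_eq using b var z2 by simp
  have l_eq: "(sqrt \<beta> ^ 1 * z 1) / d = l"
    unfolding d_eq l_def b_def[symmetric] using b by (simp add: power2_eq_square)
  have tail3: "uniform_tail 3" by (rule uniform_tail_of_moment[OF conv]) auto
  have mom: "moment_limit j (sqrt \<beta> ^ j * z j)" if "j \<le> 3" for j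
    by (rule moment_limit_of_converges[OF lower_moment_converges[OF conv that]])
  show "(\<lambda>n. assortativity n (active_graph s n (m n) (P n))) \<longlonglongrightarrow> l"
    using r_limit[OF tail3 mom[of 3]] d_pos unfolding d_def[symmetric] l_eq by simp
  have a: "(\<lambda>n. size_moment s n (m n) (P n) j) \<longlonglongrightarrow> sqrt \<beta> ^ j * z j" if "j \<le> 3" for j
    using mom[OF that] unfolding moment_limit_def
    by (rule Lim_transform_eventually) (use eventually_ge_at_top[of 1] in eventually_elim, rule size_moment_eq[symmetric])
  have "(\<lambda>n. size_moment s n (m n) (P n) 1 /
      (1 / \<beta> * (size_moment s n (m n) (P n) 1 * size_moment s n (m n) (P n) 3
        - (size_moment s n (m n) (P n) 2)\<^sup>2) + size_moment s n (m n) (P n) 2)) \<longlonglongrightarrow> (sqrt \<beta> ^ 1 * z 1) / d"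
    unfolding d_def by (intro tendsto_intros a) (use d_pos in \<open>auto simp: d_def\<close>)
  then show "(\<lambda>n. size_moment s n (m n) (P n) 1 /
      (1 / \<beta> * (size_moment s n (m n) (P n) 1 * size_moment s n (m n) (P n) 3
        - (size_moment s n (m n) (P n) 2)\<^sup>2) + size_moment s n (m n) (P n) 2)) \<longlonglongrightarrow> l"
    unfolding l_eq .
  have \<delta>: "factorial_moment (limit_degree M Z) j = z 1 ^ j * z j" if "j \<le> 3" for j
    using factorial_moment_limit_degree[OF M Z Z_nonneg int[OF that]] by simp
  have powr: "(z 1 ^ 1 * z 1) powr (5/2) = z 1 ^ 5"
  proof -
    have "z 1 ^ 1 * z 1 = z 1 powr 2" using z1 by (simp add: power2_eq_square[symmetric])
    then have "(z 1 ^ 1 * z 1) powr (5/2) = z 1 powr 5" by (simp add: powr_powr)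
    then show ?thesis using z1 by simp
  qed
  have "z 1 ^ 3 * z 3 * (z 1 ^ 1 * z 1) - (z 1 ^ 2 * z 2)\<^sup>2 + z 1 ^ 2 * z 2 * (z 1 ^ 1 * z 1) =
      z 1 ^ 4 * (z 1 * z 3 - (z 2)\<^sup>2 + z 2)"
    by (simp add: power2_eq_square power3_eq_cube power4_eq_xxxx algebra_simps)
  moreover have "z 1 ^ 5 = z 1 ^ 4 * z 1" by (simp add: power_Suc2[symmetric])
  ultimately show "1 / sqrt \<beta> * (factorial_moment (limit_degree M Z) 1 powr (5/2) /
      (factorial_moment (limit_degree M Z) 3 * factorial_moment (limit_degree M Z) 1
        - (factorial_moment (limit_degree M Z) 2)\<^sup>2
        + factorial_moment (limit_degree M Z) 2 * factorial_moment (limit_degree M Z) 1)) = l"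
    using z1 by (simp only: \<delta>[of 1] \<delta>[of 2] \<delta>[of 3] powr l_def) simp
qed

lemma infinite_third_moment_limit:
  assumes conv: "moment_converges 2" and pos: "0 < z 2"
    and inf: "(\<integral>\<^sup>+x. ennreal (Z x ^ 3) \<partial>M) = \<infinity>"
  shows "(\<lambda>n. assortativity n (active_graph s n (m n) (P n))) \<longlonglongrightarrow> 0"
proof -
  interpret size_sequence_critical s m P \<beta> "sqrt \<beta> ^ 1 * z 1" "sqrt \<beta> ^ 2 * z 2"
    by (rule critical[OF conv _ pos]) simp
  show ?thesis by (rule r_vanishes) (rule truncated_third_moment_unbounded[OF inf])
qed

end

lemma tendsto_imp_smallo_one:
  fixes f :: "nat \<Rightarrow> real"
  assumes "f \<longlonglongrightarrow> 0"
  shows "f \<in> o(\<lambda>_. 1)"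
  by (rule smalloI_tendsto) (use assms in auto)

theorem theorem1:
  fixes s :: nat and m :: "nat \<Rightarrow> nat" and P :: "nat \<Rightarrow> nat pmf"
    and M :: "'a measure" and Z :: "'a \<Rightarrow> real" and \<beta> :: real
  defines "r \<equiv> (\<lambda>n. assortativity n (active_graph s n (m n) (P n)))"
    and "a \<equiv> (\<lambda>k n. size_moment s n (m n) (P n) k)"
    and "Z1 \<equiv> (\<lambda>n. scaled_size s n (m n))"
    and "sets_law \<equiv> (\<lambda>n. measure_pmf (active_sets n (m n) (P n)))"
    and "\<delta> \<equiv> factorial_moment (limit_degree M Z)"
  assumes "s > 0"
    and "\<And>n. n \<ge> 1 \<Longrightarrow> set_pmf (P n) \<subseteq> {0..m n}"
    and "filterlim m at_top sequentially"
    and "prob_space M" and "Z \<in> borel_measurable M"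
    and "weak_conv_m (\<lambda>n. distr (sets_law n) borel (Z1 n)) (distr M borel Z)"
    and "\<beta> > 0" and "(\<lambda>n. real (m n choose s) / real n) \<longlonglongrightarrow> \<beta>"
  shows "(integrable M (\<lambda>x. Z x ^ 3) \<and> 0 < (\<integral>x. Z x ^ 3 \<partial>M) \<and>
          (\<lambda>n. \<integral>D. Z1 n D ^ 3 \<partial>sets_law n) \<longlonglongrightarrow> (\<integral>x. Z x ^ 3 \<partial>M)
          \<longrightarrow>
          (\<lambda>n. r n - a 1 n / (1 / \<beta> * (a 1 n * a 3 n - (a 2 n)\<^sup>2) + a 2 n)) \<in> o(\<lambda>_. 1) \<and>
          (\<lambda>n. r n - 1 / sqrt \<beta> * (\<delta> 1 powr (5/2) / (\<delta> 3 * \<delta> 1 - (\<delta> 2)\<^sup>2 + \<delta> 2 * \<delta> 1)))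
            \<in> o(\<lambda>_. 1))
       \<and> (integrable M (\<lambda>x. Z x ^ 2) \<and> 0 < (\<integral>x. Z x ^ 2 \<partial>M) \<and>
          (\<lambda>n. \<integral>D. Z1 n D ^ 2 \<partial>sets_law n) \<longlonglongrightarrow> (\<integral>x. Z x ^ 2 \<partial>M) \<and>
          (\<integral>\<^sup>+x. ennreal (Z x ^ 3) \<partial>M) = \<infinity>
          \<longrightarrow> r \<in> o(\<lambda>_. 1))"
proof -
  interpret weak_size_sequence s m P M Z \<beta>
    using assms(6-) unfolding sets_law_def Z1_def
    by (intro weak_size_sequence.intro size_sequence.intro weak_size_sequence_axioms.intro)
  show ?thesis
  proof (intro conjI impI; elim conjE)
    assume "integrable M (\<lambda>x. Z x ^ 3)" and pos: "0 < z 3"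
      and "(\<lambda>n. \<integral>D. Z1 n D ^ 3 \<partial>sets_law n) \<longlonglongrightarrow> z 3"
    then have conv: "moment_converges 3"
      by (intro moment_convergesI) (auto simp: Z1_def sets_law_def)
    note lim = finite_third_moment_limits[OF conv pos]
    show "(\<lambda>n. r n - a 1 n / (1 / \<beta> * (a 1 n * a 3 n - (a 2 n)\<^sup>2) + a 2 n)) \<in> o(\<lambda>_. 1)"
      unfolding r_def a_def using tendsto_diff[OF lim(1,2)]
      by (intro tendsto_imp_smallo_one) simp
    show "(\<lambda>n. r n - 1 / sqrt \<beta> * (\<delta> 1 powr (5/2) / (\<delta> 3 * \<delta> 1 - (\<delta> 2)\<^sup>2 + \<delta> 2 * \<delta> 1))) \<in> o(\<lambda>_. 1)"
      unfolding r_def \<delta>_def lim(3) using lim(1)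
      by (intro tendsto_imp_smallo_one) (rule LIM_zero)
  next
    assume "integrable M (\<lambda>x. Z x ^ 2)" and pos: "0 < z 2"
      and "(\<lambda>n. \<integral>D. Z1 n D ^ 2 \<partial>sets_law n) \<longlonglongrightarrow> z 2"
      and inf: "(\<integral>\<^sup>+x. ennreal (Z x ^ 3) \<partial>M) = \<infinity>"
    then have conv: "moment_converges 2"
      by (intro moment_convergesI) (auto simp: Z1_def sets_law_def)
    show "r \<in> o(\<lambda>_. 1)"
      unfolding r_def by (intro tendsto_imp_smallo_one infinite_third_moment_limit conv pos inf)
  qed
qed

end
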